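(* Let $\mathbf{u}(\mathbf{x},t)$ be a divergence-free vector field on $\Omega$ with $\langle|\mathbf{u}|^2\rangle<\infty$. Then \[ Nu(\mathbf{u})\leq\inf\Big\{\Big\langle|\nabla\eta|^2+\big|\nabla\Delta^{-1}[\partial_t\eta+\mathrm{div}(\mathbf{u}\eta)]\big|^2\Big\rangle\ :\ \eta\in\mathcal{A},\ \eta|_{z=0}=1,\ \eta|_{z=1}=0\Big\}. \]
   Context: Let $\Omega=\mathbb{T}^2_{xy}\times[0,1]_z$ with $\mathbb{T}^2_{xy}\cong[0,l_x]\times[0,l_y]$ periodic. $\langle f\rangle=\limsup_{\tau\to\infty}\frac{1}{\tau|\Omega|}\int_0^\tau\int_\Omega f\,d\mathbf{x}\,dt$. $\Delta^{-1}$ denotes the inverse of the Laplacian on $\Omega$ with zero Dirichlet conditions at $z=0,1$ (periodic in $x,y$), mapping $H^{-1}(\Omega)\to H^1_0(\Omega)$. For divergence-free $\mathbf{u}=(u,v,w)$ with $\langle|\mathbf{u}|^2\rangle<\infty$, $Nu(\mathbf{u})=\langle|\nabla T|^2\rangle$ where $T$ is the weak solution of $\partial_tT+\mathbf{u}\cdot\nabla T=\Delta T$, $T|_{z=0}=1$, $T|_{z=1}=0$, with essentially bounded initial data (the value is independent of the initial data). The admissible set is $\mathcal{A}=\{\eta\in L^\infty([0,\infty);L^2(\Omega)):\ \eta(t)\in H^1(\Omega)\cap L^\infty(\Omega)\ \text{and}\ \partial_t\eta(t)\in H^{-1}(\Omega)\ \text{for a.e. }t\}$. *)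

theory Defs
  imports "HOL-Analysis.Analysis"
begin

text \<open>Points of the periodic slab are represented by vectors in real^3 (components 1,2,3 = x,y,z);
  functions live on all of real^3, only their values on the fundamental cell matter, and
  periodicity in x,y enters through the periodic test functions.\<close>

type_synonym pt = "real^3"

definition Om :: "real \<Rightarrow> real \<Rightarrow> pt set" where
  "Om lx ly = {p. 0 \<le> p$1 \<and> p$1 \<le> lx \<and> 0 \<le> p$2 \<and> p$2 \<le> ly \<and> 0 \<le> p$3 \<and> p$3 \<le> 1}"

definition C1fun :: "('a::euclidean_space \<Rightarrow> real) \<Rightarrow> bool" where
  "C1fun \<phi> \<longleftrightarrow> (\<forall>x. \<phi> differentiable (at x)) \<and>
     (\<forall>v. continuous_on UNIV (\<lambda>x. frechet_derivative \<phi> (at x) v))"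

definition sgrad :: "(pt \<Rightarrow> real) \<Rightarrow> pt \<Rightarrow> real^3" where
  "sgrad \<phi> p = (\<chi> i. frechet_derivative \<phi> (at p) (axis i 1))"

definition xy_periodic :: "real \<Rightarrow> real \<Rightarrow> (pt \<Rightarrow> real) \<Rightarrow> bool" where
  "xy_periodic lx ly \<phi> \<longleftrightarrow>
     (\<forall>p. \<phi> (p + lx *\<^sub>R axis 1 1) = \<phi> p \<and> \<phi> (p + ly *\<^sub>R axis 2 1) = \<phi> p)"

definition test0 :: "real \<Rightarrow> real \<Rightarrow> (pt \<Rightarrow> real) \<Rightarrow> bool" where
  "test0 lx ly \<phi> \<longleftrightarrow> C1fun \<phi> \<and> xy_periodic lx ly \<phi> \<and>
     (\<exists>\<delta>>0. \<forall>p. (p$3 < \<delta> \<or> 1 - \<delta> < p$3) \<longrightarrow> \<phi> p = 0)"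

definition L2 :: "real \<Rightarrow> real \<Rightarrow> (pt \<Rightarrow> real) \<Rightarrow> bool" where
  "L2 lx ly f \<longleftrightarrow> f \<in> borel_measurable (lebesgue_on (Om lx ly)) \<and>
     integrable (lebesgue_on (Om lx ly)) (\<lambda>p. (f p)^2)"

definition Linf :: "real \<Rightarrow> real \<Rightarrow> (pt \<Rightarrow> real) \<Rightarrow> bool" where
  "Linf lx ly f \<longleftrightarrow> f \<in> borel_measurable (lebesgue_on (Om lx ly)) \<and>
     (\<exists>C. AE p in lebesgue_on (Om lx ly). \<bar>f p\<bar> \<le> C)"

definition H1 :: "real \<Rightarrow> real \<Rightarrow> (pt \<Rightarrow> real) \<Rightarrow> (pt \<Rightarrow> real^3) \<Rightarrow> bool" where
  "H1 lx ly f G \<longleftrightarrow> L2 lx ly f \<and> (\<forall>i. L2 lx ly (\<lambda>p. G p $ i)) \<and>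
     (\<forall>\<phi>. test0 lx ly \<phi> \<longrightarrow> (\<forall>i.
        (\<integral>p. f p * sgrad \<phi> p $ i \<partial>lebesgue_on (Om lx ly)) =
        - (\<integral>p. G p $ i * \<phi> p \<partial>lebesgue_on (Om lx ly))))"

definition H10 :: "real \<Rightarrow> real \<Rightarrow> (pt \<Rightarrow> real) \<Rightarrow> (pt \<Rightarrow> real^3) \<Rightarrow> bool" where
  "H10 lx ly f G \<longleftrightarrow> H1 lx ly f G \<and>
     (\<exists>\<phi>. (\<forall>n. test0 lx ly (\<phi> n)) \<and>
        ((\<lambda>n. \<integral>\<^sup>+p. ennreal ((f p - \<phi> n p)^2 + (norm (G p - sgrad (\<phi> n) p))^2)
                \<partial>lebesgue_on (Om lx ly)) \<longlonglongrightarrow> 0))"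

text \<open>Boundary values f = 1 at z = 0 and f = 0 at z = 1 (f - (1 - z) in H^1_0).\<close>
definition bc10 :: "real \<Rightarrow> real \<Rightarrow> (pt \<Rightarrow> real) \<Rightarrow> (pt \<Rightarrow> real^3) \<Rightarrow> bool" where
  "bc10 lx ly f G \<longleftrightarrow> H10 lx ly (\<lambda>p. f p - (1 - p$3)) (\<lambda>p. G p + axis 3 1)"

definition Hm1 :: "real \<Rightarrow> real \<Rightarrow> ((pt \<Rightarrow> real) \<Rightarrow> real) \<Rightarrow> bool" where
  "Hm1 lx ly g \<longleftrightarrow>
     (\<forall>f1 G1 f2 G2 a b. H10 lx ly f1 G1 \<and> H10 lx ly f2 G2 \<longrightarrow>
         g (\<lambda>p. a * f1 p + b * f2 p) = a * g f1 + b * g f2) \<and>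
     (\<exists>C. \<forall>f G. H10 lx ly f G \<longrightarrow>
         \<bar>g f\<bar> \<le> C * sqrt (\<integral>p. (f p)^2 + (norm (G p))^2 \<partial>lebesgue_on (Om lx ly)))"

definition dtime :: "(real \<times> pt \<Rightarrow> real) \<Rightarrow> real \<Rightarrow> pt \<Rightarrow> real" where
  "dtime \<phi> t p = frechet_derivative \<phi> (at (t, p)) (1, 0)"

definition tgrad :: "(real \<times> pt \<Rightarrow> real) \<Rightarrow> real \<Rightarrow> pt \<Rightarrow> real^3" where
  "tgrad \<phi> t p = (\<chi> i. frechet_derivative \<phi> (at (t, p)) (0, axis i 1))"

definition st_test :: "real \<Rightarrow> real \<Rightarrow> (real \<times> pt \<Rightarrow> real) \<Rightarrow> bool" where
  "st_test lx ly \<phi> \<longleftrightarrow> C1fun \<phi> \<and> (\<forall>t. xy_periodic lx ly (\<lambda>p. \<phi> (t, p))) \<and>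
     (\<exists>\<delta>>0. \<forall>t p. (p$3 < \<delta> \<or> 1 - \<delta> < p$3) \<longrightarrow> \<phi> (t, p) = 0) \<and>
     (\<exists>R. \<forall>t p. R \<le> t \<longrightarrow> \<phi> (t, p) = 0)"

definition st_test_pos :: "real \<Rightarrow> real \<Rightarrow> (real \<times> pt \<Rightarrow> real) \<Rightarrow> bool" where
  "st_test_pos lx ly \<phi> \<longleftrightarrow> st_test lx ly \<phi> \<and> (\<exists>\<delta>>0. \<forall>t p. t \<le> \<delta> \<longrightarrow> \<phi> (t, p) = 0)"

definition tavg :: "real \<Rightarrow> real \<Rightarrow> (real \<Rightarrow> pt \<Rightarrow> real) \<Rightarrow> ennreal" where
  "tavg lx ly f = Limsup at_top (\<lambda>\<tau>::real. ennreal (1 / (\<tau> * (lx * ly))) *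
      (\<integral>\<^sup>+x. ennreal (f (fst x) (snd x)) \<partial>lebesgue_on ({0..\<tau>} \<times> Om lx ly)))"

definition divfree :: "real \<Rightarrow> real \<Rightarrow> (real \<Rightarrow> pt \<Rightarrow> real^3) \<Rightarrow> bool" where
  "divfree lx ly u \<longleftrightarrow> (\<lambda>x. u (fst x) (snd x)) \<in> borel_measurable borel \<and>
     (AE t in lebesgue_on {0..}. \<forall>\<phi>. test0 lx ly \<phi> \<longrightarrow>
        (\<integral>p. u t p \<bullet> sgrad \<phi> p \<partial>lebesgue_on (Om lx ly)) = 0)"

text \<open>T (with weak spatial gradient GTe) is a weak solution of
  T_t + u.grad T = Lap T, T = 1 at z=0, T = 0 at z=1, T(0) = T0.\<close>
definition weak_sol :: "real \<Rightarrow> real \<Rightarrow> (real \<Rightarrow> pt \<Rightarrow> real^3) \<Rightarrow> (pt \<Rightarrow> real) \<Rightarrow>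
    (real \<Rightarrow> pt \<Rightarrow> real) \<Rightarrow> (real \<Rightarrow> pt \<Rightarrow> real^3) \<Rightarrow> bool" where
  "weak_sol lx ly u T0 T GTe \<longleftrightarrow>
     (\<lambda>x. T (fst x) (snd x)) \<in> borel_measurable borel \<and>
     (\<lambda>x. GTe (fst x) (snd x)) \<in> borel_measurable borel \<and>
     (\<exists>C. AE x in lebesgue_on ({0..} \<times> Om lx ly). \<bar>T (fst x) (snd x)\<bar> \<le> C) \<and>
     (\<forall>\<tau>. (\<integral>\<^sup>+x. ennreal ((norm (GTe (fst x) (snd x)))^2) \<partial>lebesgue_on ({0..\<tau>} \<times> Om lx ly)) < \<infinity>) \<and>
     (AE t in lebesgue_on {0..}. H1 lx ly (T t) (GTe t) \<and> bc10 lx ly (T t) (GTe t)) \<and>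
     (\<forall>\<phi>. st_test lx ly \<phi> \<longrightarrow>
        integrable (lebesgue_on ({0..} \<times> Om lx ly))
          (\<lambda>x. - T (fst x) (snd x) * dtime \<phi> (fst x) (snd x)
               - T (fst x) (snd x) * (u (fst x) (snd x) \<bullet> tgrad \<phi> (fst x) (snd x))
               + GTe (fst x) (snd x) \<bullet> tgrad \<phi> (fst x) (snd x)) \<and>
        (\<integral>x. - T (fst x) (snd x) * dtime \<phi> (fst x) (snd x)
               - T (fst x) (snd x) * (u (fst x) (snd x) \<bullet> tgrad \<phi> (fst x) (snd x))
               + GTe (fst x) (snd x) \<bullet> tgrad \<phi> (fst x) (snd x)
            \<partial>lebesgue_on ({0..} \<times> Om lx ly))
        = (\<integral>p. T0 p * \<phi> (0, p) \<partial>lebesgue_on (Om lx ly)))"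

text \<open>Admissible set A, with g t the H^{-1}-valued distributional time derivative of eta.\<close>
definition admissible :: "real \<Rightarrow> real \<Rightarrow> (real \<Rightarrow> pt \<Rightarrow> real) \<Rightarrow> (real \<Rightarrow> pt \<Rightarrow> real^3) \<Rightarrow>
    (real \<Rightarrow> (pt \<Rightarrow> real) \<Rightarrow> real) \<Rightarrow> bool" where
  "admissible lx ly \<eta> G\<eta> g \<longleftrightarrow>
     (\<lambda>x. \<eta> (fst x) (snd x)) \<in> borel_measurable borel \<and>
     (\<lambda>x. G\<eta> (fst x) (snd x)) \<in> borel_measurable borel \<and>
     (\<exists>C::real. AE t in lebesgue_on {0..}.
        (\<integral>\<^sup>+p. ennreal ((\<eta> t p)^2) \<partial>lebesgue_on (Om lx ly)) \<le> ennreal C) \<and>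
     (AE t in lebesgue_on {0..}. H1 lx ly (\<eta> t) (G\<eta> t) \<and> Linf lx ly (\<eta> t) \<and> Hm1 lx ly (g t)) \<and>
     (\<forall>\<phi>. st_test_pos lx ly \<phi> \<longrightarrow>
        integrable (lebesgue_on {0..}) (\<lambda>t. g t (\<lambda>p. \<phi> (t, p))) \<and>
        (\<integral>t. g t (\<lambda>p. \<phi> (t, p)) \<partial>lebesgue_on {0..}) =
          - (\<integral>x. \<eta> (fst x) (snd x) * dtime \<phi> (fst x) (snd x) \<partial>lebesgue_on ({0..} \<times> Om lx ly)))"

text \<open>psi t = Lap^{-1}[d_t eta + div(u eta)] (t), with weak gradient G\<psi> t:
  psi t in H^1_0 and -int grad psi . grad f = <g t, f> - int eta u . grad f for all f in H^1_0.\<close>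
definition inv_lap :: "real \<Rightarrow> real \<Rightarrow> (real \<Rightarrow> pt \<Rightarrow> real^3) \<Rightarrow> (real \<Rightarrow> pt \<Rightarrow> real) \<Rightarrow>
    (real \<Rightarrow> (pt \<Rightarrow> real) \<Rightarrow> real) \<Rightarrow> (real \<Rightarrow> pt \<Rightarrow> real) \<Rightarrow> (real \<Rightarrow> pt \<Rightarrow> real^3) \<Rightarrow> bool" where
  "inv_lap lx ly u \<eta> g \<psi> G\<psi> \<longleftrightarrow>
     (\<lambda>x. G\<psi> (fst x) (snd x)) \<in> borel_measurable borel \<and>
     (AE t in lebesgue_on {0..}. H10 lx ly (\<psi> t) (G\<psi> t) \<and>
        (\<forall>f G. H10 lx ly f G \<longrightarrow>
           - (\<integral>p. G\<psi> t p \<bullet> G p \<partial>lebesgue_on (Om lx ly)) =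
           g t f - (\<integral>p. \<eta> t p * (u t p \<bullet> G p) \<partial>lebesgue_on (Om lx ly))))"

end

(*
  Let theta = T - eta and let f = grad T - grad psi, so that theta_t + u . grad theta = div f weakly and
  theta vanishes at both plates. Testing with theta formally gives
  d/dt |theta|^2 / 2 = - int f . grad theta, and
  f . grad theta >= (|grad T|^2 - |grad eta|^2 - |grad psi|^2) / 2; since theta is bounded in L^2
  uniformly in time, the claim follows after dividing by the length of the time interval.

  Since u is only square integrable and eta(t) is not bounded uniformly in t, the test function theta is
  not admissible. It is replaced by beta'(theta) with beta x = (sqrt (1 + e x^2) - 1) / e, and the time
  derivative by a backward difference quotient: convexity of beta bounds
  (theta(t) - theta(t - h)) beta'(theta(t)) from below by beta(theta(t)) - beta(theta(t - h)). The remaining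
  terms become Steklov averages in time, which converge as h -> 0 by continuity of translations
  in L^1 and L^2, and the transport term vanishes in the limit because u is divergence free.
*)
theory Submission
  imports Defs
begin

section \<open>Square integrable functions\<close>

text \<open>Transport is the obstacle. With \<open>D\<close> the gradient of \<theta>, the term
  \<open>u \<bullet> D\<close> is a product of two square integrable fields, so it may be paired
  only with bounded functions, while the flux \<open>f\<close> has to meet a square integrable
  gradient. This shapes \<beta>: for fixed e its first derivative is bounded, and its second
  derivative lies between 0 and 1 and tends to 1 as e tends to 0.

  The equation is given against functions of space and time, so each spatial test function brings
  its own null set of times. But \<theta>(t) is approximated by test functions that depend on t, and
  one null set must serve them all. Averaging over the last h time units first, and then mollifying
  whole slices in L1, produces it.

  Since \<theta> is known for almost every time only, no initial value enters. The backward
  difference leaves a layer of width h before the starting time c > 0, whose energy is at most h * C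
  / 2; division by h leaves C / 2, whatever c, h and the horizon are. That is the source of the
  constant that long-time averaging finally removes.\<close>

lemma abs_mult_le_sum_squares: "\<bar>a * b\<bar> \<le> a^2 + (b::real)^2"
  using sum_squares_bound[of "\<bar>a\<bar>" "\<bar>b\<bar>"] abs_ge_zero[of "a*b"] by (simp only: abs_mult power2_abs)

lemma norm_diff_sq_le: "(norm (x - y))^2 \<le> 2 * (norm x)^2 + 2 * (norm (y::'a::real_normed_vector))^2"
proof -
  have "norm (x - y) \<le> norm x + norm y" by (rule norm_triangle_ineq4)
  then have "(norm (x - y))^2 \<le> (norm x + norm y)^2" by (intro power_mono) auto
  also have "\<dots> \<le> 2 * (norm x)^2 + 2 * (norm y)^2"
    using sum_squares_bound[of "norm x" "norm y"] by (simp add: power2_sum)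
  finally show ?thesis .
qed

lemma abs_inner_le: "norm v \<le> m \<Longrightarrow> \<bar>f \<bullet> v\<bar> \<le> m * norm (f :: 'a::real_inner)"
  using Cauchy_Schwarz_ineq2[of f v] mult_left_mono[of "norm v" m "norm f"] by (simp add: mult.commute)

lemma abs_inner_le_squares: "\<bar>f \<bullet> v\<bar> \<le> (norm f)^2 + (norm (v :: 'a::real_inner))^2"
  using Cauchy_Schwarz_ineq2[of f v] abs_mult_le_sum_squares[of "norm f" "norm v"] by simp

lemma abs_integral_le:
  fixes f :: "'a \<Rightarrow> real"
  assumes "integrable M f" "integrable M g" "\<And>x. \<bar>f x\<bar> \<le> g x"
  shows "\<bar>\<integral>x. f x \<partial>M\<bar> \<le> (\<integral>x. g x \<partial>M)"
  using order_trans[OF integral_norm_bound integral_mono[OF integrable_norm[OF assms(1)] assms(2)]] assms(3) by simp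

text \<open>Test functions are continuous on the whole space but controlled only on the compact
  cell, so the bound on \<open>v\<close> is asked on \<open>Q\<close> alone, outside of which
  \<open>F\<close> vanishes.\<close>

lemma integrable_inner_bounded:
  fixes F v :: "'a::euclidean_space \<Rightarrow> 'v::euclidean_space"
  assumes F: "integrable lborel F" and [measurable]: "v \<in> borel_measurable borel"
    and b: "\<And>x. x \<in> Q \<Longrightarrow> norm (v x) \<le> m" and z: "\<And>x. x \<notin> Q \<Longrightarrow> F x = 0"
  shows "integrable lborel (\<lambda>x. F x \<bullet> v x)"
proof (rule Bochner_Integration.integrable_bound[OF integrable_mult_right[OF integrable_norm[OF F], of "\<bar>m\<bar>"]])
  have [measurable]: "F \<in> borel_measurable borel" using borel_measurable_integrable[OF F] by simp
  show "(\<lambda>x. F x \<bullet> v x) \<in> borel_measurable lborel" by measurable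
  have "\<bar>F x \<bullet> v x\<bar> \<le> \<bar>m\<bar> * norm (F x)" for x
    using abs_inner_le[of "v x" "\<bar>m\<bar>" "F x"] b[of x] z[of x] by (cases "x \<in> Q") auto
  then show "AE x in lborel. norm (F x \<bullet> v x) \<le> norm (\<bar>m\<bar> * norm (F x))" by (simp add: abs_mult)
qed

lemma integrable_inner_L2:
  fixes f g :: "'a \<Rightarrow> 'b::euclidean_space"
  assumes [measurable]: "f \<in> borel_measurable M" "g \<in> borel_measurable M"
    and f: "integrable M (\<lambda>x. (norm (f x))^2)" and g: "integrable M (\<lambda>x. (norm (g x))^2)"
  shows "integrable M (\<lambda>x. norm (f x) * norm (g x))" "integrable M (\<lambda>x. f x \<bullet> g x)"
proof -
  show 1: "integrable M (\<lambda>x. norm (f x) * norm (g x))"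
    by (rule Bochner_Integration.integrable_bound[OF Bochner_Integration.integrable_add[OF f g]])
       (use abs_mult_le_sum_squares[of "norm (f _)" "norm (g _)"] in \<open>auto simp: abs_mult\<close>)
  show "integrable M (\<lambda>x. f x \<bullet> g x)"
    by (rule Bochner_Integration.integrable_bound[OF 1]) (auto simp: Cauchy_Schwarz_ineq2)
qed

lemma integrable_L2_scaleR:
  fixes f :: "'a \<Rightarrow> real" and g :: "'a \<Rightarrow> 'v::euclidean_space"
  assumes [measurable]: "f \<in> borel_measurable M" "g \<in> borel_measurable M"
    and "integrable M (\<lambda>x. (f x)^2)" "integrable M (\<lambda>x. (norm (g x))^2)"
  shows "integrable M (\<lambda>x. f x *\<^sub>R g x)"
proof (rule Bochner_Integration.integrable_bound[OF Bochner_Integration.integrable_add[OF assms(3,4)]])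
  show "AE x in M. norm (f x *\<^sub>R g x) \<le> norm ((f x)^2 + (norm (g x))^2)"
    using abs_mult_le_sum_squares[of "f _" "norm (g _)"] by (auto simp: abs_mult)
qed measurable

lemma integrable_L2_diff:
  fixes f g :: "'a \<Rightarrow> 'v::euclidean_space"
  assumes [measurable]: "f \<in> borel_measurable M" "g \<in> borel_measurable M"
    and f: "integrable M (\<lambda>x. (norm (f x))^2)" and g: "integrable M (\<lambda>x. (norm (g x))^2)"
  shows "integrable M (\<lambda>x. (norm (f x - g x))^2)"
  by (rule Bochner_Integration.integrable_bound[OF Bochner_Integration.integrable_add
            [OF integrable_mult_right[OF f, of 2] integrable_mult_right[OF g, of 2]]])
     (use norm_diff_sq_le[of "f _" "g _"] in auto)

lemma integrable_L2_imp_L1: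
  fixes F :: "'a::euclidean_space \<Rightarrow> 'v::euclidean_space"
  assumes [measurable]: "F \<in> borel_measurable borel" "Q \<in> sets borel" and F: "integrable lborel (\<lambda>x. (norm (F x))^2)"
    and fin: "emeasure lborel Q < \<infinity>" and z: "\<And>x. x \<notin> Q \<Longrightarrow> F x = 0"
  shows "integrable lborel F"
proof (rule Bochner_Integration.integrable_bound)
  show "integrable lborel (\<lambda>x. indicator Q x + (norm (F x))^2 :: real)" using F fin by simp
  have "a \<le> 1 + a^2" for a :: real using sum_squares_bound[of a 1] zero_le_power2[of a] unfolding power_one mult_1_right by linarith
  then show "AE x in lborel. norm (F x) \<le> norm (indicator Q x + (norm (F x))^2 :: real)"
    using z by (intro AE_I2) (auto simp: indicator_def)
qed simp

section \<open>Continuity of translations\<close>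

lemma integral_lborel_translate:
  fixes f :: "'a::euclidean_space \<Rightarrow> 'b::{banach,second_countable_topology}"
  assumes [measurable]: "f \<in> borel_measurable borel"
  shows "(LBINT x. f (x + a)) = (LBINT x. f x)"
proof -
  have "(LBINT x. f x) = (\<integral>x. f x \<partial>(distr lborel borel ((+) a)))"
    by (simp add: lborel_distr_plus)
  also have "\<dots> = (LBINT x. f (a + x))" by (rule integral_distr) auto
  finally show ?thesis by (simp add: add.commute)
qed

lemma integrable_lborel_translate:
  fixes f :: "'a::euclidean_space \<Rightarrow> 'b::{banach,second_countable_topology}"
  assumes "integrable lborel f"
  shows "integrable lborel (\<lambda>x. f (x + a))"
proof -
  have "integrable (distr lborel borel ((+) a)) f"
    using assms by (simp add: lborel_distr_plus)
  then have "integrable lborel (\<lambda>x. f (a + x))"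
    by (subst (asm) integrable_distr_eq) (use assms in auto)
  then show ?thesis by (simp add: add.commute)
qed

text \<open>The L1 distance of \<open>U\<close> and its translate is twice the measure of
  \<open>U\<close> minus twice the overlap. In an open set every point stays inside under small
  shifts, so the overlap integrand converges pointwise. It is dominated by the indicator of
  \<open>U\<close>, since the factor \<open>indicator U x\<close> removes all points outside
  \<open>U\<close>.\<close>

lemma translation_L1_open:
  fixes U :: "'a::euclidean_space set"
  assumes "open U" "emeasure lborel U < \<infinity>" "X \<longlonglongrightarrow> 0"
  shows "(\<lambda>n. LBINT x. \<bar>indicator U (x + X n) - indicator U x\<bar>) \<longlonglongrightarrow> (0::real)"
proof -
  have [measurable]: "U \<in> sets borel" using assms by auto
  have iU: "integrable lborel (indicator U :: 'a \<Rightarrow> real)" using assms by simp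
  have iT: "integrable lborel (\<lambda>x. indicator U (x + X n) :: real)" for n
    using integrable_lborel_translate[OF iU] .
  have iP: "integrable lborel (\<lambda>x. indicator U (x + X n) * indicator U x :: real)" for n
    by (rule Bochner_Integration.integrable_bound[OF iU]) (auto simp: indicator_def)
  have "(\<lambda>n. LBINT x. indicator U (x + X n) * indicator U x) \<longlonglongrightarrow> (\<integral>x. indicator U x \<partial>lborel :: real)"
  proof (rule integral_dominated_convergence[where w="indicator U"])
    show "AE x in lborel. (\<lambda>n. indicator U (x + X n) * indicator U x) \<longlonglongrightarrow> (indicator U x :: real)"
    proof (rule AE_I2)
      fix x
      show "(\<lambda>n. indicator U (x + X n) * indicator U x) \<longlonglongrightarrow> (indicator U x :: real)"
      proof (cases "x \<in> U")
        case True
        have "(\<lambda>n. x + X n) \<longlonglongrightarrow> x + 0" by (intro tendsto_intros assms)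
        then have "eventually (\<lambda>n. x + X n \<in> U) sequentially"
          using \<open>open U\<close> True by (simp add: topological_tendstoD)
        then show ?thesis
          by (intro tendsto_eventually) (auto elim!: eventually_mono simp: True)
      qed auto
    qed
  qed (use iU in \<open>auto simp: indicator_def\<close>)
  moreover have "(LBINT x. \<bar>indicator U (x + X n) - indicator U x\<bar>)
     = 2 * (LBINT x. indicator U x) - 2 * (\<integral>x. indicator U (x + X n) * indicator U x \<partial>lborel :: real)" for n
  proof -
    have "(LBINT x. \<bar>indicator U (x + X n) - indicator U x\<bar>)
      = (\<integral>x. indicator U (x + X n) + indicator U x - 2 * (indicator U (x + X n) * indicator U x) \<partial>lborel :: real)"
      by (intro Bochner_Integration.integral_cong) (auto simp: indicator_def)
    also have "\<dots> = (LBINT x. indicator U (x + X n)) + (LBINT x. indicator U x)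
       - 2 * (LBINT x. indicator U (x + X n) * indicator U x)"
      using iU iT iP by simp
    also have "(LBINT x. indicator U (x + X n)) = (\<integral>x. indicator U x \<partial>lborel :: real)"
      by (rule integral_lborel_translate) auto
    finally show ?thesis by simp
  qed
  moreover have "(\<lambda>n. 2 * c - 2 * z n) \<longlonglongrightarrow> 0" if "z \<longlonglongrightarrow> c" for z and c :: real
    using tendsto_diff[OF tendsto_const[of "2 * c"] tendsto_mult_left[OF that, of 2]] by simp
  ultimately show ?thesis by simp
qed

text \<open>Replacing \<open>f\<close> by \<open>g\<close> costs the distance twice: once at
  \<open>x\<close>, and once at the shifted point, where translation invariance removes the
  shift.\<close>

lemma norm_translate_diff_le:
  fixes f g :: "'a::euclidean_space \<Rightarrow> 'b::{banach,second_countable_topology}"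
  assumes f: "integrable lborel f" and g: "integrable lborel g"
  shows "(LBINT x. norm (f (x + a) - f x))
    \<le> 2 * (LBINT x. norm (f x - g x)) + (LBINT x. norm (g (x + a) - g x))"
proof -
  note i = f g integrable_lborel_translate[OF f, of a] integrable_lborel_translate[OF g, of a]
  have [measurable]: "f \<in> borel_measurable borel" "g \<in> borel_measurable borel"
    using f g by (auto dest: borel_measurable_integrable)
  have "(LBINT x. norm (f (x + a) - f x))
    \<le> (LBINT x. norm (f (x + a) - g (x + a)) + norm (f x - g x) + norm (g (x + a) - g x))"
  proof (rule integral_mono)
    fix x
    have "f (x + a) - f x = (f (x + a) - g (x + a)) + (- (f x - g x)) + (g (x + a) - g x)" by simp
    then show "norm (f (x + a) - f x) \<le> norm (f (x + a) - g (x + a)) + norm (f x - g x) + norm (g (x + a) - g x)"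
      by (metis (no_types, lifting) norm_minus_cancel norm_triangle_le norm_triangle_ineq add_right_mono)
  qed (use i in auto)
  also have "\<dots> = (LBINT x. norm (f (x + a) - g (x + a))) + (LBINT x. norm (f x - g x))
      + (LBINT x. norm (g (x + a) - g x))"
    using i by simp
  also have "(LBINT x. norm (f (x + a) - g (x + a))) = (LBINT x. norm (f x - g x))"
    by (rule integral_lborel_translate[where f="\<lambda>x. norm (f x - g x)"]) auto
  finally show ?thesis by simp
qed

text \<open>The functions with continuous translations are closed in L1: twice e / 4 for the
  replacement and e / 2 for the translate of \<open>g\<close>. Both the indicator case and the limit
  case of the induction below rest on this.\<close>

lemma translation_L1_approx:
  fixes f :: "'a::euclidean_space \<Rightarrow> 'b::{banach,second_countable_topology}"
  assumes f: "integrable lborel f"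
    and approx: "\<And>e::real. e > 0 \<Longrightarrow> \<exists>g. integrable lborel g \<and> (LBINT x. norm (f x - g x)) < e
        \<and> (\<lambda>n. LBINT x. norm (g (x + X n) - g x)) \<longlonglongrightarrow> 0"
  shows "(\<lambda>n. LBINT x. norm (f (x + X n) - f x)) \<longlonglongrightarrow> 0"
proof (rule LIMSEQ_I)
  fix e :: real assume "e > 0"
  then obtain g where g: "integrable lborel g" "(LBINT x. norm (f x - g x)) < e / 4"
      "(\<lambda>n. LBINT x. norm (g (x + X n) - g x)) \<longlonglongrightarrow> 0"
    using approx[of "e/4"] by auto
  obtain N where N: "\<And>n. n \<ge> N \<Longrightarrow> norm ((LBINT x. norm (g (x + X n) - g x)) - 0) < e / 2"
    using LIMSEQ_D[OF g(3), of "e/2"] \<open>e > 0\<close> by auto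
  have "norm ((LBINT x. norm (f (x + X n) - f x)) - 0) < e" if "n \<ge> N" for n
    using norm_translate_diff_le[OF f g(1), of "X n"] N[OF that] g(2) by (simp)
  then show "\<exists>N. \<forall>n\<ge>N. norm ((LBINT x. norm (f (x + X n) - f x)) - 0) < e" by blast
qed

text \<open>Induction over integrable functions. An indicator is approximated by an open superset
  through outer regularity, a sum is handled by the triangle inequality, and a limit by
  closedness.\<close>

lemma translation_L1:
  fixes F :: "'a::euclidean_space \<Rightarrow> 'b::{banach,second_countable_topology}"
  assumes "integrable lborel F" and X: "X \<longlonglongrightarrow> 0"
  shows "(\<lambda>n. LBINT x. norm (F (x + X n) - F x)) \<longlonglongrightarrow> 0"
  using assms(1)
proof (induction rule: integrable_induct)
  case (base A c)
  have [measurable]: "A \<in> sets borel" using base by simp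
  show ?case
  proof (rule translation_L1_approx)
    fix e :: real assume e: "e > 0"
    \<comment> \<open>The summand 1 keeps the denominator positive when \<open>c\<close> is
      zero.\<close>
    define e' where "e' = e / (norm c + 1)"
    have e': "e' > 0" and ce: "e' * norm c < e" using e
       by (auto simp: e'_def field_simps add_pos_nonneg)
    obtain U where U: "open U" "A \<subseteq> U" "emeasure lborel (U - A) < e'"
      using outer_regular_lborel[of A e'] e' by auto
    have [measurable]: "U \<in> sets borel" using U by simp
    have "emeasure lborel U = emeasure lborel (U - A) + emeasure lborel A"
      using U(2) by (subst plus_emeasure) (auto intro: arg_cong2[where f=emeasure])
    also have "\<dots> < \<infinity>" using U(3) base(2) by (auto simp: less_top intro: order_less_trans)
    finally have fU: "emeasure lborel U < \<infinity>" .
    let ?g = "\<lambda>x. indicator U x *\<^sub>R c"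
    have g: "integrable lborel ?g" using fU by simp
    have "(LBINT x. norm (indicator A x *\<^sub>R c - ?g x)) = (LBINT x. norm c * indicator (U - A) x)"
      using U(2) by (intro Bochner_Integration.integral_cong) (auto simp: indicator_def)
    also have "\<dots> = norm c * measure lborel (U - A)" by simp
    also have "\<dots> \<le> norm c * e'"
    proof (rule mult_left_mono)
      have "emeasure lborel (U - A) = ennreal (measure lborel (U - A))"
        using U(3) by (intro emeasure_eq_ennreal_measure) auto
      then show "measure lborel (U - A) \<le> e'" using U(3) e' by (simp add: ennreal_less_iff)
    qed auto
    also have "\<dots> < e" using ce by (simp add: mult.commute)
    finally have d: "(LBINT x. norm (indicator A x *\<^sub>R c - ?g x)) < e" .
    have "(\<lambda>n. norm c * (LBINT x. \<bar>indicator U (x + X n) - indicator U x\<bar>)) \<longlonglongrightarrow> norm c * 0"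
      by (intro tendsto_mult_left translation_L1_open U fU X)
    moreover have "(LBINT x. norm (?g (x + X n) - ?g x))
        = norm c * (LBINT x. \<bar>indicator U (x + X n) - indicator U x\<bar>)" for n
      by (subst integral_mult_right_zero[symmetric])
         (auto intro!: Bochner_Integration.integral_cong simp: mult.commute simp flip: scaleR_left_diff_distrib)
    ultimately show "\<exists>g. integrable lborel g \<and> (LBINT x. norm (indicator A x *\<^sub>R c - g x)) < e
        \<and> (\<lambda>n. LBINT x. norm (g (x + X n) - g x)) \<longlonglongrightarrow> 0"
      using g d by (intro exI[of _ ?g]) simp
  qed (use base in simp)
next
  case (add f g)
  have [measurable]: "f \<in> borel_measurable borel" "g \<in> borel_measurable borel"
    using add by (auto dest: borel_measurable_integrable)
  note i = add.hyps integrable_lborel_translate[OF add.hyps(1)] integrable_lborel_translate[OF add.hyps(2)]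
  show ?case
  proof (rule tendsto_sandwich[OF _ _ tendsto_const])
    show "(\<lambda>n. (LBINT x. norm (f (x + X n) - f x)) + (LBINT x. norm (g (x + X n) - g x))) \<longlonglongrightarrow> 0"
      using tendsto_add[OF add.IH] by simp
    show "\<forall>\<^sub>F n in sequentially. (LBINT x. norm (f (x + X n) + g (x + X n) - (f x + g x)))
      \<le> (LBINT x. norm (f (x + X n) - f x)) + (LBINT x. norm (g (x + X n) - g x))"
    proof (rule always_eventually, rule allI)
      fix n
      have "(LBINT x. norm (f (x + X n) + g (x + X n) - (f x + g x)))
        \<le> (LBINT x. norm (f (x + X n) - f x) + norm (g (x + X n) - g x))"
        using i by (intro integral_mono) (auto intro: norm_diff_triangle_ineq)
      then show "(LBINT x. norm (f (x + X n) + g (x + X n) - (f x + g x)))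
        \<le> (LBINT x. norm (f (x + X n) - f x)) + (LBINT x. norm (g (x + X n) - g x))"
        using i by simp
    qed
  qed auto
next
  case (lim f s)
  have [measurable]: "f \<in> borel_measurable borel" "s n \<in> borel_measurable borel" for n
    using lim by (auto dest: borel_measurable_integrable)
  have "(\<lambda>i. LBINT x. norm (f x - s i x)) \<longlonglongrightarrow> (\<integral>x. 0 \<partial>(lborel :: 'a measure))"
  \<comment> \<open>The majorant combines \<open>norm (f x)\<close> with the bound
    \<open>norm (s i x) \<le> 2 * norm (f x)\<close>, which is part of this induction case.\<close>
  proof (rule integral_dominated_convergence[where w="\<lambda>x. 3 * norm (f x)"])
    show "AE x in lborel. (\<lambda>i. norm (f x - s i x)) \<longlonglongrightarrow> 0"
    proof (rule AE_I2)
      fix x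
      have "(\<lambda>i. norm (f x - s i x)) \<longlonglongrightarrow> norm (f x - f x)" by (intro tendsto_intros lim.hyps(2)) auto
      then show "(\<lambda>i. norm (f x - s i x)) \<longlonglongrightarrow> 0" by simp
    qed
    show "AE x in lborel. norm (norm (f x - s i x)) \<le> 3 * norm (f x)" for i
    proof (rule AE_I2)
      fix x
      show "norm (norm (f x - s i x)) \<le> 3 * norm (f x)"
        using lim.hyps(3)[of x i] norm_triangle_ineq4[of "f x" "s i x"] by simp
    qed
  qed (use lim in auto)
  then have L: "(\<lambda>i. LBINT x. norm (f x - s i x)) \<longlonglongrightarrow> 0" by simp
  show ?case
  proof (rule translation_L1_approx[OF lim.hyps(4)])
    fix e :: real assume "e > 0"
    then obtain i where "norm ((LBINT x. norm (f x - s i x)) - 0) < e"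
      using LIMSEQ_D[OF L, of e] by blast
    then show "\<exists>g. integrable lborel g \<and> (LBINT x. norm (f x - g x)) < e
        \<and> (\<lambda>n. LBINT x. norm (g (x + X n) - g x)) \<longlonglongrightarrow> 0"
      using lim.hyps(1) lim.IH by (intro exI[of _ "s i"]) auto
  qed
qed

text \<open>Split \<open>b\<close> at height \<open>M\<close>. The bounded part meets the
  translation error in L1, which is already known to vanish. The tail \<open>c M\<close> is small in
  L2, and Young's inequality with weight \<open>d\<close> separates it from \<open>f\<close> and its
  translates, whose L2 norms all agree.\<close>

lemma translation_pairing_L2:
  fixes f b :: "'a::euclidean_space \<Rightarrow> 'v::euclidean_space"
  assumes f: "integrable lborel f" "integrable lborel (\<lambda>x. (norm (f x))^2)"
    and [measurable]: "b \<in> borel_measurable borel"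
    and b: "integrable lborel (\<lambda>x. (norm (b x))^2)" and X: "X \<longlonglongrightarrow> 0"
  shows "(\<lambda>n. LBINT x. f (x + X n) \<bullet> b x) \<longlonglongrightarrow> (LBINT x. f x \<bullet> b x)"
proof -
  have [measurable]: "f \<in> borel_measurable borel" using f(1) by (auto dest: borel_measurable_integrable)
  have f2t: "integrable lborel (\<lambda>x. (norm (f (x + a)))^2)" for a
    using integrable_lborel_translate[OF f(2), of a] by simp
  have f2i: "(LBINT x. (norm (f (x + a)))^2) = (LBINT x. (norm (f x))^2)" for a
    by (rule integral_lborel_translate[where f="\<lambda>x. (norm (f x))^2"]) simp
  define c where "c M x = (if norm (b x) \<le> real M then 0 else b x)" for M x
  have [measurable]: "c M \<in> borel_measurable borel" for M unfolding c_def by measurable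
  have c2: "integrable lborel (\<lambda>x. (norm (c M x))^2)" for M
    by (rule Bochner_Integration.integrable_bound[OF b]) (auto simp: c_def)
  have "(\<lambda>M. LBINT x. (norm (c M x))^2) \<longlonglongrightarrow> (\<integral>x. 0 \<partial>(lborel :: 'a measure))"
  proof (rule integral_dominated_convergence[where w="\<lambda>x. (norm (b x))^2"])
    show "AE x in lborel. (\<lambda>M. (norm (c M x))^2) \<longlonglongrightarrow> 0"
    proof (rule AE_I2)
      fix x
      obtain N where "norm (b x) \<le> real N" using real_arch_simple by blast
      then have "eventually (\<lambda>M. (norm (c M x))^2 = 0) sequentially"
        by (intro eventually_sequentiallyI[of N]) (auto simp: c_def)
      then show "(\<lambda>M. (norm (c M x))^2) \<longlonglongrightarrow> 0" by (rule tendsto_eventually)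
    qed
  qed (use b in \<open>auto simp: c_def\<close>)
  then have cL: "(\<lambda>M. LBINT x. (norm (c M x))^2) \<longlonglongrightarrow> 0" by simp
  let ?F = "LBINT x. (norm (f x))^2"
  have F0: "?F \<ge> 0" by simp
  have key: "\<bar>(LBINT x. f (x + a) \<bullet> b x) - (LBINT x. f x \<bullet> b x)\<bar>
     \<le> real M * (LBINT x. norm (f (x + a) - f x)) + (2 * d * ?F + (LBINT x. (norm (c M x))^2) / (2*d))"
     if "d > 0" for a M d
  proof -
    have p: "norm (f (x + a) - f x) * norm (b x) \<le> real M * norm (f (x + a) - f x)
        + (d * (norm (f (x+a)))^2 + d * (norm (f x))^2 + (norm (c M x))^2 / (2*d))" (is "?l \<le> ?r") for x
    proof (cases "norm (b x) \<le> real M")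
      case True
      then have "?l \<le> norm (f (x + a) - f x) * real M" by (intro mult_left_mono) auto
      then show ?thesis using that by (simp add: mult.commute add_increasing2)
    next
      case False
      let ?D = "norm (f (x + a) - f x)" and ?b = "norm (b x)" and ?u = "norm (f (x+a))" and ?v = "norm (f x)"
      have "(d/2) * ?D^2 \<le> (d/2) * (2 * ?u^2 + 2 * ?v^2)" using norm_diff_sq_le that by (intro mult_left_mono) auto
      then have "(d/2) * ?D^2 \<le> d * ?u^2 + d * ?v^2" by (simp add: algebra_simps)
      moreover have "?D * ?b \<le> (d/2) * ?D^2 + ?b^2 / (2*d)"
      proof -
        have "0 \<le> (d * ?D - ?b)^2 / (2*d)" using that by simp
        also have "\<dots> = (d/2) * ?D^2 + ?b^2 / (2*d) - ?D * ?b"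
          using that by (simp add: field_simps power2_eq_square)
        finally show ?thesis by simp
      qed
      moreover have "0 \<le> real M * ?D" by simp
      moreover have "c M x = b x" using False by (simp add: c_def)
      ultimately show ?thesis by (simp only:)
    qed
    have i1: "integrable lborel (\<lambda>x. f (x + a) \<bullet> b x)" "integrable lborel (\<lambda>x. f x \<bullet> b x)"
      using f2t b f(2) by (auto intro!: integrable_inner_L2)
    have iD: "integrable lborel (\<lambda>x. (f (x + a) - f x) \<bullet> b x)" using i1 by (simp add: inner_diff_left)
    have "integrable lborel (\<lambda>x. (norm (f (x + a) - f x))^2)"
      by (rule integrable_L2_diff) (use f2t f(2) in auto)
    then have i2: "integrable lborel (\<lambda>x. norm (f (x + a) - f x) * norm (b x))"
      using b by (intro integrable_inner_L2) auto
    have i3: "integrable lborel (\<lambda>x. norm (f (x + a) - f x))"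
      using f(1) integrable_lborel_translate[OF f(1), of a] by auto
    have "\<bar>(LBINT x. f (x + a) \<bullet> b x) - (LBINT x. f x \<bullet> b x)\<bar>
       = \<bar>LBINT x. (f (x + a) - f x) \<bullet> b x\<bar>"
      using i1 by (simp add: inner_diff_left)
    also have "\<dots> \<le> (LBINT x. norm (f (x + a) - f x) * norm (b x))"
      by (rule abs_integral_le[OF iD i2 Cauchy_Schwarz_ineq2])
    also have "\<dots> \<le> (LBINT x. real M * norm (f (x + a) - f x)
        + (d * (norm (f (x+a)))^2 + d * (norm (f x))^2 + (norm (c M x))^2 / (2*d)))"
      by (rule integral_mono[OF i2]) (use i3 f2t[of a] f(2) c2 p in auto)
    also have "\<dots> = real M * (LBINT x. norm (f (x + a) - f x))
        + (d * (LBINT x. (norm (f (x+a)))^2) + d * ?F + (LBINT x. (norm (c M x))^2) / (2*d))"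
      using i3 f2t[of a] f(2) c2[of M] by simp
    finally show ?thesis by (simp add: f2i)
  qed
  show ?thesis
  proof (rule LIMSEQ_I)
    fix e :: real assume e: "e > 0"
    \<comment> \<open>The order of choices matters: \<open>d\<close> makes the contribution of
      \<open>f\<close> at most e / 4, then \<open>M\<close> makes the tail divided by
      \<open>2 * d\<close> at most e / 4, and only then the shift is made small relative to
      \<open>M\<close>. The summand 1 covers the case that \<open>f\<close> vanishes.\<close>
    define d where "d = e / (8 * (?F + 1))"
    have d: "d > 0" using e F0 by (simp add: d_def add_nonneg_pos)
    have "e / (8 * z) * z = e / 8" if "z > 0" for z using that by simp
    from this[of "?F + 1"] have "d * (?F + 1) = e / 8" using F0 unfolding d_def by linarith
    then have dF: "2 * d * ?F \<le> e / 4" using d by (simp add: algebra_simps)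
    obtain M where "norm ((LBINT x. (norm (c M x))^2) - 0) < 2 * d * (e/4)"
      using LIMSEQ_D[OF cL, of "2 * d * (e/4)"] d e by auto
    then have cM: "(LBINT x. (norm (c M x))^2) / (2*d) \<le> e / 4"
      using d by (simp add: pos_divide_le_eq mult.commute)
    have "(\<lambda>n. real M * (LBINT x. norm (f (x + X n) - f x))) \<longlonglongrightarrow> real M * 0"
      by (intro tendsto_mult_left translation_L1 f X)
    from LIMSEQ_D[OF this, of "e/4"] e obtain N where
      N: "\<And>n. n \<ge> N \<Longrightarrow> norm (real M * (LBINT x. norm (f (x + X n) - f x)) - real M * 0) < e/4" by auto
    have "norm ((LBINT x. f (x + X n) \<bullet> b x) - (LBINT x. f x \<bullet> b x)) < e" if "n \<ge> N" for n
    proof -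
      have "real M * (LBINT x. norm (f (x + X n) - f x)) < e/4"
        using N[OF that] by simp
      then show ?thesis using key[OF d, of "X n" M] dF cM e by simp
    qed
    then show "\<exists>N. \<forall>n\<ge>N. norm ((LBINT x. f (x + X n) \<bullet> b x) - (LBINT x. f x \<bullet> b x)) < e" by blast
  qed
qed

section \<open>Slices in time\<close>

lemma lborel_Fubini:
  fixes f :: "'a::euclidean_space \<times> 'b::euclidean_space \<Rightarrow> 'c::{banach,second_countable_topology}"
  assumes "integrable lborel f"
  shows "integrable lborel (\<lambda>t. LBINT p. f (t, p))"
    "(LBINT t. (LBINT p. f (t, p))) = (LBINT x. f x)"
    "AE t in lborel. integrable lborel (\<lambda>p. f (t, p))"
proof -
  have f: "integrable (lborel \<Otimes>\<^sub>M lborel) f" using assms by (simp add: lborel_prod)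
  show "integrable lborel (\<lambda>t. LBINT p. f (t, p))" by (rule lborel_pair.integrable_fst'[OF f])
  show "(LBINT t. (LBINT p. f (t, p))) = (LBINT x. f x)"
    using lborel_pair.integral_fst'[OF f] by (simp add: lborel_prod)
  show "AE t in lborel. integrable lborel (\<lambda>p. f (t, p))" by (rule lborel_pair.AE_integrable_fst'[OF f])
qed

lemma lborel_Tonelli:
  fixes f :: "'a::euclidean_space \<times> 'b::euclidean_space \<Rightarrow> ennreal"
  assumes [measurable]: "f \<in> borel_measurable borel"
  shows "(\<integral>\<^sup>+t. (\<integral>\<^sup>+p. f (t, p) \<partial>lborel) \<partial>lborel) = (\<integral>\<^sup>+x. f x \<partial>lborel)"
proof -
  have "f \<in> borel_measurable (lborel \<Otimes>\<^sub>M lborel)" by (simp add: lborel_prod)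
  from lborel.nn_integral_fst[OF this] show ?thesis by (simp add: lborel_prod)
qed

lemma lborel_AE_slices:
  fixes P :: "'a::euclidean_space \<times> 'b::euclidean_space \<Rightarrow> bool"
  assumes "AE x in lborel. P x"
  shows "AE t in lborel. AE p in lborel. P (t, p)"
  using lborel_pair.AE_pair[unfolded lborel_prod, OF assms] .

lemma borel_measurable_fst_snd [measurable]:
  "fst \<in> (borel :: ('a::second_countable_topology \<times> 'b::second_countable_topology) measure) \<rightarrow>\<^sub>M borel"
  "snd \<in> (borel :: ('a::second_countable_topology \<times> 'b::second_countable_topology) measure) \<rightarrow>\<^sub>M borel"
  unfolding borel_prod[symmetric] by simp_all

definition hat :: "real \<Rightarrow> real" where "hat r = max 0 (1 - \<bar>r\<bar>)"

lemma hat_simps: "0 \<le> hat r" "hat r \<le> 1" "\<bar>r\<bar> \<ge> 1 \<Longrightarrow> hat r = 0" by (auto simp: hat_def)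

lemma continuous_hat [continuous_intros]: "continuous_on S f \<Longrightarrow> continuous_on S (\<lambda>x. hat (f x))"
  unfolding hat_def by (intro continuous_intros)

lemma borel_measurable_hat [measurable]: "hat \<in> borel_measurable borel"
  unfolding hat_def by measurable

lemma integrable_hat: "integrable lborel hat"
proof (rule Bochner_Integration.integrable_bound[where f="indicator {-1..1::real} :: real \<Rightarrow> real"])
  show "AE x in lborel. norm (hat x) \<le> norm (indicator {-1..1} x :: real)"
    by (rule AE_I2) (auto simp: hat_def indicator_def)
qed auto

lemma integral_hat_pos: "(LBINT r. hat r) > 0"
proof -
  have "(LBINT r. (1/2) * indicator {-1/2..1/2::real} r) \<le> (LBINT r. hat r)"
  proof (rule integral_mono[OF _ integrable_hat])
    show "(1/2) * indicator {-1/2..1/2::real} r \<le> hat r" for r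
      by (auto simp: hat_def indicator_def)
  qed auto
  then show ?thesis by simp
qed

text \<open>Averaging against an approximate identity in time produces an exceptional set of times that
  does not depend on the weight, so no separability of the set of weights is needed.\<close>
lemma AE_slices_orthogonal:
  fixes F :: "real \<times> 'p::euclidean_space \<Rightarrow> 'b::euclidean_space"
  assumes F: "integrable lborel F"
    and Wm: "\<And>w. w \<in> W \<Longrightarrow> w \<in> borel_measurable borel"
    and Wb: "\<And>w. w \<in> W \<Longrightarrow> \<exists>M. \<forall>p. norm (w p) \<le> M"
    and orth: "\<And>w a. w \<in> W \<Longrightarrow> continuous_on UNIV a \<Longrightarrow> (\<And>t. t \<notin> {c..d} \<Longrightarrow> a t = 0) \<Longrightarrow>
        (\<And>t. \<bar>a t\<bar> \<le> 1) \<Longrightarrow> (LBINT x. a (fst x) * (F x \<bullet> w (snd x))) = 0"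
  shows "AE t in lborel. c < t \<and> t < d \<longrightarrow> (\<forall>w\<in>W. (LBINT p. F (t, p) \<bullet> w p) = 0)"
proof -
  have [measurable]: "F \<in> borel_measurable borel" using F by (auto dest: borel_measurable_integrable)
  define X where "X k = inverse (real (Suc k))" for k
  have X0: "X \<longlonglongrightarrow> 0" unfolding X_def by (rule LIMSEQ_inverse_real_of_nat)
  have Xpos: "X k > 0" for k by (simp add: X_def)
  \<comment> \<open>No weight \<open>w\<close> occurs here: whole slices are compared in L1, so the
    times at which \<open>E\<close> tends to zero are fixed before \<open>w\<close> is
    chosen.\<close>
  define E where "E k t = (\<integral>\<^sup>+r. \<integral>\<^sup>+p. ennreal (hat r * norm (F (t + r * X k, p) - F (t, p))) \<partial>lborel \<partial>lborel)" for k t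
  have [measurable]: "E k \<in> borel_measurable borel" for k unfolding E_def by measurable
  define om where "om s = (LBINT x. norm (F (x + (s, 0)) - F x))" for s :: real
  have iF: "integrable lborel (\<lambda>x. norm (F (x + a) - F x))" for a
    using F integrable_lborel_translate[OF F] by auto
  have om0: "om s \<ge> 0" for s by (simp add: om_def)
  have om_m [measurable]: "om \<in> borel_measurable borel" unfolding om_def by measurable
  have om_le: "om s \<le> 2 * (LBINT x. norm (F x))" for s
  proof -
    have "om s \<le> (LBINT x. norm (F (x + (s, 0))) + norm (F x))"
      unfolding om_def using F integrable_lborel_translate[OF F] iF
      by (intro integral_mono) (auto intro: norm_triangle_ineq4)
    also have "\<dots> = (LBINT x. norm (F (x + (s, 0)))) + (LBINT x. norm (F x))"
      using F integrable_lborel_translate[OF F] by simp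
    also have "(LBINT x. norm (F (x + (s, 0)))) = (LBINT x. norm (F x))"
      by (rule integral_lborel_translate[where f="\<lambda>x. norm (F x)"]) auto
    finally show ?thesis by simp
  qed
  \<comment> \<open>Fubini turns the total of \<open>E k\<close> over all times into a tent average
    of the L1 translation modulus \<open>om\<close>, which tends to zero with the shift.\<close>
  have EI: "(\<integral>\<^sup>+t. E k t \<partial>lborel) = ennreal (LBINT r. hat r * om (r * X k))"
    and iho: "integrable lborel (\<lambda>r. hat r * om (r * X k))" for k
  proof -
    show i: "integrable lborel (\<lambda>r. hat r * om (r * X k))"
    proof (rule Bochner_Integration.integrable_bound)
      show "integrable lborel (\<lambda>r. hat r * (2 * (LBINT x. norm (F x))))"
        using integrable_hat by simp
      show "AE r in lborel. norm (hat r * om (r * X k)) \<le> norm (hat r * (2 * (LBINT x. norm (F x))))"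
        by (rule AE_I2) (use om_le om0 hat_simps in \<open>auto simp: abs_mult intro!: mult_mono\<close>)
    qed simp
    have "(\<integral>\<^sup>+t. E k t \<partial>lborel) =
      (\<integral>\<^sup>+r. \<integral>\<^sup>+t. \<integral>\<^sup>+p. ennreal (hat r * norm (F (t + r * X k, p) - F (t, p))) \<partial>lborel \<partial>lborel \<partial>lborel)"
      unfolding E_def by (rule lborel_pair.Fubini') measurable
    also have "\<dots> = (\<integral>\<^sup>+r. ennreal (hat r * om (r * X k)) \<partial>lborel)"
    proof (rule nn_integral_cong)
      fix r :: real
      have "(\<integral>\<^sup>+t. \<integral>\<^sup>+p. ennreal (hat r * norm (F (t + r * X k, p) - F (t, p))) \<partial>lborel \<partial>lborel)
         = (\<integral>\<^sup>+x. ennreal (hat r * norm (F (x + (r * X k, 0)) - F x)) \<partial>lborel)"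
        by (subst lborel_Tonelli[symmetric]) auto
      also have "\<dots> = ennreal (LBINT x. hat r * norm (F (x + (r * X k, 0)) - F x))"
        by (rule nn_integral_eq_integral) (use iF hat_simps in auto)
      finally show "(\<integral>\<^sup>+t. \<integral>\<^sup>+p. ennreal (hat r * norm (F (t + r * X k, p) - F (t, p))) \<partial>lborel \<partial>lborel)
        = ennreal (hat r * om (r * X k))" by (simp add: om_def)
    qed
    also have "\<dots> = ennreal (LBINT r. hat r * om (r * X k))"
      by (rule nn_integral_eq_integral[OF i]) (use om0 hat_simps in auto)
    finally show "(\<integral>\<^sup>+t. E k t \<partial>lborel) = ennreal (LBINT r. hat r * om (r * X k))" .
  qed
  have "(\<lambda>k. LBINT r. hat r * om (r * X k)) \<longlonglongrightarrow> (\<integral>r. 0 \<partial>(lborel :: real measure))"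
  proof (rule integral_dominated_convergence[where w="\<lambda>r. hat r * (2 * (LBINT x. norm (F x)))"])
    show "AE r in lborel. (\<lambda>k. hat r * om (r * X k)) \<longlonglongrightarrow> 0"
    proof (rule AE_I2)
      fix r
      have "(\<lambda>k. (r * X k, 0 :: 'p)) \<longlonglongrightarrow> (r * 0, 0)" by (intro tendsto_intros X0)
      then have "(\<lambda>k. om (r * X k)) \<longlonglongrightarrow> 0"
        unfolding om_def by (intro translation_L1 F) (simp add: zero_prod_def)
      from tendsto_mult_left[OF this, of "hat r"] show "(\<lambda>k. hat r * om (r * X k)) \<longlonglongrightarrow> 0" by simp
    qed
    show "AE r in lborel. norm (hat r * om (r * X k)) \<le> hat r * (2 * (LBINT x. norm (F x)))" for k
      by (rule AE_I2) (use om_le om0 hat_simps in \<open>auto simp: abs_mult intro!: mult_mono\<close>)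
  qed (use integrable_hat in auto)
  then have EL: "(\<lambda>k. LBINT r. hat r * om (r * X k)) \<longlonglongrightarrow> 0" by simp
  have fin: "AE t in lborel. E k t \<noteq> \<infinity>" for k
    by (rule nn_integral_PInf_AE) (auto simp: EI)
  have uE: "AE t in lborel. ennreal (enn2real (E k t)) = E k t" for k
    using fin[of k] by eventually_elim (simp add: less_top)
  have nE: "(\<integral>\<^sup>+t. ennreal (enn2real (E k t)) \<partial>lborel) = (\<integral>\<^sup>+t. E k t \<partial>lborel)" for k
    by (rule nn_integral_cong_AE[OF uE])
  have iE: "integrable lborel (\<lambda>t. enn2real (E k t))" for k
    by (rule integrableI_nonneg) (auto simp: nE EI)
  have "(LBINT t. norm (enn2real (E k t))) = (LBINT r. hat r * om (r * X k))" for k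
  proof -
    have "ennreal (LBINT t. enn2real (E k t)) = ennreal (LBINT r. hat r * om (r * X k))"
      using nn_integral_eq_integral[OF iE, of k] by (simp add: nE EI)
    then show ?thesis using om0 hat_simps by simp
  qed
  then have "(\<lambda>k. LBINT t. norm (enn2real (E k t))) \<longlonglongrightarrow> 0" using EL by simp
  \<comment> \<open>Convergence in mean yields convergence at almost every time only along a
    subsequence. That suffices, because the estimate \<open>key\<close> below holds for every large
    index.\<close>
  from tendsto_L1_AE_subseq[OF iE this] obtain \<kappa> where \<kappa>: "strict_mono \<kappa>"
     "AE t in lborel. (\<lambda>n. enn2real (E (\<kappa> n) t)) \<longlonglongrightarrow> 0" by auto
  have slice: "AE t in lborel. integrable lborel (\<lambda>p. F (t, p))" by (rule lborel_Fubini(3)[OF F])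
  have "AE t in lborel. \<forall>k. E k t \<noteq> \<infinity>" using fin by (simp add: AE_all_countable)
  with \<kappa>(2) slice show ?thesis
  proof eventually_elim
    case (elim t)
    show ?case
    proof (intro impI ballI)
      fix w assume t: "c < t \<and> t < d" and w: "w \<in> W"
      note [measurable] = Wm[OF w]
      obtain M0 where M0: "\<And>p. norm (w p) \<le> M0" using Wb[OF w] by blast
      define M where "M = \<bar>M0\<bar>"
      have M: "norm (w p) \<le> M" "M \<ge> 0" for p using M0[of p] by (auto simp: M_def)
      define D where "D s = (LBINT p. F (s, p) \<bullet> w p)" for s
      have [measurable]: "D \<in> borel_measurable borel" unfolding D_def by measurable
      have iw: "integrable lborel (\<lambda>p. f p \<bullet> w p)" if "integrable lborel f" for f :: "'p \<Rightarrow> 'b"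
        by (rule integrable_inner_bounded[where Q=UNIV, OF that _ M(1)]) auto
      have iFw: "integrable lborel (\<lambda>x. F x \<bullet> w (snd x))"
        by (rule integrable_inner_bounded[where Q=UNIV, OF F _ M(1)]) auto
      \<comment> \<open>From here on the tent of width \<open>X k\<close> around \<open>t\<close> is
        supported inside \<open>{c..d}\<close>, so the orthogonality hypothesis applies to
        it.\<close>
      obtain N where N: "\<And>k. k \<ge> N \<Longrightarrow> X k < min (t - c) (d - t)"
        using order_tendstoD(2)[OF X0, of "min (t - c) (d - t)"] t
        by (auto simp: eventually_sequentially)
      let ?c0 = "LBINT r. hat r"
      \<comment> \<open>The tent average of \<open>D\<close> around \<open>t\<close> is zero, hence
        \<open>D t\<close> times the tent mass is the average of the differences
        \<open>D t - D s\<close>. Each difference is at most \<open>M\<close> times the L1 distance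
        of the two slices.\<close>
      have key: "\<bar>D t\<bar> * ?c0 \<le> M * enn2real (E k t)" if k: "k \<ge> N" for k
      proof -
        let ?a = "\<lambda>s. hat ((s - t) / X k)"
        have az: "?a s = 0" if "s \<notin> {c..d}" for s
          using that N[OF k] Xpos[of k] t by (intro hat_simps) (auto simp: field_simps abs_if)
        have "integrable lborel (\<lambda>x. ?a (fst x) * (F x \<bullet> w (snd x)))"
          by (rule Bochner_Integration.integrable_bound[OF iFw]) (auto simp: abs_mult hat_simps mult_left_le_one_le)
        from lborel_Fubini[OF this] have i1: "integrable lborel (\<lambda>s. ?a s * D s)"
          and i1e: "(LBINT s. ?a s * D s) = (LBINT x. ?a (fst x) * (F x \<bullet> w (snd x)))"
          by (auto simp: D_def)
        note i1e
        also have "(LBINT x. ?a (fst x) * (F x \<bullet> w (snd x))) = 0"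
          by (rule orth[OF w _ az]) (auto intro!: continuous_intros simp: hat_simps Xpos less_imp_neq[OF Xpos, symmetric])
        finally have z: "(LBINT s. ?a s * D s) = 0" .
        have i2: "integrable lborel (\<lambda>r. hat r * D (t + X k * r))"
          using lborel_integrable_real_affine[OF i1, of "X k" t] Xpos[of k] by simp
        have "(LBINT r. hat r * D (t + X k * r)) = 0"
          using lborel_integral_real_affine[of "X k" "\<lambda>s. ?a s * D s" t] Xpos[of k] z by simp
        then have "D t * ?c0 = (LBINT r. hat r * (D t - D (t + X k * r)))"
          using i2 integrable_hat by (simp add: right_diff_distrib)
        then have "ennreal (\<bar>D t\<bar> * ?c0) = ennreal (norm (LBINT r. hat r * (D t - D (t + X k * r))))"
          using integral_hat_pos by (simp add: abs_mult flip: norm_mult) (metis abs_mult abs_of_pos real_norm_def)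
        also have "\<dots> \<le> (\<integral>\<^sup>+r. norm (hat r * (D t - D (t + X k * r))) \<partial>lborel)"
          by (rule integral_norm_bound_ennreal) (use i2 integrable_hat in \<open>simp add: right_diff_distrib\<close>)
        also have "\<dots> \<le> (\<integral>\<^sup>+r. ennreal M * \<integral>\<^sup>+p. ennreal (hat r * norm (F (t + r * X k, p) - F (t, p))) \<partial>lborel \<partial>lborel)"
        proof (rule nn_integral_mono_AE)
          have "AE s in lborel. (s \<noteq> s \<or> integrable lborel (\<lambda>p. F (s, p)))"
            using slice by simp
          \<comment> \<open>The change of variables from \<open>r\<close> to
            \<open>t + X k * r\<close> preserves null sets because \<open>X k\<close> is nonzero, so
            almost every \<open>r\<close> hits a time with an integrable slice.\<close>
          then have "AE r in lborel. integrable lborel (\<lambda>p. F (t + X k * r, p))"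
            using AE_borel_affine[of "X k" "\<lambda>s. integrable lborel (\<lambda>p. F (s, p))" t] slice Xpos[of k] by auto
          then show "AE r in lborel. ennreal (norm (hat r * (D t - D (t + X k * r))))
              \<le> ennreal M * \<integral>\<^sup>+p. ennreal (hat r * norm (F (t + r * X k, p) - F (t, p))) \<partial>lborel"
          proof eventually_elim
            case e: (elim r)
            let ?s = "t + X k * r"
            have "D t - D ?s = (LBINT p. (F (t, p) - F (?s, p)) \<bullet> w p)"
              using iw[OF e] iw[OF elim(2)] by (simp add: D_def inner_diff_left)
            then have "ennreal (norm (hat r * (D t - D ?s))) = ennreal (norm (LBINT p. hat r * ((F (t, p) - F (?s, p)) \<bullet> w p)))"
              by simp
            also have "\<dots> \<le> (\<integral>\<^sup>+p. norm (hat r * ((F (t, p) - F (?s, p)) \<bullet> w p)) \<partial>lborel)"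
              by (rule integral_norm_bound_ennreal) (use iw[OF e] iw[OF elim(2)] in \<open>simp add: inner_diff_left\<close>)
            also have "\<dots> \<le> (\<integral>\<^sup>+p. ennreal M * ennreal (hat r * norm (F (?s, p) - F (t, p))) \<partial>lborel)"
            proof (rule nn_integral_mono)
              fix p
              have "\<bar>(F (t, p) - F (?s, p)) \<bullet> w p\<bar> \<le> norm (F (?s, p) - F (t, p)) * M"
                using abs_inner_le[OF M(1), of "F (t, p) - F (?s, p)" p] by (simp add: norm_minus_commute mult.commute)
              then have "hat r * \<bar>(F (t, p) - F (?s, p)) \<bullet> w p\<bar> \<le> hat r * (norm (F (?s, p) - F (t, p)) * M)"
                using hat_simps by (intro mult_left_mono) auto
              then show "ennreal (norm (hat r * ((F (t, p) - F (?s, p)) \<bullet> w p))) \<le> ennreal M * ennreal (hat r * norm (F (?s, p) - F (t, p)))"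
                using M(2) hat_simps(1)[of r]
                by (simp add: ennreal_mult[symmetric] abs_mult mult_ac)
            qed
            also have "\<dots> = ennreal M * (\<integral>\<^sup>+p. ennreal (hat r * norm (F (?s, p) - F (t, p))) \<partial>lborel)"
              by (rule nn_integral_cmult) measurable
            finally show ?case by (simp add: mult.commute)
          qed
        qed
        also have "\<dots> = ennreal M * E k t"
          unfolding E_def by (rule nn_integral_cmult) measurable
        also have "\<dots> = ennreal (M * enn2real (E k t))"
          using elim(3) M(2) by (simp add: ennreal_mult less_top)
        finally show ?thesis using M(2) by (simp add: ennreal_le_iff)
      qed
      have "\<bar>D t\<bar> * ?c0 \<le> M * 0"
      proof (rule LIMSEQ_le_const)
        show "(\<lambda>n. M * enn2real (E (\<kappa> n) t)) \<longlonglongrightarrow> M * 0" by (intro tendsto_mult_left elim)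
        show "\<exists>N. \<forall>n\<ge>N. \<bar>D t\<bar> * ?c0 \<le> M * enn2real (E (\<kappa> n) t)"
          using key seq_suble[OF \<kappa>(1)] order_trans by blast
      qed
      then have "\<bar>D t\<bar> * ?c0 \<le> 0" by simp
      with integral_hat_pos have "D t = 0" by (simp add: mult_le_0_iff)
      then show "(LBINT p. F (t, p) \<bullet> w p) = 0" by (simp add: D_def)
    qed
  qed
qed

section \<open>Test functions\<close>

lemma C1funD:
  assumes "C1fun \<phi>"
  shows "(\<phi> has_derivative frechet_derivative \<phi> (at x)) (at x)"
    "continuous_on UNIV (\<lambda>x. frechet_derivative \<phi> (at x) v)"
    "continuous_on UNIV \<phi>"
proof -
  show *: "(\<phi> has_derivative frechet_derivative \<phi> (at x)) (at x)" for x
    using assms by (simp add: C1fun_def frechet_derivative_works[symmetric])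
  show "continuous_on UNIV (\<lambda>x. frechet_derivative \<phi> (at x) v)" using assms by (simp add: C1fun_def)
  show "continuous_on UNIV \<phi>" using * by (blast intro: continuous_at_imp_continuous_on has_derivative_continuous)
qed

lemma C1funI:
  assumes D: "\<And>x. (\<phi> has_derivative D x) (at x)" and c: "\<And>v. continuous_on UNIV (\<lambda>x. D x v)"
  shows "C1fun \<phi>" "frechet_derivative \<phi> (at x) = D x"
proof -
  show *: "frechet_derivative \<phi> (at x) = D x" for x using frechet_derivative_at[OF D] by simp
  show "C1fun \<phi>" unfolding C1fun_def using c D * by (auto simp: differentiable_def)
qed

lemma sgrad_nth: "sgrad \<phi> p $ i = frechet_derivative \<phi> (at p) (axis i 1)" by (simp add: sgrad_def)

lemma borel_measurable_vec_nth' [measurable (raw)]: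
  fixes f :: "'a \<Rightarrow> 'b::second_countable_topology ^ 'n"
  shows "f \<in> borel_measurable M \<Longrightarrow> (\<lambda>x. f x $ i) \<in> borel_measurable M"
  by (rule measurable_compose[OF _ borel_measurable_continuous_onI])
     (auto intro: continuous_intros)

lemma continuous_on_vec_nth: "continuous_on UNIV f \<Longrightarrow> continuous_on UNIV (\<lambda>x. f x $ i)"
  by (intro continuous_intros)

lemma sgrad_continuous:
  assumes "C1fun \<phi>"
  shows "continuous_on UNIV (sgrad \<phi>)"
  unfolding sgrad_def using C1funD(2)[OF assms] by (intro continuous_on_vec_lambda)

lemma sgrad_compose:
  assumes C: "C1fun \<phi>" and g: "\<And>x. (g has_real_derivative g' x) (at x)" and g': "continuous_on UNIV g'"
  shows "C1fun (\<lambda>p. g (\<phi> p))" "sgrad (\<lambda>p. g (\<phi> p)) p = g' (\<phi> p) *\<^sub>R sgrad \<phi> p"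
proof -
  have D: "((\<lambda>p. g (\<phi> p)) has_derivative (\<lambda>v. g' (\<phi> x) * frechet_derivative \<phi> (at x) v)) (at x)" for x
    using has_derivative_compose[OF C1funD(1)[OF C] g[unfolded has_field_derivative_def]] .
  have c: "continuous_on UNIV (\<lambda>x. g' (\<phi> x) * frechet_derivative \<phi> (at x) v)" for v
    by (intro continuous_intros C1funD(2,3)[OF C] continuous_on_compose2[OF g']) auto
  show "C1fun (\<lambda>p. g (\<phi> p))" by (rule C1funI(1)[OF D c])
  show "sgrad (\<lambda>p. g (\<phi> p)) p = g' (\<phi> p) *\<^sub>R sgrad \<phi> p"
    by (simp add: vec_eq_iff sgrad_nth C1funI(2)[OF D c])
qed

lemma sgrad_mult:
  assumes C: "C1fun \<phi>" "C1fun \<psi>"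
  shows "C1fun (\<lambda>p. \<phi> p * \<psi> p)" "sgrad (\<lambda>p. \<phi> p * \<psi> p) p = \<phi> p *\<^sub>R sgrad \<psi> p + \<psi> p *\<^sub>R sgrad \<phi> p"
proof -
  have D: "((\<lambda>p. \<phi> p * \<psi> p) has_derivative (\<lambda>v. \<phi> x * frechet_derivative \<psi> (at x) v + frechet_derivative \<phi> (at x) v * \<psi> x)) (at x)" for x
    by (intro has_derivative_mult C1funD(1) C)
  have c: "continuous_on UNIV (\<lambda>x. \<phi> x * frechet_derivative \<psi> (at x) v + frechet_derivative \<phi> (at x) v * \<psi> x)" for v
    by (intro continuous_intros C1funD(2,3) C)
  show "C1fun (\<lambda>p. \<phi> p * \<psi> p)" by (rule C1funI(1)[OF D c])
  show "sgrad (\<lambda>p. \<phi> p * \<psi> p) p = \<phi> p *\<^sub>R sgrad \<psi> p + \<psi> p *\<^sub>R sgrad \<phi> p"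
    by (simp add: vec_eq_iff sgrad_nth C1funI(2)[OF D c])
qed

lemma sgrad_diff:
  assumes C: "C1fun \<phi>" "C1fun \<psi>"
  shows "C1fun (\<lambda>p. \<phi> p - \<psi> p)" "sgrad (\<lambda>p. \<phi> p - \<psi> p) p = sgrad \<phi> p - sgrad \<psi> p"
proof -
  have D: "((\<lambda>p. \<phi> p - \<psi> p) has_derivative (\<lambda>v. frechet_derivative \<phi> (at x) v - frechet_derivative \<psi> (at x) v)) (at x)" for x
    by (intro has_derivative_diff C1funD(1) C)
  have c: "continuous_on UNIV (\<lambda>x. frechet_derivative \<phi> (at x) v - frechet_derivative \<psi> (at x) v)" for v
    by (intro continuous_intros C1funD(2,3) C)
  show "C1fun (\<lambda>p. \<phi> p - \<psi> p)" by (rule C1funI(1)[OF D c])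
  show "sgrad (\<lambda>p. \<phi> p - \<psi> p) p = sgrad \<phi> p - sgrad \<psi> p"
    by (simp add: vec_eq_iff sgrad_nth C1funI(2)[OF D c])
qed

lemma test0_compose:
  assumes \<phi>: "test0 lx ly \<phi>" and g: "\<And>x. (g has_real_derivative g' x) (at x)" and g': "continuous_on UNIV g'"
    and "g 0 = 0"
  shows "test0 lx ly (\<lambda>p. g (\<phi> p))"
  using \<phi> sgrad_compose(1)[OF _ g g', of \<phi>] \<open>g 0 = 0\<close> unfolding test0_def xy_periodic_def by fastforce

lemma test0_mult:
  assumes "test0 lx ly \<phi>" "test0 lx ly \<psi>"
  shows "test0 lx ly (\<lambda>p. \<phi> p * \<psi> p)"
  using assms sgrad_mult(1)[of \<phi> \<psi>] unfolding test0_def xy_periodic_def by (auto 4 4)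

lemma test0_diff:
  assumes "test0 lx ly \<phi>" "test0 lx ly \<psi>"
  shows "test0 lx ly (\<lambda>p. \<phi> p - \<psi> p)"
proof -
  obtain d1 d2 where "d1 > 0" "\<forall>p. p $ 3 < d1 \<or> 1 - d1 < p $ 3 \<longrightarrow> \<phi> p = 0"
     "d2 > 0" "\<forall>p. p $ 3 < d2 \<or> 1 - d2 < p $ 3 \<longrightarrow> \<psi> p = 0"
    using assms unfolding test0_def by blast
  then have "min d1 d2 > 0 \<and> (\<forall>p. p $ 3 < min d1 d2 \<or> 1 - min d1 d2 < p $ 3 \<longrightarrow> \<phi> p - \<psi> p = 0)"
    by auto
  then have "\<exists>d>0. \<forall>p. p $ 3 < d \<or> 1 - d < p $ 3 \<longrightarrow> \<phi> p - \<psi> p = 0" by blast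
  moreover have "xy_periodic lx ly (\<lambda>p. \<phi> p - \<psi> p)"
    using assms unfolding test0_def xy_periodic_def by simp
  ultimately show ?thesis
    using assms sgrad_diff(1)[of \<phi> \<psi>] unfolding test0_def by blast
qed

lemma test0_scale:
  assumes "test0 lx ly \<phi>"
  shows "test0 lx ly (\<lambda>p. c * \<phi> p)" "sgrad (\<lambda>p. c * \<phi> p) p = c *\<^sub>R sgrad \<phi> p"
proof -
  have D: "((\<lambda>x. c * x) has_real_derivative c) (at x)" for x by (auto intro!: derivative_eq_intros)
  show "test0 lx ly (\<lambda>p. c * \<phi> p)" by (rule test0_compose[OF assms D]) auto
  show "sgrad (\<lambda>p. c * \<phi> p) p = c *\<^sub>R sgrad \<phi> p"
    using sgrad_compose(2)[OF _ D, of \<phi> p] assms by (simp add: test0_def)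
qed

lemma test0_C1: "test0 lx ly \<phi> \<Longrightarrow> C1fun \<phi>" by (simp add: test0_def)

lemma test0_cont:
  assumes "test0 lx ly \<phi>"
  shows "continuous_on UNIV \<phi>" "continuous_on UNIV (sgrad \<phi>)"
    "\<phi> \<in> borel_measurable borel" "sgrad \<phi> \<in> borel_measurable borel"
proof -
  show "continuous_on UNIV \<phi>" "continuous_on UNIV (sgrad \<phi>)"
    using C1funD(3)[OF test0_C1[OF assms]] sgrad_continuous[OF test0_C1[OF assms]] by auto
  then show "\<phi> \<in> borel_measurable borel" "sgrad \<phi> \<in> borel_measurable borel"
    by (auto intro: borel_measurable_continuous_onI)
qed

section \<open>The periodic cell: measure, shifts, and integration by parts without boundary
  terms\<close>

lemma Om_eq: "Om lx ly = cbox 0 (\<chi> i. if i = 1 then lx else if i = 2 then ly else 1)"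
  by (auto simp: Om_def mem_box_cart forall_3)

lemma Om_compact: "compact (Om lx ly)" by (simp add: Om_eq)

lemma Om_borel [measurable]: "Om lx ly \<in> sets borel" by (simp add: Om_eq)

lemma Om_finite: "emeasure lborel (Om lx ly) < \<infinity>"
  unfolding Om_eq by (simp add: emeasure_lborel_cbox_eq)

text \<open>The definitions integrate against completed Lebesgue measure restricted to a set,
  whereas Fubini and translation invariance are applied on \<open>lborel\<close>. For Borel
  integrands the two agree after extension by zero, and this lemma is the passage between
  them.\<close>

lemma lebesgue_on_borel:
  fixes S :: "'a::euclidean_space set"
  assumes [measurable]: "S \<in> sets borel"
  shows
    "\<And>f. f \<in> borel_measurable borel \<Longrightarrow> (\<integral>\<^sup>+x. f x \<partial>lebesgue_on S) = (\<integral>\<^sup>+x. f x * indicator S x \<partial>lborel)"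
    "\<And>f :: 'a \<Rightarrow> 'b::{banach,second_countable_topology}. f \<in> borel_measurable borel \<Longrightarrow>
        (\<integral>x. f x \<partial>lebesgue_on S) = (LBINT x. indicator S x *\<^sub>R f x)"
    "\<And>f :: 'a \<Rightarrow> 'b::{banach,second_countable_topology}. f \<in> borel_measurable borel \<Longrightarrow>
        integrable (lebesgue_on S) f \<longleftrightarrow> integrable lborel (\<lambda>x. indicator S x *\<^sub>R f x)"
    "\<And>P. (AE x in lebesgue_on S. P x) \<longleftrightarrow> (AE x in lborel. x \<in> S \<longrightarrow> P x)"
proof -
  have S: "S \<in> sets lebesgue" by simp
  show "(\<integral>\<^sup>+x. f x \<partial>lebesgue_on S) = (\<integral>\<^sup>+x. f x * indicator S x \<partial>lborel)" if [measurable]: "f \<in> borel_measurable borel" for f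
    by (subst nn_integral_restrict_space) (auto simp: nn_integral_completion)
  show "(\<integral>x. f x \<partial>lebesgue_on S) = (LBINT x. indicator S x *\<^sub>R f x)" if [measurable]: "f \<in> borel_measurable borel"
    for f :: "'a \<Rightarrow> 'b::{banach,second_countable_topology}"
    by (subst integral_restrict_space) (auto simp: integral_completion)
  show "integrable (lebesgue_on S) f \<longleftrightarrow> integrable lborel (\<lambda>x. indicator S x *\<^sub>R f x)" if [measurable]: "f \<in> borel_measurable borel"
    for f :: "'a \<Rightarrow> 'b::{banach,second_countable_topology}"
    by (subst integrable_restrict_space) (auto simp: integrable_completion)
  show "(AE x in lebesgue_on S. P x) \<longleftrightarrow> (AE x in lborel. x \<in> S \<longrightarrow> P x)" for P
    by (subst AE_restrict_space_iff) (auto simp: AE_completion_iff)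
qed

lemma borel_measurable_lebesgue_on:
  "f \<in> borel_measurable borel \<Longrightarrow> f \<in> borel_measurable (lebesgue_on S)"
  by (intro measurable_restrict_space1 measurable_completion) simp

abbreviation MO :: "real \<Rightarrow> real \<Rightarrow> pt measure" where "MO lx ly \<equiv> lebesgue_on (Om lx ly)"

lemma finite_measure_MO: "finite_measure (MO lx ly)"
  using Om_finite[of lx ly] by (intro finite_measureI) (simp add: emeasure_restrict_space less_top[symmetric])

lemma test0_bounded:
  assumes "test0 lx ly \<phi>"
  obtains M where "\<And>p. p \<in> Om lx ly \<Longrightarrow> \<bar>\<phi> p\<bar> \<le> M" "\<And>p. p \<in> Om lx ly \<Longrightarrow> norm (sgrad \<phi> p) \<le> M" "M \<ge> 0"
proof -
  have "compact (\<phi> ` Om lx ly)" "compact (sgrad \<phi> ` Om lx ly)"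
    using test0_cont[OF assms] Om_compact by (auto intro!: compact_continuous_image intro: continuous_on_subset)
  then have "bounded (\<phi> ` Om lx ly)" "bounded (sgrad \<phi> ` Om lx ly)"
    by (auto intro: compact_imp_bounded)
  then obtain B C where "\<forall>p\<in>Om lx ly. norm (\<phi> p) \<le> B" "\<forall>p\<in>Om lx ly. norm (sgrad \<phi> p) \<le> C"
    unfolding bounded_iff by (metis imageI)
  then show ?thesis by (intro that[of "max 0 (max B C)"]) (auto simp: le_max_iff_disj)
qed

lemma integrable_MO_bounded:
  fixes f :: "pt \<Rightarrow> 'b::{banach,second_countable_topology}"
  assumes "f \<in> borel_measurable borel" "\<And>p. p \<in> Om lx ly \<Longrightarrow> norm (f p) \<le> M"
  shows "integrable (MO lx ly) f"
proof -
  interpret finite_measure "MO lx ly" by (rule finite_measure_MO)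
  show ?thesis
    by (rule integrable_const_bound[of _ M]) (use assms in \<open>auto intro: borel_measurable_lebesgue_on\<close>)
qed

text \<open>Half-open cells make the two pieces of the translated cell disjoint.\<close>
lemma periodic_shift:
  fixes w :: "pt \<Rightarrow> real"
  assumes [measurable]: "w \<in> borel_measurable borel" and bd: "\<And>p. p \<in> cball 0 R \<Longrightarrow> \<bar>w p\<bar> \<le> M"
    and per: "\<And>p. w (p + l *\<^sub>R axis i 1) = w p"
    and S: "\<And>p. p \<in> S \<longleftrightarrow> 0 \<le> p $ i \<and> p $ i < l \<and> Q p"
    and Q: "\<And>p s. Q (p + s *\<^sub>R axis i 1) = Q p"
    and [measurable]: "S \<in> sets borel" and SR: "S \<subseteq> cball 0 R" and s: "0 \<le> s" "s \<le> l"
    and fin: "emeasure lborel S < \<infinity>"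
  shows "(LBINT p. indicator S p * w (p + s *\<^sub>R axis i 1)) = (LBINT p. indicator S p * w p)"
proof -
  let ?e = "axis i 1 :: pt"
  \<comment> \<open>After the shift by \<open>s\<close>, \<open>g1\<close> carries the points that
    are still in the cell and \<open>g2\<close> those that left through the far face and are moved
    back by one period. Their positions \<open>s \<le> q $ i\<close> and \<open>q $ i < s\<close>
    partition the cell again.\<close>
  define g1 where "g1 q = indicator {q \<in> S. s \<le> q $ i} q * w q" for q
  define g2 where "g2 q = indicator {q \<in> S. q $ i < s} q * w q" for q
  have [measurable]: "{q \<in> S. s \<le> q $ i} \<in> sets borel" "{q \<in> S. q $ i < s} \<in> sets borel"
    by measurable
  have [measurable]: "g1 \<in> borel_measurable borel" "g2 \<in> borel_measurable borel"
    unfolding g1_def g2_def by measurable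
  have iS: "integrable lborel (\<lambda>p. indicator S p * M)" using fin by simp
  have i1: "integrable lborel g1"
    by (rule Bochner_Integration.integrable_bound[OF iS]) (use bd SR in \<open>force simp: g1_def indicator_def\<close>)+
  have i2: "integrable lborel g2"
    by (rule Bochner_Integration.integrable_bound[OF iS]) (use bd SR in \<open>force simp: g2_def indicator_def\<close>)+
  have perm: "w (q - l *\<^sub>R ?e) = w q" for q using per[of "q - l *\<^sub>R ?e"] by simp
  have "indicator S p * w (p + s *\<^sub>R ?e) = g1 (p + s *\<^sub>R ?e) + g2 (p + (s - l) *\<^sub>R ?e)" for p
  proof -
    have a: "(p + s *\<^sub>R ?e) $ i = p $ i + s" "(p + (s-l) *\<^sub>R ?e) $ i = p $ i + s - l" by auto
    have w: "w (p + (s-l) *\<^sub>R ?e) = w (p + s *\<^sub>R ?e)"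
      using perm[of "p + s *\<^sub>R ?e"] by (simp add: algebra_simps)
    have 1: "p + s *\<^sub>R ?e \<in> {q \<in> S. s \<le> q $ i} \<longleftrightarrow> p \<in> S \<and> p $ i + s < l"
      using s by (auto simp: S Q a simp del: vector_add_component)
    have 2: "p + (s-l) *\<^sub>R ?e \<in> {q \<in> S. q $ i < s} \<longleftrightarrow> p \<in> S \<and> \<not> p $ i + s < l"
      using s by (auto simp: S Q a simp del: vector_add_component)
    show ?thesis unfolding g1_def g2_def w using 1 2 by (auto simp: indicator_def)
  qed
  then have "(LBINT p. indicator S p * w (p + s *\<^sub>R ?e)) = (LBINT p. g1 (p + s *\<^sub>R ?e) + g2 (p + (s-l) *\<^sub>R ?e))"
    by simp
  also have "\<dots> = (LBINT p. g1 p) + (LBINT p. g2 p)"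
    using integrable_lborel_translate[OF i1] integrable_lborel_translate[OF i2]
    by (simp add: integral_lborel_translate)
  also have "\<dots> = (LBINT p. g1 p + g2 p)" using i1 i2 by simp
  also have "\<dots> = (LBINT p. indicator S p * w p)"
    by (intro Bochner_Integration.integral_cong) (auto simp: g1_def g2_def indicator_def)
  finally show ?thesis .
qed

lemma AE_nth_neq: "AE p in lborel. (p :: pt) $ i \<noteq> c"
proof -
  have "negligible {x :: pt. x \<bullet> axis i 1 = c}"
    by (rule negligible_standard_hyperplane) simp
  then have "AE x in lebesgue. x \<notin> {x :: pt. x \<bullet> axis i 1 = c}"
    by (intro AE_not_in) (simp add: negligible_iff_null_sets)
  then show ?thesis by (simp add: AE_completion_iff inner_axis)
qed

text \<open>Horizontally, a shift rearranges the cell up to periods, so every shift up to a full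
  period is allowed. Vertically, \<open>\<phi>\<close> vanishes near the plates and a small shift
  keeps its support inside; there the allowed size is half the width of the vanishing layer.\<close>

lemma integral_Om_shift:
  assumes \<phi>: "test0 lx ly \<phi>" and l: "0 < lx" "0 < ly"
  shows "\<exists>d>0. \<forall>s. 0 \<le> s \<and> s \<le> d \<longrightarrow>
    (LBINT p. indicator (Om lx ly) p * \<phi> (p + s *\<^sub>R axis i 1)) = (LBINT p. indicator (Om lx ly) p * \<phi> p)"
proof -
  note c = test0_cont[OF \<phi>]
  note [measurable] = c(3)
  have per: "\<And>p. \<phi> (p + lx *\<^sub>R axis 1 1) = \<phi> p" "\<And>p. \<phi> (p + ly *\<^sub>R axis 2 1) = \<phi> p"
    using \<phi> by (auto simp: test0_def xy_periodic_def)
  obtain R where R: "Om lx ly \<subseteq> cball 0 R"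
    using compact_imp_bounded[OF Om_compact] unfolding bounded_iff by (metis mem_cball_0 subsetI)
  have "compact (\<phi> ` cball 0 R)" by (intro compact_continuous_image continuous_on_subset[OF c(1)]) auto
  then have "bounded (\<phi> ` cball 0 R)" by (rule compact_imp_bounded)
  then obtain M where M: "\<And>p. p \<in> cball 0 R \<Longrightarrow> \<bar>\<phi> p\<bar> \<le> M"
    unfolding bounded_iff by (metis imageI real_norm_def)
  \<comment> \<open>The period \<open>l\<close> and the condition \<open>Q\<close> on the other
    coordinates are kept abstract, so that one argument covers both horizontal directions.\<close>
  have per_case: ?thesis
    if l: "l > 0" and per: "\<And>p. \<phi> (p + l *\<^sub>R axis i 1) = \<phi> p"
      and O: "\<And>p. p \<in> Om lx ly \<longleftrightarrow> 0 \<le> p $ i \<and> p $ i \<le> l \<and> Q p"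
      and Q: "\<And>p s. Q (p + s *\<^sub>R axis i 1) = Q p" for l Q
  proof (intro exI[of _ l] conjI allI impI l)
    fix s assume s: "0 \<le> s \<and> s \<le> l"
    define S where "S = {p \<in> Om lx ly. p $ i < l}"
    have [measurable]: "S \<in> sets borel" unfolding S_def by measurable
    \<comment> \<open>The closed cell and the half-open one differ by the face
      \<open>p $ i = l\<close>, which is a null set.\<close>
    have ae: "AE p in lborel. (indicator (Om lx ly) p :: real) = indicator S p"
      using AE_nth_neq[of i l] by eventually_elim (auto simp: indicator_def S_def O)
    have "(LBINT p. indicator S p * \<phi> (p + s *\<^sub>R axis i 1)) = (LBINT p. indicator S p * \<phi> p)"
    proof (rule periodic_shift[where R=R and M=M and l=l and Q=Q])
      show "p \<in> S \<longleftrightarrow> 0 \<le> p $ i \<and> p $ i < l \<and> Q p" for p by (auto simp: S_def O)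
      have "emeasure lborel S \<le> emeasure lborel (Om lx ly)" by (rule emeasure_mono) (auto simp: S_def)
      then show "emeasure lborel S < \<infinity>" using Om_finite by (rule le_less_trans)
    qed (use M per Q R s in \<open>auto simp: S_def\<close>)
    moreover have "(LBINT p. indicator (Om lx ly) p * \<phi> (p + r *\<^sub>R axis i 1)) = (LBINT p. indicator S p * \<phi> (p + r *\<^sub>R axis i 1))" for r
      by (rule integral_cong_AE) (use ae in auto)
    from this[of s] this[of 0] show "(LBINT p. indicator (Om lx ly) p * \<phi> (p + s *\<^sub>R axis i 1)) = (LBINT p. indicator (Om lx ly) p * \<phi> p)"
      using calculation by simp
  qed
  consider "i = 1" | "i = 2" | "i = 3" using exhaust_3 by blast
  then show ?thesis
  proof cases
    case 1
    show ?thesis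
      by (rule per_case[where l=lx and Q="\<lambda>p. 0 \<le> p$2 \<and> p$2 \<le> ly \<and> 0 \<le> p$3 \<and> p$3 \<le> 1"])
         (use l per 1 in \<open>auto simp: Om_def axis_def\<close>)
  next
    case 2
    show ?thesis
      by (rule per_case[where l=ly and Q="\<lambda>p. 0 \<le> p$1 \<and> p$1 \<le> lx \<and> 0 \<le> p$3 \<and> p$3 \<le> 1"])
         (use l per 2 in \<open>auto simp: Om_def axis_def\<close>)
  next
    case 3
    obtain d where d: "d > 0" "\<And>p. p $ 3 < d \<or> 1 - d < p $ 3 \<Longrightarrow> \<phi> p = 0"
      using \<phi> unfolding test0_def by blast
    show ?thesis
    proof (intro exI[of _ "d/2"] conjI allI impI)
      fix s assume s: "0 \<le> s \<and> s \<le> d / 2"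
      \<comment> \<open>Where \<open>\<phi>\<close> is nonzero at the shifted point, the shifted
        height lies between \<open>d\<close> and \<open>1 - d\<close>. With \<open>s\<close> at most
        \<open>d / 2\<close>, both heights are then between 0 and 1, so the indicator may be shifted
        along with \<open>\<phi>\<close>.\<close>
      have "indicator (Om lx ly) p * \<phi> (p + s *\<^sub>R axis i 1)
        = indicator (Om lx ly) (p + s *\<^sub>R axis i 1) * \<phi> (p + s *\<^sub>R axis i 1)" for p
      proof (cases "\<phi> (p + s *\<^sub>R axis i 1) = 0")
        case False
        then have "d \<le> p $ 3 + s" "p $ 3 + s \<le> 1 - d"
          using d(2)[of "p + s *\<^sub>R axis i 1"] 3 by force+
        then show ?thesis using s 3 d(1) by (auto simp: indicator_def Om_def axis_def)
      qed simp
      note * = this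
      show "(LBINT p. indicator (Om lx ly) p * \<phi> (p + s *\<^sub>R axis i 1)) = (LBINT p. indicator (Om lx ly) p * \<phi> p)"
        unfolding * by (intro integral_lborel_translate[where f="\<lambda>p. indicator (Om lx ly) p * \<phi> p"]) measurable
    qed (use d in auto)
  qed
qed

text \<open>The divergence theorem for a cell without effective boundary. Small shifts do not change
  the integral, so the difference quotients of \<open>\<phi>\<close> integrate to zero; the mean
  value theorem supplies the majorant for passing to the derivative.\<close>

lemma integral_sgrad_zero:
  assumes \<phi>: "test0 lx ly \<phi>" and l: "0 < lx" "0 < ly"
  shows "(\<integral>p. sgrad \<phi> p $ i \<partial>MO lx ly) = 0"
proof -
  note c = test0_cont[OF \<phi>]
  note [measurable] = c(3,4)
  let ?O = "Om lx ly" and ?e = "axis i 1 :: pt"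
  obtain d where d: "d > 0" "\<And>s. 0 \<le> s \<Longrightarrow> s \<le> d \<Longrightarrow>
    (LBINT p. indicator ?O p * \<phi> (p + s *\<^sub>R ?e)) = (LBINT p. indicator ?O p * \<phi> p)"
    using integral_Om_shift[OF assms, of i] by blast
  obtain R where R: "?O \<subseteq> cball 0 R"
    using compact_imp_bounded[OF Om_compact] unfolding bounded_iff by (metis mem_cball_0 subsetI)
  have "compact ((\<lambda>p. sgrad \<phi> p $ i) ` cball 0 (R + 1))" "compact (\<phi> ` cball 0 (R + 1))"
    by (intro compact_continuous_image continuous_on_subset[OF continuous_on_vec_nth[OF c(2)]] continuous_on_subset[OF c(1)]; simp)+
  then have "bounded ((\<lambda>p. sgrad \<phi> p $ i) ` cball 0 (R + 1))" "bounded (\<phi> ` cball 0 (R + 1))"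
    by (auto intro: compact_imp_bounded)
  then obtain M M' where M: "\<And>p. p \<in> cball 0 (R + 1) \<Longrightarrow> \<bar>sgrad \<phi> p $ i\<bar> \<le> M"
     and M': "\<And>p. p \<in> cball 0 (R + 1) \<Longrightarrow> \<bar>\<phi> p\<bar> \<le> M'"
    unfolding bounded_iff by (metis imageI real_norm_def)
  have der: "((\<lambda>s. \<phi> (p + s *\<^sub>R ?e)) has_real_derivative sgrad \<phi> (p + s *\<^sub>R ?e) $ i) (at s)" for p s
  proof -
    have "((\<lambda>s. p + s *\<^sub>R ?e) has_derivative (\<lambda>s. s *\<^sub>R ?e)) (at s)" by (auto intro!: derivative_eq_intros)
    from has_derivative_compose[OF this C1funD(1)[OF test0_C1[OF \<phi>]]]
    have "((\<lambda>s. \<phi> (p + s *\<^sub>R ?e)) has_derivative (\<lambda>r. frechet_derivative \<phi> (at (p + s *\<^sub>R ?e)) (r *\<^sub>R ?e))) (at s)" .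
    moreover have "frechet_derivative \<phi> (at (p + s *\<^sub>R ?e)) (r *\<^sub>R ?e) = sgrad \<phi> (p + s *\<^sub>R ?e) $ i * r" for r
      using linear_scale[OF has_derivative_linear[OF C1funD(1)[OF test0_C1[OF \<phi>]]]] by (simp add: sgrad_nth)
    ultimately show ?thesis by (simp add: has_field_derivative_def)
  qed
  \<comment> \<open>The steps are positive, at most \<open>d\<close> so that the shift identity
    applies, and at most 1 so that the segment from a point of the cell stays in the ball of radius
    \<open>R + 1\<close> on which the gradient is bounded.\<close>
  define X where "X k = min (min 1 d) (inverse (real (Suc k)))" for k
  have Xpos: "0 < X k" "X k \<le> 1" "X k \<le> d" for k using d by (auto simp: X_def)
  have "X \<longlonglongrightarrow> min (min 1 d) 0" unfolding X_def by (intro tendsto_intros LIMSEQ_inverse_real_of_nat)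
  then have X0: "X \<longlonglongrightarrow> 0" using d(1) by simp
  have "(\<lambda>k. LBINT p. indicator ?O p * ((\<phi> (p + X k *\<^sub>R ?e) - \<phi> p) / X k)) \<longlonglongrightarrow> (LBINT p. indicator ?O p * (sgrad \<phi> p $ i))"
  proof (rule integral_dominated_convergence[where w="\<lambda>p. indicator ?O p * M"])
    show "integrable lborel (\<lambda>p. indicator ?O p * M)" using Om_finite by simp
    show "AE p in lborel. (\<lambda>k. indicator ?O p * ((\<phi> (p + X k *\<^sub>R ?e) - \<phi> p) / X k)) \<longlonglongrightarrow> indicator ?O p * (sgrad \<phi> p $ i)"
    proof (rule AE_I2)
      fix p
      have "((\<lambda>h. (\<phi> (p + h *\<^sub>R ?e) - \<phi> p) / h) \<longlongrightarrow> sgrad \<phi> p $ i) (at 0)"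
        using der[of p 0] by (simp add: has_field_derivative_iff)
      then have "(\<lambda>k. (\<phi> (p + X k *\<^sub>R ?e) - \<phi> p) / X k) \<longlonglongrightarrow> sgrad \<phi> p $ i"
        by (rule filterlim_compose) (rule filterlim_atI[OF X0], use Xpos(1) in \<open>auto simp: less_imp_neq[symmetric]\<close>)
      then show "(\<lambda>k. indicator ?O p * ((\<phi> (p + X k *\<^sub>R ?e) - \<phi> p) / X k)) \<longlonglongrightarrow> indicator ?O p * (sgrad \<phi> p $ i)"
        by (rule tendsto_mult_left)
    qed
    show "AE p in lborel. norm (indicator ?O p * ((\<phi> (p + X k *\<^sub>R ?e) - \<phi> p) / X k)) \<le> indicator ?O p * M" for k
    proof (rule AE_I2)
      fix p
      show "norm (indicator ?O p * ((\<phi> (p + X k *\<^sub>R ?e) - \<phi> p) / X k)) \<le> indicator ?O p * M"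
      proof (cases "p \<in> ?O")
        case True
        obtain z where z: "0 < z" "z < X k" "\<phi> (p + X k *\<^sub>R ?e) - \<phi> (p + 0 *\<^sub>R ?e) = (X k - 0) * (sgrad \<phi> (p + z *\<^sub>R ?e) $ i)"
          using MVT2[of 0 "X k" "\<lambda>s. \<phi> (p + s *\<^sub>R ?e)" "\<lambda>s. sgrad \<phi> (p + s *\<^sub>R ?e) $ i"] der Xpos by blast
        have "norm (p + z *\<^sub>R ?e) \<le> norm p + norm (z *\<^sub>R ?e)" by (rule norm_triangle_ineq)
        also have "\<dots> \<le> R + 1" using True R z(1,2) Xpos(2)[of k] by (intro add_mono) auto
        finally have "\<bar>sgrad \<phi> (p + z *\<^sub>R ?e) $ i\<bar> \<le> M" by (intro M) simp
        then show ?thesis using True z Xpos(1)[of k] by simp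
      qed simp
    qed
  qed simp_all
  moreover have "(LBINT p. indicator ?O p * ((\<phi> (p + X k *\<^sub>R ?e) - \<phi> p) / X k)) = 0" for k
  proof -
    have i: "integrable lborel (\<lambda>p. indicator ?O p * \<phi> (p + s *\<^sub>R ?e))" if "0 \<le> s" "s \<le> 1" for s
    proof (rule Bochner_Integration.integrable_bound[where f="\<lambda>p. indicator ?O p * M'"])
      show "integrable lborel (\<lambda>p. indicator ?O p * M')" using Om_finite by simp
      have "norm (p + s *\<^sub>R ?e) \<le> R + 1" if "p \<in> ?O" for p
        using norm_triangle_ineq[of p "s *\<^sub>R ?e"] R that \<open>0 \<le> s\<close> \<open>s \<le> 1\<close> by fastforce
      then show "AE p in lborel. norm (indicator ?O p * \<phi> (p + s *\<^sub>R ?e)) \<le> norm (indicator ?O p * M')"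
        using M' by (intro AE_I2) (force simp: indicator_def)
    qed simp
    have "(LBINT p. indicator ?O p * ((\<phi> (p + X k *\<^sub>R ?e) - \<phi> p) / X k))
      = (LBINT p. (indicator ?O p * \<phi> (p + X k *\<^sub>R ?e) - indicator ?O p * \<phi> p) / X k)"
      by (simp add: right_diff_distrib)
    also have "\<dots> = 0" using i[of "X k"] i[of 0] Xpos[of k] d(2)[of "X k"] by simp
    finally show ?thesis .
  qed
  ultimately have "(LBINT p. indicator ?O p * (sgrad \<phi> p $ i)) = 0"
    by (simp only: LIMSEQ_const_iff)
  then show ?thesis by (simp add: lebesgue_on_borel)
qed

text \<open>Integration by parts is the vanishing mean gradient of a product of two test functions,
  and the constant sequence serves as approximation. This permits inserting classical test functions
  into the relation that defines the inverse Laplacian.\<close>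

lemma test0_H10:
  assumes \<phi>: "test0 lx ly \<phi>" and l: "0 < lx" "0 < ly"
  shows "H10 lx ly \<phi> (sgrad \<phi>)"
proof -
  note [measurable] = test0_cont(3,4)[OF \<phi>]
  obtain M where M: "\<And>p. p \<in> Om lx ly \<Longrightarrow> \<bar>\<phi> p\<bar> \<le> M" "\<And>p. p \<in> Om lx ly \<Longrightarrow> norm (sgrad \<phi> p) \<le> M" "M \<ge> 0"
    using test0_bounded[OF \<phi>] by blast
  have 1: "L2 lx ly \<phi>"
    unfolding L2_def using M(1,3)
    by (auto intro!: borel_measurable_lebesgue_on integrable_MO_bounded[where M="M^2"] simp: abs_le_square_iff[symmetric])
  have 2: "L2 lx ly (\<lambda>p. sgrad \<phi> p $ i)" for i
  proof -
    have "\<bar>sgrad \<phi> p $ i\<bar> \<le> M" if "p \<in> Om lx ly" for p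
      using M(2)[OF that] component_le_norm_cart[of "sgrad \<phi> p" i] by linarith
    then show ?thesis unfolding L2_def using M(3)
      by (auto intro!: borel_measurable_lebesgue_on integrable_MO_bounded[where M="M^2"] simp: abs_le_square_iff[symmetric])
  qed
  have 3: "(\<integral>p. \<phi> p * sgrad \<psi> p $ i \<partial>MO lx ly) = - (\<integral>p. sgrad \<phi> p $ i * \<psi> p \<partial>MO lx ly)" if \<psi>: "test0 lx ly \<psi>" for \<psi> i
  proof -
    note [measurable] = test0_cont(3,4)[OF \<psi>]
    obtain N where N: "\<And>p. p \<in> Om lx ly \<Longrightarrow> \<bar>\<psi> p\<bar> \<le> N" "\<And>p. p \<in> Om lx ly \<Longrightarrow> norm (sgrad \<psi> p) \<le> N" "N \<ge> 0"
      using test0_bounded[OF \<psi>] by blast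
    have a: "\<bar>sgrad \<phi> p $ i\<bar> \<le> M" "\<bar>sgrad \<psi> p $ i\<bar> \<le> N" if "p \<in> Om lx ly" for p
      using M(2)[OF that] component_le_norm_cart[of "sgrad \<phi> p" i] N(2)[OF that] component_le_norm_cart[of "sgrad \<psi> p" i] by linarith+
    have i1: "integrable (MO lx ly) (\<lambda>p. \<phi> p * sgrad \<psi> p $ i)"
      by (rule integrable_MO_bounded[where M="M*N"]) (use M N a in \<open>auto simp: abs_mult intro!: mult_mono\<close>)
    have i2: "integrable (MO lx ly) (\<lambda>p. sgrad \<phi> p $ i * \<psi> p)"
      by (rule integrable_MO_bounded[where M="M*N"]) (use M N a in \<open>auto simp: abs_mult intro!: mult_mono\<close>)
    have "0 = (\<integral>p. sgrad (\<lambda>p. \<phi> p * \<psi> p) p $ i \<partial>MO lx ly)"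
      using integral_sgrad_zero[OF test0_mult[OF \<phi> \<psi>] l] by simp
    also have "\<dots> = (\<integral>p. \<phi> p * sgrad \<psi> p $ i + sgrad \<phi> p $ i * \<psi> p \<partial>MO lx ly)"
      by (simp add: sgrad_mult(2) test0_C1[OF \<phi>] test0_C1[OF \<psi>] mult.commute)
    also have "\<dots> = (\<integral>p. \<phi> p * sgrad \<psi> p $ i \<partial>MO lx ly) + (\<integral>p. sgrad \<phi> p $ i * \<psi> p \<partial>MO lx ly)"
      using i1 i2 by simp
    finally show ?thesis by simp
  qed
  show ?thesis unfolding H10_def H1_def using 1 2 3 \<phi> by (auto intro!: exI[of _ "\<lambda>_. \<phi>"])
qed

section \<open>Composite test functions\<close>

text \<open>Young's inequality with a weight \<open>d\<close> does the work of the Cauchy-Schwarz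
  inequality for integrals: \<open>d\<close> first makes the share of \<open>Q\<close> small, and
  the remaining square divided by \<open>d\<close> tends to zero.\<close>

lemma tendsto_L2_pairing_norm:
  fixes g :: "'a \<Rightarrow> 'v::euclidean_space"
  assumes [measurable]: "Q \<in> borel_measurable M" "g \<in> borel_measurable M" "\<And>n. h n \<in> borel_measurable M"
    and Q: "integrable M (\<lambda>x. (norm (Q x))^2)" and h: "\<And>n. integrable M (\<lambda>x. (norm (g x - h n x))^2)"
    and L: "(\<lambda>n. \<integral>x. (norm (g x - h n x))^2 \<partial>M) \<longlonglongrightarrow> 0"
  shows "(\<lambda>n. \<integral>x. norm (Q x :: 'v) * norm (g x - h n x) \<partial>M) \<longlonglongrightarrow> 0"
proof (rule LIMSEQ_I)
  fix e :: real assume e: "e > 0"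
  let ?A = "\<integral>x. (norm (Q x))^2 \<partial>M"
  have A0: "?A \<ge> 0" by simp
  define d where "d = e / (2 * (?A + 1))"
  have d: "d > 0" using e A0 by (simp add: d_def add_nonneg_pos)
  have "e / (2 * z) * z = e / 2" if "z > 0" for z using that by simp
  from this[of "?A + 1"] have "d * (?A + 1) = e / 2" using A0 unfolding d_def by linarith
  then have dA: "d * ?A \<le> e / 2" using d by (simp add: algebra_simps)
  obtain N where N: "\<And>n. n \<ge> N \<Longrightarrow> norm ((\<integral>x. (norm (g x - h n x))^2 \<partial>M) - 0) < d * (e / 2)"
    using LIMSEQ_D[OF L, of "d * (e/2)"] d e by auto
  have "norm ((\<integral>x. norm (Q x) * norm (g x - h n x) \<partial>M) - 0) < e" if "n \<ge> N" for n
  proof -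
    have i: "integrable M (\<lambda>x. norm (Q x) * norm (g x - h n x))"
      by (rule integrable_inner_L2(1)) (use Q h in auto)
    have "(\<integral>x. norm (Q x) * norm (g x - h n x) \<partial>M) \<le> (\<integral>x. d * (norm (Q x))^2 + (norm (g x - h n x))^2 / d \<partial>M)"
    proof (rule integral_mono[OF i])
      fix x
      let ?a = "norm (Q x)" and ?b = "norm (g x - h n x)"
      have "0 \<le> (d * ?a - ?b)^2 / d" using d by simp
      also have "\<dots> = d * ?a^2 + ?b^2 / d - 2 * (?a * ?b)"
        using d by (simp add: field_simps power2_eq_square)
      finally have "2 * (?a * ?b) \<le> d * ?a^2 + ?b^2 / d" by simp
      moreover have "0 \<le> ?a * ?b" by simp
      ultimately show "?a * ?b \<le> d * ?a^2 + ?b^2 / d" by linarith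
    qed (use Q h in auto)
    also have "\<dots> = d * ?A + (\<integral>x. (norm (g x - h n x))^2 \<partial>M) / d" using Q h by simp
    also have "\<dots> < e"
    proof -
      have "(\<integral>x. (norm (g x - h n x))^2 \<partial>M) < d * (e / 2)" using N[OF that] by simp
      then have "(\<integral>x. (norm (g x - h n x))^2 \<partial>M) / d < e / 2" using d by (simp add: pos_divide_less_eq mult.commute)
      with dA show ?thesis by linarith
    qed
    finally show ?thesis by simp
  qed
  then show "\<exists>N. \<forall>n\<ge>N. norm ((\<integral>x. norm (Q x) * norm (g x - h n x) \<partial>M) - 0) < e" by blast
qed

lemma tendsto_L2_pairing:
  fixes g :: "'a \<Rightarrow> 'v::euclidean_space"
  assumes m [measurable]: "Q \<in> borel_measurable M" "g \<in> borel_measurable M" "\<And>n. h n \<in> borel_measurable M"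
    and Q: "integrable M (\<lambda>x. (norm (Q x))^2)" and h: "\<And>n. integrable M (\<lambda>x. (norm (g x - h n x))^2)"
    and g: "integrable M (\<lambda>x. (norm (g x))^2)"
    and L: "(\<lambda>n. \<integral>x. (norm (g x - h n x))^2 \<partial>M) \<longlonglongrightarrow> 0"
  shows "(\<lambda>n. \<integral>x. Q x \<bullet> h n x \<partial>M) \<longlonglongrightarrow> (\<integral>x. Q x \<bullet> g x \<partial>M)" "integrable M (\<lambda>x. Q x \<bullet> h n x)"
proof -
  have i1: "integrable M (\<lambda>x. Q x \<bullet> g x)" by (rule integrable_inner_L2) (use Q g in auto)
  have i2: "integrable M (\<lambda>x. Q x \<bullet> (g x - h n x))" for n by (rule integrable_inner_L2) (use Q h in auto)
  have i2': "integrable M (\<lambda>x. norm (Q x) * norm (g x - h n x))" for n by (rule integrable_inner_L2) (use Q h in auto)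
  have "integrable M (\<lambda>x. Q x \<bullet> g x - Q x \<bullet> (g x - h n x))" for n by (rule Bochner_Integration.integrable_diff[OF i1 i2])
  then show i3: "integrable M (\<lambda>x. Q x \<bullet> h n x)" for n by (simp add: inner_diff_right)
  show "(\<lambda>n. \<integral>x. Q x \<bullet> h n x \<partial>M) \<longlonglongrightarrow> (\<integral>x. Q x \<bullet> g x \<partial>M)"
  proof (rule LIM_zero_cancel, rule tendsto_rabs_zero_cancel,
      rule tendsto_sandwich[OF _ _ tendsto_const tendsto_L2_pairing_norm[OF m Q h L]])
    show "\<forall>\<^sub>F n in sequentially. \<bar>(\<integral>x. Q x \<bullet> h n x \<partial>M) - (\<integral>x. Q x \<bullet> g x \<partial>M)\<bar> \<le> (\<integral>x. norm (Q x) * norm (g x - h n x) \<partial>M)"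
    proof (rule always_eventually, rule allI)
      fix n
      have "(\<integral>x. Q x \<bullet> h n x \<partial>M) - (\<integral>x. Q x \<bullet> g x \<partial>M) = - (\<integral>x. Q x \<bullet> (g x - h n x) \<partial>M)"
        using i1 i3[of n] by (simp add: inner_diff_right)
      also have "\<bar>\<dots>\<bar> \<le> (\<integral>x. norm (Q x) * norm (g x - h n x) \<partial>M)"
        using abs_integral_le[OF i2 i2'] Cauchy_Schwarz_ineq2 by fastforce
      finally show "\<bar>(\<integral>x. Q x \<bullet> h n x \<partial>M) - (\<integral>x. Q x \<bullet> g x \<partial>M)\<bar> \<le> (\<integral>x. norm (Q x) * norm (g x - h n x) \<partial>M)" .
    qed
  qed auto
qed

text \<open>The part of \<open>H10\<close> that carries weak identities from test functions over to
  \<open>f\<close>: strong approximability, phrased with a real integral in place of the extended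
  one. The integration by parts identity is left out, which makes stability under differences
  immediate from linearity of \<open>sgrad\<close>.\<close>

definition H10_limit :: "real \<Rightarrow> real \<Rightarrow> (pt \<Rightarrow> real) \<Rightarrow> (pt \<Rightarrow> pt) \<Rightarrow> bool" where
  "H10_limit lx ly f G \<longleftrightarrow> f \<in> borel_measurable (MO lx ly) \<and> G \<in> borel_measurable (MO lx ly) \<and>
     integrable (MO lx ly) (\<lambda>p. (f p)^2) \<and> integrable (MO lx ly) (\<lambda>p. (norm (G p))^2) \<and>
     (\<exists>\<zeta>. (\<forall>n. test0 lx ly (\<zeta> n)) \<and> (\<lambda>n. \<integral>p. (f p - \<zeta> n p)^2 + (norm (G p - sgrad (\<zeta> n) p))^2 \<partial>MO lx ly) \<longlonglongrightarrow> 0)"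

lemma norm_sq_vec3: "(norm (v :: pt))^2 = (\<Sum>i\<in>UNIV. (v $ i)^2)"
  by (simp only: power2_norm_eq_inner inner_vec_def) (simp add: power2_eq_square)

lemma test0_MO:
  assumes "test0 lx ly \<phi>"
  shows "\<phi> \<in> borel_measurable (MO lx ly)" "sgrad \<phi> \<in> borel_measurable (MO lx ly)"
    "integrable (MO lx ly) (\<lambda>p. (\<phi> p)^2)" "integrable (MO lx ly) (\<lambda>p. (norm (sgrad \<phi> p))^2)"
proof -
  note [measurable] = test0_cont(3,4)[OF assms]
  obtain M where M: "\<And>p. p \<in> Om lx ly \<Longrightarrow> \<bar>\<phi> p\<bar> \<le> M" "\<And>p. p \<in> Om lx ly \<Longrightarrow> norm (sgrad \<phi> p) \<le> M" "M \<ge> 0"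
    using test0_bounded[OF assms] by blast
  show "\<phi> \<in> borel_measurable (MO lx ly)" "sgrad \<phi> \<in> borel_measurable (MO lx ly)"
    by (auto intro: borel_measurable_lebesgue_on)
  show "integrable (MO lx ly) (\<lambda>p. (\<phi> p)^2)" "integrable (MO lx ly) (\<lambda>p. (norm (sgrad \<phi> p))^2)"
    by (rule integrable_MO_bounded[where M="M^2"];
        use M in \<open>auto simp: abs_le_square_iff[symmetric] power_mono\<close>)+
qed

lemma H10_limit_sq:
  assumes [measurable]: "f \<in> borel_measurable (MO lx ly)" "G \<in> borel_measurable (MO lx ly)"
    and f: "integrable (MO lx ly) (\<lambda>p. (f p)^2)" and G: "integrable (MO lx ly) (\<lambda>p. (norm (G p))^2)"
    and \<zeta>: "test0 lx ly \<zeta>"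
  shows "integrable (MO lx ly) (\<lambda>p. (f p - \<zeta> p)^2)" "integrable (MO lx ly) (\<lambda>p. (norm (G p - sgrad \<zeta> p))^2)"
proof -
  note [measurable] = test0_MO(1,2)[OF \<zeta>]
  show "integrable (MO lx ly) (\<lambda>p. (f p - \<zeta> p)^2)"
    using integrable_L2_diff[of f "MO lx ly" \<zeta>] f test0_MO[OF \<zeta>] by simp
  show "integrable (MO lx ly) (\<lambda>p. (norm (G p - sgrad \<zeta> p))^2)"
    using integrable_L2_diff[of G "MO lx ly" "sgrad \<zeta>"] G test0_MO[OF \<zeta>] by simp
qed

lemma H10_imp_limit:
  assumes "H10 lx ly f G"
  shows "H10_limit lx ly f G"
proof -
  let ?M = "MO lx ly"
  have f: "f \<in> borel_measurable ?M" "integrable ?M (\<lambda>p. (f p)^2)"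
    and G: "\<And>i. (\<lambda>p. G p $ i) \<in> borel_measurable ?M" "\<And>i. integrable ?M (\<lambda>p. (G p $ i)^2)"
    using assms by (auto simp: H10_def H1_def L2_def)
  have Gm: "G \<in> borel_measurable ?M"
    by (subst borel_measurable_euclidean_space) (auto simp: Basis_vec_def inner_axis intro: G)
  have Gi: "integrable ?M (\<lambda>p. (norm (G p))^2)" by (simp add: norm_sq_vec3 G)
  note [measurable] = f(1) Gm
  obtain \<zeta> where \<zeta>: "\<And>n. test0 lx ly (\<zeta> n)"
    and L: "(\<lambda>n. \<integral>\<^sup>+p. ennreal ((f p - \<zeta> n p)^2 + (norm (G p - sgrad (\<zeta> n) p))^2) \<partial>?M) \<longlonglongrightarrow> 0"
    using assms unfolding H10_def by blast
  have i: "integrable ?M (\<lambda>p. (f p - \<zeta> n p)^2 + (norm (G p - sgrad (\<zeta> n) p))^2)" for n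
    using H10_limit_sq[OF f(1) Gm f(2) Gi \<zeta>] by simp
  have "(\<integral>\<^sup>+p. ennreal ((f p - \<zeta> n p)^2 + (norm (G p - sgrad (\<zeta> n) p))^2) \<partial>?M)
     = ennreal (\<integral>p. (f p - \<zeta> n p)^2 + (norm (G p - sgrad (\<zeta> n) p))^2 \<partial>?M)" for n
    by (rule nn_integral_eq_integral[OF i]) auto
  then have "(\<lambda>n. ennreal (\<integral>p. (f p - \<zeta> n p)^2 + (norm (G p - sgrad (\<zeta> n) p))^2 \<partial>?M)) \<longlonglongrightarrow> ennreal 0"
    using L by simp
  then have "(\<lambda>n. \<integral>p. (f p - \<zeta> n p)^2 + (norm (G p - sgrad (\<zeta> n) p))^2 \<partial>?M) \<longlonglongrightarrow> 0"
    by (subst (asm) tendsto_ennreal_iff) auto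
  with f Gm Gi \<zeta> show ?thesis unfolding H10_limit_def by blast
qed

lemma H10_limit_diff:
  assumes 1: "H10_limit lx ly f G" and 2: "H10_limit lx ly g H"
  shows "H10_limit lx ly (\<lambda>p. f p - g p) (\<lambda>p. G p - H p)"
proof -
  let ?M = "MO lx ly"
  have m [measurable]: "f \<in> borel_measurable ?M" "G \<in> borel_measurable ?M" "g \<in> borel_measurable ?M" "H \<in> borel_measurable ?M"
    and i: "integrable ?M (\<lambda>p. (f p)^2)" "integrable ?M (\<lambda>p. (norm (G p))^2)"
       "integrable ?M (\<lambda>p. (g p)^2)" "integrable ?M (\<lambda>p. (norm (H p))^2)"
    using assms unfolding H10_limit_def by auto
  obtain \<zeta> where \<zeta>: "\<And>n. test0 lx ly (\<zeta> n)"
    and L1: "(\<lambda>n. \<integral>p. (f p - \<zeta> n p)^2 + (norm (G p - sgrad (\<zeta> n) p))^2 \<partial>?M) \<longlonglongrightarrow> 0"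
    using 1 unfolding H10_limit_def by blast
  obtain \<xi> where \<xi>: "\<And>n. test0 lx ly (\<xi> n)"
    and L2: "(\<lambda>n. \<integral>p. (g p - \<xi> n p)^2 + (norm (H p - sgrad (\<xi> n) p))^2 \<partial>?M) \<longlonglongrightarrow> 0"
    using 2 unfolding H10_limit_def by blast
  have a: "integrable ?M (\<lambda>p. (f p - g p)^2)" using integrable_L2_diff[of f ?M g] i by simp
  have b: "integrable ?M (\<lambda>p. (norm (G p - H p))^2)" using integrable_L2_diff[of G ?M H] i by simp
  define \<eta> where "\<eta> n = (\<lambda>p. \<zeta> n p - \<xi> n p)" for n
  have \<eta>: "test0 lx ly (\<eta> n)" for n unfolding \<eta>_def by (rule test0_diff[OF \<zeta> \<xi>])
  have s\<eta>: "sgrad (\<eta> n) p = sgrad (\<zeta> n) p - sgrad (\<xi> n) p" for n p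
    unfolding \<eta>_def by (rule sgrad_diff(2)[OF test0_C1[OF \<zeta>] test0_C1[OF \<xi>]])
  let ?E = "\<lambda>n. \<integral>p. ((f p - g p) - \<eta> n p)^2 + (norm ((G p - H p) - sgrad (\<eta> n) p))^2 \<partial>?M"
  let ?E1 = "\<lambda>n. \<integral>p. (f p - \<zeta> n p)^2 + (norm (G p - sgrad (\<zeta> n) p))^2 \<partial>?M"
  let ?E2 = "\<lambda>n. \<integral>p. (g p - \<xi> n p)^2 + (norm (H p - sgrad (\<xi> n) p))^2 \<partial>?M"
  have le: "?E n \<le> 2 * ?E1 n + 2 * ?E2 n" for n
  proof -
    have i1: "integrable ?M (\<lambda>p. (f p - \<zeta> n p)^2 + (norm (G p - sgrad (\<zeta> n) p))^2)"
      using H10_limit_sq[OF m(1,2) i(1,2) \<zeta>[of n]] by simp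
    have i2: "integrable ?M (\<lambda>p. (g p - \<xi> n p)^2 + (norm (H p - sgrad (\<xi> n) p))^2)"
      using H10_limit_sq[OF m(3,4) i(3,4) \<xi>[of n]] by simp
    have i3: "integrable ?M (\<lambda>p. ((f p - g p) - \<eta> n p)^2 + (norm ((G p - H p) - sgrad (\<eta> n) p))^2)"
      using H10_limit_sq[OF _ _ a b \<eta>[of n]] by simp
    have "?E n \<le> (\<integral>p. 2 * ((f p - \<zeta> n p)^2 + (norm (G p - sgrad (\<zeta> n) p))^2) + 2 * ((g p - \<xi> n p)^2 + (norm (H p - sgrad (\<xi> n) p))^2) \<partial>?M)"
    proof (rule integral_mono[OF i3])
      fix p
      have e: "(f p - g p) - \<eta> n p = (f p - \<zeta> n p) - (g p - \<xi> n p)"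
        "(G p - H p) - sgrad (\<eta> n) p = (G p - sgrad (\<zeta> n) p) - (H p - sgrad (\<xi> n) p)" by (simp_all add: \<eta>_def s\<eta>[unfolded \<eta>_def])
      have A: "((f p - g p) - \<eta> n p)^2 \<le> 2 * (f p - \<zeta> n p)^2 + 2 * (g p - \<xi> n p)^2"
        unfolding e using norm_diff_sq_le[of "f p - \<zeta> n p" "g p - \<xi> n p"] unfolding real_norm_def power2_abs .
      have B: "(norm ((G p - H p) - sgrad (\<eta> n) p))^2 \<le> 2 * (norm (G p - sgrad (\<zeta> n) p))^2 + 2 * (norm (H p - sgrad (\<xi> n) p))^2"
        unfolding e by (rule norm_diff_sq_le)
      show "((f p - g p) - \<eta> n p)^2 + (norm ((G p - H p) - sgrad (\<eta> n) p))^2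
         \<le> 2 * ((f p - \<zeta> n p)^2 + (norm (G p - sgrad (\<zeta> n) p))^2) + 2 * ((g p - \<xi> n p)^2 + (norm (H p - sgrad (\<xi> n) p))^2)"
        using add_mono[OF A B] unfolding distrib_left by linarith
    qed (rule Bochner_Integration.integrable_add[OF integrable_mult_right[OF i1] integrable_mult_right[OF i2]])
    also have "\<dots> = 2 * ?E1 n + 2 * ?E2 n"
      by (subst Bochner_Integration.integral_add[OF integrable_mult_right[OF i1] integrable_mult_right[OF i2]])
         (simp only: integral_mult_right_zero)
    finally show ?thesis .
  qed
  have "(\<lambda>n. 2 * ?E1 n + 2 * ?E2 n) \<longlonglongrightarrow> 2 * 0 + 2 * 0"
    by (intro tendsto_add tendsto_mult_left L1 L2)
  then have L: "(\<lambda>n. 2 * ?E1 n + 2 * ?E2 n) \<longlonglongrightarrow> 0" by simp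
  have "?E \<longlonglongrightarrow> 0"
  proof (rule tendsto_sandwich[OF _ _ tendsto_const L])
    show "\<forall>\<^sub>F n in sequentially. ?E n \<le> 2 * ?E1 n + 2 * ?E2 n"
      by (rule always_eventually) (rule allI, rule le)
  qed (auto intro!: always_eventually)
  with \<eta> a b show ?thesis unfolding H10_limit_def by (auto simp: m intro!: exI[of _ \<eta>])
qed

text \<open>The subsequence adds convergence almost everywhere. It is wanted because nonlinear
  functions of the approximants have to converge, with no majorant beyond bounds on those
  functions.\<close>

lemma H10_limit_AE:
  assumes "H10_limit lx ly f G"
  shows "\<exists>\<zeta>. (\<forall>n. test0 lx ly (\<zeta> n)) \<and>
    (\<lambda>n. \<integral>p. (norm (f p - \<zeta> n p))^2 \<partial>MO lx ly) \<longlonglongrightarrow> 0 \<and>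
    (\<lambda>n. \<integral>p. (norm (G p - sgrad (\<zeta> n) p))^2 \<partial>MO lx ly) \<longlonglongrightarrow> 0 \<and>
    (AE p in MO lx ly. (\<lambda>n. \<zeta> n p) \<longlonglongrightarrow> f p)"
proof -
  let ?M = "MO lx ly"
  have m [measurable]: "f \<in> borel_measurable ?M" "G \<in> borel_measurable ?M"
    and i: "integrable ?M (\<lambda>p. (f p)^2)" "integrable ?M (\<lambda>p. (norm (G p))^2)"
    using assms unfolding H10_limit_def by auto
  obtain \<zeta> where \<zeta>: "\<And>n. test0 lx ly (\<zeta> n)"
    and L: "(\<lambda>n. \<integral>p. (f p - \<zeta> n p)^2 + (norm (G p - sgrad (\<zeta> n) p))^2 \<partial>?M) \<longlonglongrightarrow> 0"
    using assms unfolding H10_limit_def by blast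
  note q = H10_limit_sq[OF m i \<zeta>]
  have L1: "(\<lambda>n. \<integral>p. (f p - \<zeta> n p)^2 \<partial>?M) \<longlonglongrightarrow> 0"
    by (rule tendsto_sandwich[OF _ _ tendsto_const L]) (use q in \<open>auto intro!: always_eventually integral_mono\<close>)
  have L2: "(\<lambda>n. \<integral>p. (norm (G p - sgrad (\<zeta> n) p))^2 \<partial>?M) \<longlonglongrightarrow> 0"
    by (rule tendsto_sandwich[OF _ _ tendsto_const L]) (use q in \<open>auto intro!: always_eventually integral_mono\<close>)
  have "(\<lambda>n. \<integral>p. norm ((f p - \<zeta> n p)^2) \<partial>?M) \<longlonglongrightarrow> 0" using L1 by simp
  from tendsto_L1_AE_subseq[OF q(1) this] obtain r where r: "strict_mono r" "AE p in ?M. (\<lambda>n. (f p - \<zeta> (r n) p)^2) \<longlonglongrightarrow> 0"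
    by auto
  have "AE p in ?M. (\<lambda>n. \<zeta> (r n) p) \<longlonglongrightarrow> f p"
    using r(2)
  proof eventually_elim
    case (elim p)
    then have "(\<lambda>n. f p - \<zeta> (r n) p) \<longlonglongrightarrow> 0"
      using tendsto_real_sqrt[OF elim] by (simp add: tendsto_rabs_zero_iff)
    from tendsto_diff[OF tendsto_const[of "f p"] this] show ?case by simp
  qed
  then show ?thesis
    using \<zeta> LIMSEQ_subseq_LIMSEQ[OF L1 r(1)] LIMSEQ_subseq_LIMSEQ[OF L2 r(1)]
    by (intro exI[of _ "\<zeta> \<circ> r"]) (simp add: comp_def)
qed

text \<open>Insert \<open>g (\<zeta> n p)\<close>, a test function because \<open>g 0 = 0\<close>.
  Since \<open>P\<close> is only integrable, L2 convergence of the approximants does not control the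
  first term; the majorant \<open>N\<close>, uniform in the argument of \<open>g\<close>, does. Two
  instances occur: bounded \<open>g\<close> with \<open>N\<close> a multiple of the absolute value
  of \<open>P\<close>, and unbounded \<open>g\<close> with \<open>P\<close> and \<open>N\<close>
  both zero.\<close>

lemma weak_test_compose:
  assumes H: "H10_limit lx ly f G" and [measurable]: "P \<in> borel_measurable (MO lx ly)" "Q \<in> borel_measurable (MO lx ly)"
    and P: "integrable (MO lx ly) P" and Q: "integrable (MO lx ly) (\<lambda>p. (norm (Q p :: pt))^2)"
    and g: "\<And>x. (g has_real_derivative g' x) (at x)" and g': "continuous_on UNIV g'" "g 0 = 0" "\<And>x. \<bar>g' x\<bar> \<le> L"
    and N: "integrable (MO lx ly) N" "\<And>p x. \<bar>P p * g x\<bar> \<le> N p"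
    and weak: "\<And>\<phi>. test0 lx ly \<phi> \<Longrightarrow> (\<integral>p. P p * \<phi> p + Q p \<bullet> sgrad \<phi> p \<partial>MO lx ly) = 0"
  shows "(\<integral>p. P p * g (f p) \<partial>MO lx ly) + (\<integral>p. g' (f p) * (Q p \<bullet> G p) \<partial>MO lx ly) = 0"
proof -
  let ?M = "MO lx ly"
  have m [measurable]: "f \<in> borel_measurable ?M" "G \<in> borel_measurable ?M"
    and i: "integrable ?M (\<lambda>p. (f p)^2)" "integrable ?M (\<lambda>p. (norm (G p))^2)"
    using H unfolding H10_limit_def by auto
  obtain \<zeta> where \<zeta>: "\<And>n. test0 lx ly (\<zeta> n)"
    and L1: "(\<lambda>n. \<integral>p. (norm (f p - \<zeta> n p))^2 \<partial>?M) \<longlonglongrightarrow> 0"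
    and L2: "(\<lambda>n. \<integral>p. (norm (G p - sgrad (\<zeta> n) p))^2 \<partial>?M) \<longlonglongrightarrow> 0"
    and ae: "AE p in ?M. (\<lambda>n. \<zeta> n p) \<longlonglongrightarrow> f p"
    using H10_limit_AE[OF H] by (elim exE conjE) (rule that, auto)
  note [measurable] = test0_MO(1,2)[OF \<zeta>]
  note q = H10_limit_sq[OF m i \<zeta>]
  have gc: "continuous_on UNIV g" by (intro continuous_at_imp_continuous_on ballI DERIV_isCont[OF g])
  have [measurable]: "g \<in> borel_measurable borel" "g' \<in> borel_measurable borel"
    using gc g' by (auto intro: borel_measurable_continuous_onI)
  have gs: "(\<lambda>n. g (x n)) \<longlonglongrightarrow> g y" if "x \<longlonglongrightarrow> y" for x y
    using continuous_on_tendsto_compose[OF gc that] by simp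
  have g's: "(\<lambda>n. g' (x n)) \<longlonglongrightarrow> g' y" if "x \<longlonglongrightarrow> y" for x y
    using continuous_on_tendsto_compose[OF g'(1) that] by simp
  have N0: "\<bar>P p * g x\<bar> \<le> \<bar>N p\<bar>" for p x using N(2)[of p x] by linarith
  have iPg: "integrable ?M (\<lambda>p. P p * g (\<zeta> n p))" for n
    by (rule Bochner_Integration.integrable_bound[OF N(1)]) (use N0 in auto)
  have iQG: "integrable ?M (\<lambda>p. norm (Q p) * norm (G p))" by (rule integrable_inner_L2) (use Q i in auto)
  have L0: "L \<ge> 0" using g'(3)[of 0] by linarith
  have iQz: "integrable ?M (\<lambda>p. norm (Q p) * norm (sgrad (\<zeta> n) p))" for n
    by (rule integrable_inner_L2) (use Q test0_MO[OF \<zeta>] in auto)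
  have bound: "\<bar>g' x * (a \<bullet> b)\<bar> \<le> L * (norm a * norm b)" for x and a b :: pt
    unfolding abs_mult using g'(3) Cauchy_Schwarz_ineq2 L0 by (intro mult_mono) auto
  have iz: "integrable ?M (\<lambda>p. g' (\<zeta> n p) * (Q p \<bullet> sgrad (\<zeta> n) p))" for n
    by (rule Bochner_Integration.integrable_bound[OF integrable_mult_right[OF iQz[of n], of L]])
       (use bound L0 in \<open>auto simp: abs_mult\<close>)
  have iG: "integrable ?M (\<lambda>p. g' (\<zeta> n p) * (Q p \<bullet> G p))" for n
    by (rule Bochner_Integration.integrable_bound[OF integrable_mult_right[OF iQG, of L]])
       (use bound L0 in \<open>auto simp: abs_mult\<close>)
  have z: "(\<integral>p. P p * g (\<zeta> n p) \<partial>?M) + (\<integral>p. g' (\<zeta> n p) * (Q p \<bullet> sgrad (\<zeta> n) p) \<partial>?M) = 0" for n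
  proof -
    have "0 = (\<integral>p. P p * g (\<zeta> n p) + Q p \<bullet> sgrad (\<lambda>p. g (\<zeta> n p)) p \<partial>?M)"
      using weak[OF test0_compose[OF \<zeta> g g'(1,2)]] by simp
    also have "\<dots> = (\<integral>p. P p * g (\<zeta> n p) + g' (\<zeta> n p) * (Q p \<bullet> sgrad (\<zeta> n) p) \<partial>?M)"
      by (simp add: sgrad_compose(2)[OF test0_C1[OF \<zeta>] g g'(1)])
    also have "\<dots> = (\<integral>p. P p * g (\<zeta> n p) \<partial>?M) + (\<integral>p. g' (\<zeta> n p) * (Q p \<bullet> sgrad (\<zeta> n) p) \<partial>?M)"
      using iPg iz by simp
    finally show ?thesis by simp
  qed
  have T1: "(\<lambda>n. \<integral>p. P p * g (\<zeta> n p) \<partial>?M) \<longlonglongrightarrow> (\<integral>p. P p * g (f p) \<partial>?M)"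
  proof (rule integral_dominated_convergence[OF _ _ N(1)])
    show "AE p in ?M. (\<lambda>n. P p * g (\<zeta> n p)) \<longlonglongrightarrow> P p * g (f p)"
      using ae by eventually_elim (intro tendsto_mult_left gs)
  qed (use N in auto)
  \<comment> \<open>The gradient is first frozen at its limit \<open>G\<close>, so that only the
    factor \<open>g' (\<zeta> n p)\<close> varies and dominated convergence applies.
    \<open>T3\<close> then replaces \<open>G\<close> by the gradient of the approximant at a cost
    that is small in L2.\<close>
  have T2: "(\<lambda>n. \<integral>p. g' (\<zeta> n p) * (Q p \<bullet> G p) \<partial>?M) \<longlonglongrightarrow> (\<integral>p. g' (f p) * (Q p \<bullet> G p) \<partial>?M)"
  proof (rule integral_dominated_convergence[OF _ _ integrable_mult_right[OF iQG, of L]])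
    show "AE p in ?M. (\<lambda>n. g' (\<zeta> n p) * (Q p \<bullet> G p)) \<longlonglongrightarrow> g' (f p) * (Q p \<bullet> G p)"
      using ae by eventually_elim (intro tendsto_mult_right g's)
  qed (use bound in auto)
  have T3: "(\<lambda>n. (\<integral>p. g' (\<zeta> n p) * (Q p \<bullet> sgrad (\<zeta> n) p) \<partial>?M) - (\<integral>p. g' (\<zeta> n p) * (Q p \<bullet> G p) \<partial>?M)) \<longlonglongrightarrow> 0"
  proof (rule tendsto_rabs_zero_cancel, rule tendsto_sandwich[OF _ _ tendsto_const])
    have "(\<lambda>n. \<integral>p. norm (Q p) * norm (G p - sgrad (\<zeta> n) p) \<partial>?M) \<longlonglongrightarrow> 0"
      by (rule tendsto_L2_pairing_norm) (use q Q L2 in auto)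
    from tendsto_mult_left[OF this, of L]
    show "(\<lambda>n. L * (\<integral>p. norm (Q p) * norm (G p - sgrad (\<zeta> n) p) \<partial>?M)) \<longlonglongrightarrow> 0" by simp
    show "\<forall>\<^sub>F n in sequentially. \<bar>(\<integral>p. g' (\<zeta> n p) * (Q p \<bullet> sgrad (\<zeta> n) p) \<partial>?M) - (\<integral>p. g' (\<zeta> n p) * (Q p \<bullet> G p) \<partial>?M)\<bar>
        \<le> L * (\<integral>p. norm (Q p) * norm (G p - sgrad (\<zeta> n) p) \<partial>?M)"
    proof (rule always_eventually, rule allI)
      fix n
      have iD: "integrable ?M (\<lambda>p. norm (Q p) * norm (G p - sgrad (\<zeta> n) p))"
        by (rule integrable_inner_L2) (use Q q in auto)
      have iD': "integrable ?M (\<lambda>p. g' (\<zeta> n p) * (Q p \<bullet> (G p - sgrad (\<zeta> n) p)))"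
        by (rule Bochner_Integration.integrable_bound[OF integrable_mult_right[OF iD, of L]])
           (use bound L0 in \<open>auto simp: abs_mult\<close>)
      have "(\<integral>p. g' (\<zeta> n p) * (Q p \<bullet> sgrad (\<zeta> n) p) \<partial>?M) - (\<integral>p. g' (\<zeta> n p) * (Q p \<bullet> G p) \<partial>?M)
        = - (\<integral>p. g' (\<zeta> n p) * (Q p \<bullet> (G p - sgrad (\<zeta> n) p)) \<partial>?M)"
        using iz[of n] iG[of n] by (simp add: inner_diff_right right_diff_distrib)
      also have "\<bar>\<dots>\<bar> \<le> (\<integral>p. L * (norm (Q p) * norm (G p - sgrad (\<zeta> n) p)) \<partial>?M)"
        unfolding abs_minus_cancel by (rule abs_integral_le[OF iD' integrable_mult_right[OF iD] bound])
      also have "\<dots> = L * (\<integral>p. norm (Q p) * norm (G p - sgrad (\<zeta> n) p) \<partial>?M)" by simp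
      finally show "\<bar>(\<integral>p. g' (\<zeta> n p) * (Q p \<bullet> sgrad (\<zeta> n) p) \<partial>?M) - (\<integral>p. g' (\<zeta> n p) * (Q p \<bullet> G p) \<partial>?M)\<bar>
        \<le> L * (\<integral>p. norm (Q p) * norm (G p - sgrad (\<zeta> n) p) \<partial>?M)" .
    qed
  qed auto
  have "(\<lambda>n. (\<integral>p. P p * g (\<zeta> n p) \<partial>?M) + (((\<integral>p. g' (\<zeta> n p) * (Q p \<bullet> sgrad (\<zeta> n) p) \<partial>?M) - (\<integral>p. g' (\<zeta> n p) * (Q p \<bullet> G p) \<partial>?M))
      + (\<integral>p. g' (\<zeta> n p) * (Q p \<bullet> G p) \<partial>?M))) \<longlonglongrightarrow> (\<integral>p. P p * g (f p) \<partial>?M) + (0 + (\<integral>p. g' (f p) * (Q p \<bullet> G p) \<partial>?M))"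
    by (intro tendsto_add T1 T2 T3)
  then show ?thesis using z by (simp add: LIMSEQ_const_iff)
qed

text \<open>A divergence-free \<open>u\<close> annihilates the gradient of
  \<open>\<zeta> n p * \<phi> p\<close>. Both terms of the product rule pass to the limit in L2
  because \<open>\<phi>\<close> and its gradient are bounded on the cell. This moves the derivative
  onto \<open>f\<close> and brings transport from divergence form into advective form.\<close>

lemma weak_test_mult:
  assumes H: "H10_limit lx ly f G" and [measurable]: "u \<in> borel_measurable (MO lx ly)"
    and u: "integrable (MO lx ly) (\<lambda>p. (norm (u p :: pt))^2)"
    and div: "\<And>\<phi>. test0 lx ly \<phi> \<Longrightarrow> (\<integral>p. u p \<bullet> sgrad \<phi> p \<partial>MO lx ly) = 0"
    and \<phi>: "test0 lx ly \<phi>"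
  shows "(\<integral>p. f p * (u p \<bullet> sgrad \<phi> p) \<partial>MO lx ly) = - (\<integral>p. \<phi> p * (u p \<bullet> G p) \<partial>MO lx ly)"
proof -
  let ?M = "MO lx ly"
  have m [measurable]: "f \<in> borel_measurable ?M" "G \<in> borel_measurable ?M"
    and i: "integrable ?M (\<lambda>p. (f p)^2)" "integrable ?M (\<lambda>p. (norm (G p))^2)"
    using H unfolding H10_limit_def by auto
  obtain \<zeta> where \<zeta>: "\<And>n. test0 lx ly (\<zeta> n)"
    and L1: "(\<lambda>n. \<integral>p. (norm (f p - \<zeta> n p))^2 \<partial>?M) \<longlonglongrightarrow> 0"
    and L2: "(\<lambda>n. \<integral>p. (norm (G p - sgrad (\<zeta> n) p))^2 \<partial>?M) \<longlonglongrightarrow> 0"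
    and ae: "AE p in ?M. (\<lambda>n. \<zeta> n p) \<longlonglongrightarrow> f p"
    using H10_limit_AE[OF H] by (elim exE conjE) (rule that, auto)
  note [measurable] = test0_MO(1,2)[OF \<zeta>] test0_MO(1,2)[OF \<phi>]
  note q = H10_limit_sq[OF m i \<zeta>]
  obtain B where B: "\<And>p. p \<in> Om lx ly \<Longrightarrow> \<bar>\<phi> p\<bar> \<le> B" "\<And>p. p \<in> Om lx ly \<Longrightarrow> norm (sgrad \<phi> p) \<le> B" "B \<ge> 0"
    using test0_bounded[OF \<phi>] by blast
  have i1: "integrable ?M (\<lambda>p. (norm (u p \<bullet> sgrad \<phi> p))^2)"
  proof (rule Bochner_Integration.integrable_bound[OF integrable_mult_right[OF u, of "B^2"]])
    show "AE p in ?M. norm ((norm (u p \<bullet> sgrad \<phi> p))^2) \<le> norm (B^2 * (norm (u p))^2)"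
    proof (rule AE_I2)
      fix p assume "p \<in> space ?M"
      then have p: "p \<in> Om lx ly" by simp
      have "\<bar>u p \<bullet> sgrad \<phi> p\<bar> \<le> norm (u p) * norm (sgrad \<phi> p)" by (rule Cauchy_Schwarz_ineq2)
      also have "\<dots> \<le> norm (u p) * B" using B(2)[OF p] by (intro mult_left_mono) auto
      finally have "\<bar>u p \<bullet> sgrad \<phi> p\<bar>^2 \<le> (norm (u p) * B)^2" by (intro power_mono) auto
      then show "norm ((norm (u p \<bullet> sgrad \<phi> p))^2) \<le> norm (B^2 * (norm (u p))^2)" by (simp add: power_mult_distrib mult.commute)
    qed
  qed auto
  have i2: "integrable ?M (\<lambda>p. (norm (\<phi> p *\<^sub>R u p))^2)"
  proof (rule Bochner_Integration.integrable_bound[OF integrable_mult_right[OF u, of "B^2"]])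
    show "AE p in ?M. norm ((norm (\<phi> p *\<^sub>R u p))^2) \<le> norm (B^2 * (norm (u p))^2)"
    proof (rule AE_I2)
      fix p assume "p \<in> space ?M"
      then have "\<bar>\<phi> p\<bar>^2 \<le> B^2" using B(1) by (intro power_mono) auto
      then show "norm ((norm (\<phi> p *\<^sub>R u p))^2) \<le> norm (B^2 * (norm (u p))^2)"
        by (simp add: power_mult_distrib mult_right_mono)
    qed
  qed auto
  have T1: "(\<lambda>n. \<integral>p. (u p \<bullet> sgrad \<phi> p) \<bullet> \<zeta> n p \<partial>?M) \<longlonglongrightarrow> (\<integral>p. (u p \<bullet> sgrad \<phi> p) \<bullet> f p \<partial>?M)"
    and I1: "integrable ?M (\<lambda>p. (u p \<bullet> sgrad \<phi> p) \<bullet> \<zeta> n p)" for n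
    by (rule tendsto_L2_pairing[where g=f]; use i1 q i L1 in auto)+
  have T2: "(\<lambda>n. \<integral>p. (\<phi> p *\<^sub>R u p) \<bullet> sgrad (\<zeta> n) p \<partial>?M) \<longlonglongrightarrow> (\<integral>p. (\<phi> p *\<^sub>R u p) \<bullet> G p \<partial>?M)"
    and I2: "integrable ?M (\<lambda>p. (\<phi> p *\<^sub>R u p) \<bullet> sgrad (\<zeta> n) p)" for n
    by (rule tendsto_L2_pairing[where g=G]; use i2 q i L2 in auto)+
  have z: "(\<integral>p. (u p \<bullet> sgrad \<phi> p) \<bullet> \<zeta> n p \<partial>?M) + (\<integral>p. (\<phi> p *\<^sub>R u p) \<bullet> sgrad (\<zeta> n) p \<partial>?M) = 0" for n
  proof -
    have "0 = (\<integral>p. u p \<bullet> sgrad (\<lambda>p. \<zeta> n p * \<phi> p) p \<partial>?M)"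
      using div[OF test0_mult[OF \<zeta> \<phi>]] by simp
    also have "\<dots> = (\<integral>p. (u p \<bullet> sgrad \<phi> p) \<bullet> \<zeta> n p + (\<phi> p *\<^sub>R u p) \<bullet> sgrad (\<zeta> n) p \<partial>?M)"
      unfolding sgrad_mult(2)[OF test0_C1[OF \<zeta>] test0_C1[OF \<phi>]] by (simp add: inner_add_right mult.commute)
    also have "\<dots> = (\<integral>p. (u p \<bullet> sgrad \<phi> p) \<bullet> \<zeta> n p \<partial>?M) + (\<integral>p. (\<phi> p *\<^sub>R u p) \<bullet> sgrad (\<zeta> n) p \<partial>?M)"
      by (rule Bochner_Integration.integral_add[OF I1 I2])
    finally show ?thesis by simp
  qed
  from tendsto_add[OF T1 T2] have "(\<integral>p. (u p \<bullet> sgrad \<phi> p) \<bullet> f p \<partial>?M) + (\<integral>p. (\<phi> p *\<^sub>R u p) \<bullet> G p \<partial>?M) = 0"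
    unfolding z by (simp only: LIMSEQ_const_iff)
  then show ?thesis by (simp add: mult.commute)
qed

section \<open>Steklov averages\<close>

text \<open>For positive \<open>h\<close> this is the mean over the preceding time span of length
  \<open>h\<close>, rescaled to the unit interval so that \<open>h\<close> occurs only in the shift.
  The spatial variable is left alone.\<close>

definition steklov :: "real \<Rightarrow> (real \<times> 'p::euclidean_space \<Rightarrow> 'v::{banach,second_countable_topology}) \<Rightarrow> real \<times> 'p \<Rightarrow> 'v" where
  "steklov h F x = (LBINT s. indicator {0..1} s *\<^sub>R F (x - (h * s, 0)))"

lemma steklov_measurable [measurable]:
  assumes [measurable]: "F \<in> borel_measurable borel"
  shows "steklov h F \<in> borel_measurable borel"
  unfolding steklov_def by measurable

text \<open>Translations preserve the L1 norm, so the inner integral is the same number for every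
  \<open>s\<close> in the unit interval. Joint integrability in position and shift licenses the
  exchanges of averaging and integration below.\<close>

lemma translate_joint_integrable:
  fixes F :: "real \<times> 'p::euclidean_space \<Rightarrow> 'v::{banach,second_countable_topology}"
  assumes F: "integrable lborel F"
  shows "integrable (lborel \<Otimes>\<^sub>M lborel) (\<lambda>(x, s). indicator {0..1} s *\<^sub>R F (x - (h * s, 0)))"
proof -
  have [measurable]: "F \<in> borel_measurable borel" using F by (auto dest: borel_measurable_integrable)
  have m: "(\<lambda>(s, x). indicator {0..1} s *\<^sub>R F (x - (h * s, 0))) \<in> borel_measurable (lborel \<Otimes>\<^sub>M lborel)"
    by measurable
  have tr: "(LBINT x. norm (F (x - a))) = (LBINT x. norm (F x))" for a
    using integral_lborel_translate[of "\<lambda>x. norm (F x)" "- a"] by simp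
  have "integrable (lborel \<Otimes>\<^sub>M lborel) (\<lambda>(s, x). indicator {0..1} s *\<^sub>R F (x - (h * s, 0)))"
  proof (rule lborel_pair.Fubini_integrable[OF m])
    have "integrable lborel (\<lambda>s. indicator {0..1::real} s * (LBINT x. norm (F x)))" by simp
    then show "integrable lborel (\<lambda>s. LBINT x. norm (case (s, x) of (s, x) \<Rightarrow> indicator {0..1} s *\<^sub>R F (x - (h * s, 0))))"
      by (simp add: tr)
    show "AE s in lborel. integrable lborel (\<lambda>x. case (s, x) of (s, x) \<Rightarrow> indicator {0..1} s *\<^sub>R F (x - (h * s, 0)))"
      using integrable_lborel_translate[OF F] by (auto simp: diff_conv_add_uminus simp del: add_uminus_conv_diff)
  qed
  then have "integrable (lborel \<Otimes>\<^sub>M lborel) (\<lambda>(x, y). case (y, x) of (s, x) \<Rightarrow> indicator {0..1} s *\<^sub>R F (x - (h * s, 0)))"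
    by (rule lborel_pair.integrable_product_swap)
  then show ?thesis by simp
qed

lemma steklov_integrable:
  fixes F :: "real \<times> 'p::euclidean_space \<Rightarrow> 'v::{banach,second_countable_topology}"
  assumes F: "integrable lborel F"
  shows "integrable lborel (steklov h F)"
  unfolding steklov_def
  using lborel_pair.integrable_fst'[OF translate_joint_integrable[OF F, of h]] by simp

lemma steklov_AE_integrable:
  fixes F :: "real \<times> 'p::euclidean_space \<Rightarrow> 'v::{banach,second_countable_topology}"
  assumes F: "integrable lborel F"
  shows "AE x in lborel. integrable lborel (\<lambda>s. indicator {0..1} s *\<^sub>R F (x - (h * s, 0)))"
  using lborel_pair.AE_integrable_fst'[OF translate_joint_integrable[OF F, of h]] by simp

lemma steklov_sq_le:
  fixes F :: "real \<times> 'p::euclidean_space \<Rightarrow> 'v::{banach,second_countable_topology}"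
  assumes F: "integrable lborel F" and F2: "integrable lborel (\<lambda>x. (norm (F x))^2)"
  shows "integrable lborel (\<lambda>x. (norm (steklov h F x))^2)"
proof (rule Bochner_Integration.integrable_bound[OF steklov_integrable[OF F2, of h]])
  have [measurable]: "F \<in> borel_measurable borel" using F by (auto dest: borel_measurable_integrable)
  show "(\<lambda>x. (norm (steklov h F x))^2) \<in> borel_measurable lborel" by measurable
  show "AE x in lborel. norm ((norm (steklov h F x))^2) \<le> norm (steklov h (\<lambda>x. (norm (F x))^2) x)"
    using steklov_AE_integrable[OF F, of h] steklov_AE_integrable[OF F2, of h]
  proof eventually_elim
    case (elim x)
    let ?n = "\<lambda>s. norm (F (x - (h * s, 0)))" and ?I = "indicator {0..1} :: real \<Rightarrow> real"
    define m where "m = (LBINT s. ?I s * ?n s)"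
    have i1: "integrable lborel (\<lambda>s. ?I s * ?n s)"
      using integrable_norm[OF elim(1)] by simp
    have i2: "integrable lborel (\<lambda>s. ?I s * (?n s)^2)" using elim(2) by simp
    have "norm (steklov h F x) \<le> m"
      unfolding steklov_def m_def using integral_norm_bound[of lborel "\<lambda>s. ?I s *\<^sub>R F (x - (h * s, 0))"] by simp
    then have "(norm (steklov h F x))^2 \<le> m^2" by (intro power_mono) auto
    \<comment> \<open>Jensen's inequality, read off from the nonnegative variance of
      \<open>?n\<close> over the unit interval.\<close>
    also have "m^2 \<le> (LBINT s. ?I s * (?n s)^2)"
    proof -
      have "0 \<le> (LBINT s. ?I s * (?n s - m)^2)" by (intro integral_nonneg_AE) simp
      also have "\<dots> = (LBINT s. ?I s * (?n s)^2 - 2 * m * (?I s * ?n s) + m^2 * ?I s)"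
        by (intro Bochner_Integration.integral_cong) (auto simp: indicator_def power2_diff)
      also have "\<dots> = (LBINT s. ?I s * (?n s)^2) - 2 * m * m + m^2"
        using i1 i2 by (simp add: m_def[symmetric])
      finally show ?thesis by (simp add: power2_eq_square)
    qed
    also have "\<dots> = steklov h (\<lambda>x. (norm (F x))^2) x" by (simp add: steklov_def)
    finally show ?case by simp
  qed
qed

text \<open>Fubini: averaging and then pairing equals pairing each translate and then averaging
  numbers. Joint integrability \<open>J\<close> is a hypothesis because it has two different
  sources, \<open>b\<close> bounded or both fields square integrable.\<close>

lemma steklov_pair:
  fixes F b :: "real \<times> 'p::euclidean_space \<Rightarrow> 'v::euclidean_space"
  assumes F: "integrable lborel F"
    and J: "integrable (lborel \<Otimes>\<^sub>M lborel) (\<lambda>(x, s). indicator {0..1} s * (F (x - (h * s, 0)) \<bullet> b x))"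
    and [measurable]: "b \<in> borel_measurable borel"
  shows "integrable lborel (\<lambda>x. steklov h F x \<bullet> b x)"
    "(LBINT x. steklov h F x \<bullet> b x) = (LBINT s. indicator {0..1} s * (LBINT x. F (x - (h * s, 0)) \<bullet> b x))"
proof -
  have ae: "AE x in lborel. (LBINT s. indicator {0..1} s * (F (x - (h * s, 0)) \<bullet> b x)) = steklov h F x \<bullet> b x"
    using steklov_AE_integrable[OF F, of h]
  proof eventually_elim
    case (elim x)
    from integral_inner_left[OF elim, of "b x"] show ?case unfolding steklov_def by simp
  qed
  have I: "integrable lborel (\<lambda>x. LBINT s. indicator {0..1} s * (F (x - (h * s, 0)) \<bullet> b x))"
    using lborel_pair.integrable_fst'[OF J] by simp
  have [measurable]: "(\<lambda>x. steklov h F x \<bullet> b x) \<in> borel_measurable lborel"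
    using F[THEN borel_measurable_integrable] by simp
  show "integrable lborel (\<lambda>x. steklov h F x \<bullet> b x)"
    using ae by (subst integrable_cong_AE[symmetric, OF _ _ ae]) (use I in auto)
  have "(LBINT x. steklov h F x \<bullet> b x) = (LBINT x. (LBINT s. indicator {0..1} s * (F (x - (h * s, 0)) \<bullet> b x)))"
    by (rule integral_cong_AE[symmetric]) (use ae I in auto)
  also have "\<dots> = (LBINT s. (LBINT x. indicator {0..1} s * (F (x - (h * s, 0)) \<bullet> b x)))"
    using lborel_pair.Fubini_integral[OF J] by simp
  finally show "(LBINT x. steklov h F x \<bullet> b x) = (LBINT s. indicator {0..1} s * (LBINT x. F (x - (h * s, 0)) \<bullet> b x))"
    by simp
qed

lemma steklov_joint_bounded:
  fixes F b :: "real \<times> 'p::euclidean_space \<Rightarrow> 'v::euclidean_space"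
  assumes F: "integrable lborel F" and [measurable]: "b \<in> borel_measurable borel" and M: "\<And>x. norm (b x) \<le> M"
  shows "integrable (lborel \<Otimes>\<^sub>M lborel) (\<lambda>(x, s). indicator {0..1} s * (F (x - (h * s, 0)) \<bullet> b x))"
proof (rule Bochner_Integration.integrable_bound[OF integrable_mult_right[OF integrable_norm[OF translate_joint_integrable[OF F, of h]], of M]])
  have [measurable]: "F \<in> borel_measurable borel" using F by (auto dest: borel_measurable_integrable)
  show "(\<lambda>(x, s). indicator {0..1} s * (F (x - (h * s, 0)) \<bullet> b x)) \<in> borel_measurable (lborel \<Otimes>\<^sub>M lborel)"
    by measurable
  have "M \<ge> 0" using M[of 0] norm_ge_zero[of "b 0"] by linarith
  have "\<bar>F y \<bullet> b x\<bar> \<le> M * norm (F y)" for x y by (rule abs_inner_le[OF M])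
  then show "AE xs in lborel \<Otimes>\<^sub>M lborel. norm (case xs of (x, s) \<Rightarrow> indicator {0..1} s * (F (x - (h * s, 0)) \<bullet> b x))
     \<le> norm (M * norm (case xs of (x, s) \<Rightarrow> indicator {0..1} s *\<^sub>R F (x - (h * s, 0))))"
    using \<open>M \<ge> 0\<close> by (intro AE_I2) (auto simp: indicator_def abs_mult split: prod.splits)
qed

lemma steklov_joint_L2:
  fixes F b :: "real \<times> 'p::euclidean_space \<Rightarrow> 'v::euclidean_space"
  assumes [measurable]: "F \<in> borel_measurable borel" "b \<in> borel_measurable borel"
    and F: "integrable lborel (\<lambda>x. (norm (F x))^2)" and b: "integrable lborel (\<lambda>x. (norm (b x))^2)"
  shows "integrable (lborel \<Otimes>\<^sub>M lborel) (\<lambda>(x, s). indicator {0..1} s * (F (x - (h * s, 0)) \<bullet> b x))"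
proof (rule Bochner_Integration.integrable_bound[OF Bochner_Integration.integrable_add
    [OF translate_joint_integrable[OF F, of h] translate_joint_integrable[OF b, of 0]]])
  show "(\<lambda>(x, s). indicator {0..1} s * (F (x - (h * s, 0)) \<bullet> b x)) \<in> borel_measurable (lborel \<Otimes>\<^sub>M lborel)"
    by measurable
  have "\<bar>F y \<bullet> b x\<bar> \<le> (norm (F y))^2 + (norm (b x))^2" for x y by (rule abs_inner_le_squares)
  then show "AE xs in lborel \<Otimes>\<^sub>M lborel. norm (case xs of (x, s) \<Rightarrow> indicator {0..1} s * (F (x - (h * s, 0)) \<bullet> b x))
     \<le> norm ((case xs of (x, s) \<Rightarrow> indicator {0..1} s *\<^sub>R (norm (F (x - (h * s, 0))))^2)
          + (case xs of (x, s) \<Rightarrow> indicator {0..1} s *\<^sub>R (norm (b (x - (0 * s, 0))))^2))"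
    by (intro AE_I2) (auto simp: indicator_def abs_mult zero_prod_def[symmetric] split: prod.splits)
qed

text \<open>By \<open>steklov_pair\<close> the left side is an average over \<open>s\<close> of
  pairings with the shift \<open>- (h n * s)\<close>. Each of them converges by \<open>lim\<close>,
  and \<open>B\<close> is a common majorant.\<close>

lemma steklov_limit:
  fixes F b :: "real \<times> 'p::euclidean_space \<Rightarrow> 'v::euclidean_space"
  assumes F: "integrable lborel F" and [measurable]: "b \<in> borel_measurable borel"
    and J: "\<And>h. integrable (lborel \<Otimes>\<^sub>M lborel) (\<lambda>(x, s). indicator {0..1} s * (F (x - (h * s, 0)) \<bullet> b x))"
    and lim: "\<And>X. X \<longlonglongrightarrow> 0 \<Longrightarrow> (\<lambda>n. LBINT x. F (x + X n) \<bullet> b x) \<longlonglongrightarrow> (LBINT x. F x \<bullet> b x)"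
    and B: "\<And>y. \<bar>LBINT x. F (x + y) \<bullet> b x\<bar> \<le> B" and h: "h \<longlonglongrightarrow> 0"
  shows "(\<lambda>n. LBINT x. steklov (h n) F x \<bullet> b x) \<longlonglongrightarrow> (LBINT x. F x \<bullet> b x)"
proof -
  have e: "x - (r, 0) = x + (- r, 0)" for x :: "real \<times> 'p" and r by (simp add: prod_eq_iff)
  have [measurable]: "F \<in> borel_measurable borel" using F by (auto dest: borel_measurable_integrable)
  have "(\<lambda>n. LBINT s. indicator {0..1} s * (LBINT x. F (x - (h n * s, 0)) \<bullet> b x))
    \<longlonglongrightarrow> (LBINT s. indicator {0..1::real} s * (LBINT x. F x \<bullet> b x))"
  proof (rule integral_dominated_convergence[where w="\<lambda>s. indicator {0..1::real} s * B"])
    show "AE s in lborel. (\<lambda>n. indicator {0..1} s * (LBINT x. F (x - (h n * s, 0)) \<bullet> b x))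
       \<longlonglongrightarrow> indicator {0..1::real} s * (LBINT x. F x \<bullet> b x)"
    proof (rule AE_I2)
      fix s :: real
      have "(\<lambda>n. (- (h n * s), 0 :: 'p)) \<longlonglongrightarrow> (- (0 * s), 0)" by (intro tendsto_intros h)
      then have X: "(\<lambda>n. (- (h n * s), 0 :: 'p)) \<longlonglongrightarrow> 0" by (simp add: zero_prod_def)
      from tendsto_mult_left[OF lim[OF X], of "indicator {0..1} s"]
      show "(\<lambda>n. indicator {0..1} s * (LBINT x. F (x - (h n * s, 0)) \<bullet> b x))
       \<longlonglongrightarrow> indicator {0..1::real} s * (LBINT x. F x \<bullet> b x)"
        unfolding e .
    qed
    show "AE s in lborel. norm (indicator {0..1} s * (LBINT x. F (x - (h n * s, 0)) \<bullet> b x)) \<le> indicator {0..1::real} s * B" for n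
      unfolding e using B[of "(- (h n * _), 0)"] by (intro AE_I2) (auto simp: indicator_def)
  qed auto
  then show ?thesis by (simp add: steklov_pair(2)[OF F J])
qed

text \<open>The version for the transport term, which is only integrable and therefore meets a
  bounded \<open>b\<close>; it rests on L1 continuity of translations.\<close>

lemma steklov_limit_bounded:
  fixes F b :: "real \<times> 'p::euclidean_space \<Rightarrow> 'v::euclidean_space"
  assumes F: "integrable lborel F" and [measurable]: "b \<in> borel_measurable borel" and M: "\<And>x. norm (b x) \<le> M"
    and h: "h \<longlonglongrightarrow> 0"
  shows "(\<lambda>n. LBINT x. steklov (h n) F x \<bullet> b x) \<longlonglongrightarrow> (LBINT x. F x \<bullet> b x)"
proof (rule steklov_limit[OF F _ steklov_joint_bounded[OF F _ M] _ _ h])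
  have [measurable]: "F \<in> borel_measurable borel" using F by (auto dest: borel_measurable_integrable)
  have M0: "M \<ge> 0" using M[of 0] norm_ge_zero[of "b 0"] by linarith
  have bd: "\<bar>f \<bullet> b x\<bar> \<le> M * norm f" for f x by (rule abs_inner_le[OF M])
  have i: "integrable lborel (\<lambda>x. F (x + y) \<bullet> b x)" for y
    by (rule integrable_inner_bounded[where Q=UNIV, OF integrable_lborel_translate[OF F] _ M]) auto
  have tr: "(LBINT x. norm (F (x + a))) = (LBINT x. norm (F x))" for a
    using integral_lborel_translate[of "\<lambda>x. norm (F x)" "a"] by simp
  show "\<bar>LBINT x. F (x + y) \<bullet> b x\<bar> \<le> M * (LBINT x. norm (F x))" for y
    using abs_integral_le[OF i integrable_mult_right[OF integrable_norm[OF integrable_lborel_translate[OF F]]] bd] by (simp add: tr)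
  fix X :: "nat \<Rightarrow> real \<times> 'p" assume X: "X \<longlonglongrightarrow> 0"
  show "(\<lambda>n. LBINT x. F (x + X n) \<bullet> b x) \<longlonglongrightarrow> (LBINT x. F x \<bullet> b x)"
  proof (rule LIM_zero_cancel, rule tendsto_rabs_zero_cancel, rule tendsto_sandwich[OF _ _ tendsto_const])
    show "(\<lambda>n. M * (LBINT x. norm (F (x + X n) - F x))) \<longlonglongrightarrow> 0"
      using tendsto_mult_left[OF translation_L1[OF F X], of M] by simp
    show "\<forall>\<^sub>F n in sequentially. \<bar>(LBINT x. F (x + X n) \<bullet> b x) - (LBINT x. F x \<bullet> b x)\<bar> \<le> M * (LBINT x. norm (F (x + X n) - F x))"
    proof (rule always_eventually, rule allI)
      fix n
      have iD: "integrable lborel (\<lambda>x. F (x + X n) - F x)" using F integrable_lborel_translate[OF F, of "X n"] by simp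
      have iDb: "integrable lborel (\<lambda>x. (F (x + X n) - F x) \<bullet> b x)" using i[of "X n"] i[of 0] by (simp add: inner_diff_left)
      have "(LBINT x. F (x + X n) \<bullet> b x) - (LBINT x. F x \<bullet> b x) = (LBINT x. (F (x + X n) - F x) \<bullet> b x)"
        using i[of "X n"] i[of 0] by (simp add: inner_diff_left)
      also have "\<bar>\<dots>\<bar> \<le> (LBINT x. M * norm (F (x + X n) - F x))"
        by (rule abs_integral_le[OF iDb integrable_mult_right[OF integrable_norm[OF iD]] bd])
      finally show "\<bar>(LBINT x. F (x + X n) \<bullet> b x) - (LBINT x. F x \<bullet> b x)\<bar> \<le> M * (LBINT x. norm (F (x + X n) - F x))"
        by simp
    qed
  qed auto
qed measurable

text \<open>The version for the flux, which is square integrable and meets a weighted gradient that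
  is square integrable but unbounded.\<close>

lemma steklov_limit_L2:
  fixes F b :: "real \<times> 'p::euclidean_space \<Rightarrow> 'v::euclidean_space"
  assumes F: "integrable lborel F" and F2: "integrable lborel (\<lambda>x. (norm (F x))^2)"
    and [measurable]: "b \<in> borel_measurable borel" and b2: "integrable lborel (\<lambda>x. (norm (b x))^2)"
    and h: "h \<longlonglongrightarrow> 0"
  shows "(\<lambda>n. LBINT x. steklov (h n) F x \<bullet> b x) \<longlonglongrightarrow> (LBINT x. F x \<bullet> b x)"
proof -
  have [measurable]: "F \<in> borel_measurable borel" using F by (auto dest: borel_measurable_integrable)
  have tr: "(LBINT x. (norm (F (x + a)))^2) = (LBINT x. (norm (F x))^2)" for a
    using integral_lborel_translate[of "\<lambda>x. (norm (F x))^2" "a"] by simp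
  have tri: "integrable lborel (\<lambda>x. (norm (F (x + a)))^2)" for a
    using integrable_lborel_translate[OF F2, of a] by simp
  show ?thesis
  proof (rule steklov_limit[OF F _ steklov_joint_L2[OF _ _ F2 b2] _ _ h])
    show "(\<lambda>n. LBINT x. F (x + X n) \<bullet> b x) \<longlonglongrightarrow> (LBINT x. F x \<bullet> b x)"
      if "X \<longlonglongrightarrow> 0" for X by (rule translation_pairing_L2[OF F F2 _ b2 that]) measurable
    show "\<bar>LBINT x. F (x + y) \<bullet> b x\<bar> \<le> (LBINT x. (norm (F x))^2) + (LBINT x. (norm (b x))^2)" for y
    proof -
      have i: "integrable lborel (\<lambda>x. F (x + y) \<bullet> b x)"
        by (rule integrable_inner_L2) (use tri b2 in auto)
      have "\<bar>LBINT x. F (x + y) \<bullet> b x\<bar> \<le> (LBINT x. (norm (F (x + y)))^2 + (norm (b x))^2)"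
        by (rule abs_integral_le[OF i Bochner_Integration.integrable_add[OF tri b2] abs_inner_le_squares])
      then show ?thesis using tri[of y] b2 by (simp add: tr)
    qed
  qed measurable
qed

text \<open>The substitution \<open>t + h * s\<close> for the time moves the average from
  \<open>F\<close> to the time weight, where the backward mean becomes a forward mean. Averaging the
  equation thus amounts to testing it with a smoother weight.\<close>

lemma steklov_time_test:
  fixes F :: "real \<times> 'p::euclidean_space \<Rightarrow> 'v::euclidean_space"
  assumes F: "integrable lborel F" and [measurable]: "a \<in> borel_measurable borel" "w \<in> borel_measurable borel"
    and a: "\<And>t. \<bar>a t\<bar> \<le> 1" and w: "\<And>p. norm (w p) \<le> M"
  shows "(LBINT x. steklov h F x \<bullet> (a (fst x) *\<^sub>R w (snd x)))
    = (LBINT x. (LBINT s. indicator {0..1} s * a (fst x + h * s)) * (F x \<bullet> w (snd x)))"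
    "integrable lborel (\<lambda>x. steklov h F x \<bullet> (a (fst x) *\<^sub>R w (snd x)))"
proof -
  have [measurable]: "F \<in> borel_measurable borel" using F by (auto dest: borel_measurable_integrable)
  have M0: "M \<ge> 0" using w[of 0] norm_ge_zero[of "w 0"] by linarith
  have b: "norm (a (fst x) *\<^sub>R w (snd x)) \<le> M" for x
    using mult_mono[OF a[of "fst x"] w[of "snd x"]] by simp
  have m: "(\<lambda>x. a (fst x) *\<^sub>R w (snd x)) \<in> borel_measurable borel" by measurable
  have J: "integrable (lborel \<Otimes>\<^sub>M lborel) (\<lambda>(x, s). indicator {0..1} s * (F (x - (h * s, 0)) \<bullet> (a (fst x) *\<^sub>R w (snd x))))"
    by (rule steklov_joint_bounded[OF F _ b]) measurable
  show "integrable lborel (\<lambda>x. steklov h F x \<bullet> (a (fst x) *\<^sub>R w (snd x)))" by (rule steklov_pair[OF F J m])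
  have tr: "(LBINT x. F (x - (h * s, 0)) \<bullet> (a (fst x) *\<^sub>R w (snd x)))
     = (LBINT x. a (fst x + h * s) * (F x \<bullet> w (snd x)))" for s
  proof -
    have "(LBINT x. F (x - (h * s, 0)) \<bullet> (a (fst x) *\<^sub>R w (snd x)))
      = (LBINT x. F ((x + (h * s, 0)) - (h * s, 0)) \<bullet> (a (fst (x + (h * s, 0))) *\<^sub>R w (snd (x + (h * s, 0)))))"
      by (rule integral_lborel_translate[symmetric]) measurable
    then show ?thesis by simp
  qed
  have bd: "\<bar>a t * (F x \<bullet> w p)\<bar> \<le> M * norm (F x)" for t x p
    using mult_mono[OF a abs_inner_le[OF w]] by (simp add: abs_mult)
  have J2: "integrable (lborel \<Otimes>\<^sub>M lborel) (\<lambda>(x, s). indicator {0..1} s * (a (fst x + h * s) * (F x \<bullet> w (snd x))))"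
  proof (rule Bochner_Integration.integrable_bound[OF integrable_mult_right[OF integrable_norm[OF translate_joint_integrable[OF F, of 0]], of M]])
    show "AE xs in lborel \<Otimes>\<^sub>M lborel. norm (case xs of (x, s) \<Rightarrow> indicator {0..1} s * (a (fst x + h * s) * (F x \<bullet> w (snd x))))
      \<le> norm (M * norm (case xs of (x, s) \<Rightarrow> indicator {0..1} s *\<^sub>R F (x - (0 * s, 0))))"
      using bd M0 by (intro AE_I2) (auto simp: indicator_def abs_mult zero_prod_def[symmetric] split: prod.splits)
  qed measurable
  have "(LBINT x. steklov h F x \<bullet> (a (fst x) *\<^sub>R w (snd x)))
     = (LBINT s. (LBINT x. indicator {0..1} s * (a (fst x + h * s) * (F x \<bullet> w (snd x)))))"
    unfolding steklov_pair(2)[OF F J m] tr by (simp only: integral_mult_right_zero)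
  also have "\<dots> = (LBINT x. (LBINT s. indicator {0..1} s * (a (fst x + h * s) * (F x \<bullet> w (snd x)))))"
    by (rule lborel_pair.Fubini_integral[OF J2])
  also have "\<dots> = (LBINT x. (LBINT s. indicator {0..1} s * a (fst x + h * s)) * (F x \<bullet> w (snd x)))"
    by (simp only: mult.assoc[symmetric] integral_mult_left_zero)
  finally show "(LBINT x. steklov h F x \<bullet> (a (fst x) *\<^sub>R w (snd x)))
    = (LBINT x. (LBINT s. indicator {0..1} s * a (fst x + h * s)) * (F x \<bullet> w (snd x)))" .
qed

text \<open>Turns a merely continuous time weight into an admissible one.\<close>
lemma steklov_weight:
  fixes a :: "real \<Rightarrow> real"
  assumes a: "continuous_on UNIV a" and h: "h \<noteq> 0"
  shows "((\<lambda>t. LBINT s. indicator {0..1} s * a (t + h * s)) has_real_derivative (a (t + h) - a t) / h) (at t)"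
proof -
  \<comment> \<open>An antiderivative on the whole line turns the forward mean into
    \<open>(J (t + h) - J t) / h\<close>, whose derivative is immediate.\<close>
  obtain J where "\<forall>x. -\<infinity> < ereal x \<longrightarrow> ereal x < \<infinity> \<longrightarrow> (J has_vector_derivative a x) (at x)"
    using einterval_antiderivative[of "-\<infinity>" "\<infinity>" a] a by (auto simp: continuous_on_eq_continuous_at)
  then have J: "(J has_real_derivative a x) (at x)" for x by (simp add: has_real_derivative_iff_has_vector_derivative)
  have "(LBINT s. indicator {0..1} s * a (t + h * s)) = (J (t + h) - J t) / h" for t
  proof -
    have "(LBINT s. a (t + h * s) * indicator {0..1} s) = J (t + h * 1) / h - J (t + h * 0) / h"
    proof (rule integral_FTC_Icc_real)
      show "((\<lambda>s. J (t + h * s) / h) has_real_derivative a (t + h * s)) (at s)" for s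
      proof -
        have "((\<lambda>s. t + h * s) has_real_derivative h) (at s)" by (auto intro!: derivative_eq_intros)
        from DERIV_cdivide[OF DERIV_chain2[OF J this], of h] show ?thesis using h by simp
      qed
      show "isCont (\<lambda>s. a (t + h * s)) s" for s
        by (rule isCont_o2[where g=a]) (use a in \<open>auto simp: continuous_on_eq_continuous_at\<close>)
    qed simp
    then show ?thesis by (simp add: mult.commute diff_divide_distrib)
  qed
  moreover have "((\<lambda>t. (J (t + h) - J t) / h) has_real_derivative (a (t + h) - a t) / h) (at t)"
    by (intro DERIV_cdivide DERIV_diff J) (simp only: J DERIV_shift[symmetric])
  ultimately show ?thesis by simp
qed

section \<open>Renormalized energy inequality\<close>

lemma integral_MO_eq:
  assumes "F \<in> borel_measurable borel" "\<And>p. p \<notin> Om lx ly \<Longrightarrow> F p = (0::real)"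
  shows "(\<integral>p. F p \<partial>MO lx ly) = (LBINT p. F p)"
  using assms(2) unfolding lebesgue_on_borel(2)[OF Om_borel assms(1)]
  by (intro Bochner_Integration.integral_cong) (auto simp: indicator_def)

lemma integrable_MO_I:
  fixes F :: "pt \<Rightarrow> real"
  assumes "integrable lborel F"
  shows "integrable (MO lx ly) F"
proof -
  have m: "F \<in> borel_measurable borel" using borel_measurable_integrable[OF assms] by simp
  show ?thesis
    unfolding lebesgue_on_borel(3)[OF Om_borel m] by (rule integrable_mult_indicator[OF _ assms]) simp
qed

text \<open>The fields stand for T - eta, its gradient, grad T - grad psi and the velocity, extended
  by zero off the cell so that they can be translated on the whole space. In \<open>weak\<close> the
  time weights are supported strictly between 0 and \<open>R\<close>, where cutting the fields at
  those times is invisible. Transport appears in advective form: in divergence form the flux would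
  contain \<theta> u, which is merely integrable and could not be the field \<open>Q\<close> of
  \<open>weak_test_compose\<close>.\<close>

locale energy_setup =
  fixes lx ly R C :: real and \<theta> :: "real \<times> pt \<Rightarrow> real" and D f u :: "real \<times> pt \<Rightarrow> pt"
  assumes meas [measurable]: "\<theta> \<in> borel_measurable borel" "D \<in> borel_measurable borel"
      "f \<in> borel_measurable borel" "u \<in> borel_measurable borel"
    and supp: "\<And>x. snd x \<notin> Om lx ly \<Longrightarrow> \<theta> x = 0" "\<And>x. snd x \<notin> Om lx ly \<Longrightarrow> D x = 0"
      "\<And>x. snd x \<notin> Om lx ly \<Longrightarrow> f x = 0" "\<And>x. snd x \<notin> Om lx ly \<Longrightarrow> u x = 0"
    and int: "integrable lborel \<theta>" "integrable lborel (\<lambda>x. (\<theta> x)^2)" "integrable lborel (\<lambda>x. (norm (D x))^2)"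
      "integrable lborel f" "integrable lborel (\<lambda>x. (norm (f x))^2)" "integrable lborel (\<lambda>x. (norm (u x))^2)"
    and slice: "AE t in lborel. t \<in> {0..R} \<longrightarrow> H10_limit lx ly (\<lambda>p. \<theta> (t, p)) (\<lambda>p. D (t, p))"
    and div: "AE t in lborel. t \<in> {0..R} \<longrightarrow> (\<forall>\<phi>. test0 lx ly \<phi> \<longrightarrow> (\<integral>p. u (t, p) \<bullet> sgrad \<phi> p \<partial>MO lx ly) = 0)"
    and bound: "AE t in lborel. t \<in> {0..R} \<longrightarrow> (LBINT p. (\<theta> (t, p))^2) \<le> C"
    and weak: "\<And>A A' \<phi> c d. 0 < c \<Longrightarrow> d < R \<Longrightarrow> (\<And>t. (A has_real_derivative A' t) (at t)) \<Longrightarrow> continuous_on UNIV A' \<Longrightarrow>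
      (\<And>t. t \<notin> {c..d} \<Longrightarrow> A t = 0) \<Longrightarrow> test0 lx ly \<phi> \<Longrightarrow>
      (LBINT x. A' (fst x) * (\<theta> x * \<phi> (snd x)))
        = (LBINT x. A (fst x) * (\<phi> (snd x) * (u x \<bullet> D x) + f x \<bullet> sgrad \<phi> (snd x)))"
begin

text \<open>The transport term, a product of two square integrable fields and hence merely
  integrable; below it is paired with bounded functions.\<close>

definition K :: "real \<times> pt \<Rightarrow> real" where "K x = u x \<bullet> D x"

lemma K_integrable: "integrable lborel K"
  unfolding K_def by (rule integrable_inner_L2) (use int in auto)

lemma K_meas [measurable]: "K \<in> borel_measurable borel" unfolding K_def by measurable

text \<open>The source in the averaged equation, whose flux is \<open>steklov h f\<close>. The mean
  of the time derivative over the last \<open>h\<close> time units is a backward difference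
  quotient, so that no derivative in time is left and the equation makes sense on single
  slices.\<close>

definition P :: "real \<Rightarrow> real \<times> pt \<Rightarrow> real" where
  "P h x = (\<theta> x - \<theta> (x - (h, 0))) / h + steklov h K x"

lemma translate_minus:
  fixes F :: "real \<times> pt \<Rightarrow> 'v::{banach,second_countable_topology}"
  assumes "integrable lborel F"
  shows "integrable lborel (\<lambda>x. F (x - a))"
  using integrable_lborel_translate[OF assms, of "- a"] by simp

lemma P_integrable: "integrable lborel (P h)"
  unfolding P_def using int(1) translate_minus[OF int(1)] steklov_integrable[OF K_integrable]
  by (intro Bochner_Integration.integrable_add integrable_divide Bochner_Integration.integrable_diff) auto

lemma P_meas [measurable]: "P h \<in> borel_measurable borel" unfolding P_def by measurable

text \<open>The weak equation is tested with the forward mean \<open>A\<close> of \<open>a\<close>,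
  whose derivative is a difference quotient of \<open>a\<close>; a shift in time passes it on to
  \<open>\<theta>\<close>. The value and the gradient of \<open>\<phi>\<close> are combined into one
  vector weight, so a single orthogonality relation encodes the whole equation.\<close>

lemma orthogonal_average:
  assumes h: "0 < h" "h < c" and d: "d < R" and \<phi>: "test0 lx ly \<phi>"
    and a: "continuous_on UNIV a" "\<And>t. t \<notin> {c..d} \<Longrightarrow> a t = 0" "\<And>t. \<bar>a t\<bar> \<le> 1"
  shows "(LBINT x. a (fst x) * ((P h x, steklov h f x) \<bullet> (indicator (Om lx ly) (snd x) *\<^sub>R (\<phi> (snd x), sgrad \<phi> (snd x))))) = 0"
proof -
  note [measurable] = test0_cont(3,4)[OF \<phi>]
  have [measurable]: "a \<in> borel_measurable borel" using a(1) by (rule borel_measurable_continuous_onI)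
  obtain M where M: "\<And>p. p \<in> Om lx ly \<Longrightarrow> \<bar>\<phi> p\<bar> \<le> M" "\<And>p. p \<in> Om lx ly \<Longrightarrow> norm (sgrad \<phi> p) \<le> M" "M \<ge> 0"
    using test0_bounded[OF \<phi>] by blast
  define w1 where "w1 p = indicator (Om lx ly) p * \<phi> p" for p
  define w2 where "w2 p = indicator (Om lx ly) p *\<^sub>R sgrad \<phi> p" for p
  have [measurable]: "w1 \<in> borel_measurable borel" "w2 \<in> borel_measurable borel"
    unfolding w1_def w2_def by measurable
  have w: "norm (w1 p) \<le> M" "norm (w2 p) \<le> M" for p
    using M by (auto simp: w1_def w2_def indicator_def)
  define A where "A t = (LBINT s. indicator {0..1} s * a (t + h * s))" for t
  define A' where "A' t = (a (t + h) - a t) / h" for t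
  have dA: "(A has_real_derivative A' t) (at t)" for t
    unfolding A_def A'_def by (rule steklov_weight[OF a(1)]) (use h in simp)
  have cA': "continuous_on UNIV A'"
    unfolding A'_def by (intro continuous_intros continuous_on_compose2[OF a(1)] a(1)) (use h in auto)
  \<comment> \<open>The forward mean enlarges the support to the left by \<open>h\<close>, and
    \<open>h < c\<close> keeps it away from time 0.\<close>
  have A0: "A t = 0" if "t \<notin> {c - h..d}" for t
  proof -
    have "indicator {0..1} s * a (t + h * s) = 0" for s :: real
    proof (cases "0 \<le> s \<and> s \<le> 1")
      case True
      then have "0 \<le> h * s" "h * s \<le> h" using h by auto
      then have "t + h * s \<notin> {c..d}" using that by auto
      then show ?thesis using a(2) by simp
    qed (auto simp: indicator_def)
    then show ?thesis unfolding A_def by (simp only: integral_zero)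
  qed
  have W: "(LBINT x. A' (fst x) * (\<theta> x * \<phi> (snd x)))
        = (LBINT x. A (fst x) * (\<phi> (snd x) * (u x \<bullet> D x) + f x \<bullet> sgrad \<phi> (snd x)))"
    by (rule weak[OF _ d dA cA' A0 \<phi>]) (use h in auto)
  have eK: "\<phi> (snd x) * (u x \<bullet> D x) = K x \<bullet> w1 (snd x)" for x
    using supp(2)[of x] by (cases "snd x \<in> Om lx ly") (auto simp: K_def w1_def)
  have ef: "f x \<bullet> sgrad \<phi> (snd x) = f x \<bullet> w2 (snd x)" for x
    using supp(3)[of x] by (cases "snd x \<in> Om lx ly") (auto simp: w2_def)
  have et: "\<theta> x * \<phi> (snd x) = \<theta> x * w1 (snd x)" for x
    using supp(1)[of x] by (cases "snd x \<in> Om lx ly") (auto simp: w1_def)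
  note T1 = steklov_time_test[where a=a and w=w1 and h=h, OF K_integrable _ _ a(3) w(1), folded A_def]
  note T2 = steklov_time_test[where a=a and w=w2 and h=h, OF int(4) _ _ a(3) w(2), folded A_def]
  have [measurable]: "A \<in> borel_measurable borel" unfolding A_def by measurable
  have A1: "\<bar>A t\<bar> \<le> 1" for t
  proof -
    have "integrable lborel (\<lambda>s. indicator {0..1} s * a (t + h * s))"
      by (rule Bochner_Integration.integrable_bound[where f="indicator {0..1::real} :: real \<Rightarrow> real"])
         (use a(3) in \<open>auto simp: indicator_def\<close>)
    then have "(LBINT s. norm (indicator {0..1} s * a (t + h * s))) \<le> (LBINT s. indicator {0..1::real} s)"
    proof (intro integral_mono integrable_norm)
      show "norm (indicator {0..1} s * a (t + h * s)) \<le> (indicator {0..1::real} s :: real)" for s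
        using a(3) by (auto simp: indicator_def)
    qed auto
    from order_trans[OF integral_norm_bound this] show ?thesis by (simp add: A_def)
  qed
  have bdi: "integrable lborel (\<lambda>x. \<alpha> (fst x) * (F x \<bullet> w (snd x)))"
    if F: "integrable lborel F" and [measurable]: "\<alpha> \<in> borel_measurable borel" "w \<in> borel_measurable borel"
      and b: "\<And>t. \<bar>\<alpha> t\<bar> \<le> 1" "\<And>p. norm (w p) \<le> M"
    for \<alpha> :: "real \<Rightarrow> real" and F :: "real \<times> pt \<Rightarrow> 'v::euclidean_space" and w
  proof -
    have "norm (\<alpha> (fst x) *\<^sub>R w (snd x)) \<le> M" for x
      using mult_mono[OF b(1)[of "fst x"] b(2)[of "snd x"]] by simp
    then show ?thesis
      using integrable_inner_bounded[where Q=UNIV and v="\<lambda>x. \<alpha> (fst x) *\<^sub>R w (snd x)" and m=M, OF F] by simp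
  qed
  have iAK: "integrable lborel (\<lambda>x. A (fst x) * (K x \<bullet> w1 (snd x)))"
    by (rule bdi[OF K_integrable _ _ A1 w(1)]) measurable
  have iAf: "integrable lborel (\<lambda>x. A (fst x) * (f x \<bullet> w2 (snd x)))"
    by (rule bdi[OF int(4) _ _ A1 w(2)]) measurable
  have ia\<theta>: "integrable lborel (\<lambda>x. a (fst x) * (\<theta> x \<bullet> w1 (snd x)))"
    by (rule bdi[OF int(1) _ _ a(3) w(1)]) measurable
  have iah\<theta>: "integrable lborel (\<lambda>x. a (fst x + h) * (\<theta> x \<bullet> w1 (snd x)))"
    by (rule bdi[OF int(1) _ _ a(3) w(1), of "\<lambda>t. t + h"]) measurable
  have ia\<theta>h: "integrable lborel (\<lambda>x. a (fst x) * (\<theta> (x - (h, 0)) \<bullet> w1 (snd x)))"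
    by (rule bdi[OF translate_minus[OF int(1)] _ _ a(3) w(1)]) measurable
  have "(LBINT x. a (fst x) * (\<theta> (x - (h, 0)) \<bullet> w1 (snd x)))
     = (LBINT x. a (fst (x + (h, 0))) * (\<theta> ((x + (h, 0)) - (h, 0)) \<bullet> w1 (snd (x + (h, 0)))))"
    by (rule integral_lborel_translate[symmetric]) measurable
  then have tr: "(LBINT x. a (fst x) * (\<theta> (x - (h, 0)) \<bullet> w1 (snd x)))
     = (LBINT x. a (fst x + h) * (\<theta> x \<bullet> w1 (snd x)))" by simp
  have "(LBINT x. A' (fst x) * (\<theta> x * \<phi> (snd x)))
     = (LBINT x. (a (fst x + h) * (\<theta> x \<bullet> w1 (snd x)) - a (fst x) * (\<theta> x \<bullet> w1 (snd x))) / h)"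
    unfolding et A'_def by (simp add: algebra_simps diff_divide_distrib)
  also have "\<dots> = ((LBINT x. a (fst x) * (\<theta> (x - (h, 0)) \<bullet> w1 (snd x))) - (LBINT x. a (fst x) * (\<theta> x \<bullet> w1 (snd x)))) / h"
    unfolding tr using iah\<theta> ia\<theta> by simp
  finally have L: "(LBINT x. A' (fst x) * (\<theta> x * \<phi> (snd x)))
    = ((LBINT x. a (fst x) * (\<theta> (x - (h, 0)) \<bullet> w1 (snd x))) - (LBINT x. a (fst x) * (\<theta> x \<bullet> w1 (snd x)))) / h" .
  have Rr: "(LBINT x. A (fst x) * (\<phi> (snd x) * (u x \<bullet> D x) + f x \<bullet> sgrad \<phi> (snd x)))
    = (LBINT x. A (fst x) * (K x \<bullet> w1 (snd x))) + (LBINT x. A (fst x) * (f x \<bullet> w2 (snd x)))"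
    unfolding eK ef distrib_left by (rule Bochner_Integration.integral_add[OF iAK iAf])
  have "a (fst x) * ((P h x, steklov h f x) \<bullet> (indicator (Om lx ly) (snd x) *\<^sub>R (\<phi> (snd x), sgrad \<phi> (snd x))))
    = (a (fst x) * (\<theta> x \<bullet> w1 (snd x)) - a (fst x) * (\<theta> (x - (h, 0)) \<bullet> w1 (snd x))) / h
      + (steklov h K x \<bullet> (a (fst x) *\<^sub>R w1 (snd x)) + steklov h f x \<bullet> (a (fst x) *\<^sub>R w2 (snd x)))" for x
    by (simp add: P_def w1_def w2_def algebra_simps diff_divide_distrib add_divide_distrib)
  then have "(LBINT x. a (fst x) * ((P h x, steklov h f x) \<bullet> (indicator (Om lx ly) (snd x) *\<^sub>R (\<phi> (snd x), sgrad \<phi> (snd x)))))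
    = (LBINT x. (a (fst x) * (\<theta> x \<bullet> w1 (snd x)) - a (fst x) * (\<theta> (x - (h, 0)) \<bullet> w1 (snd x))) / h
      + (steklov h K x \<bullet> (a (fst x) *\<^sub>R w1 (snd x)) + steklov h f x \<bullet> (a (fst x) *\<^sub>R w2 (snd x))))"
    by simp
  also have "\<dots> = ((LBINT x. a (fst x) * (\<theta> x \<bullet> w1 (snd x))) - (LBINT x. a (fst x) * (\<theta> (x - (h, 0)) \<bullet> w1 (snd x)))) / h
      + ((LBINT x. steklov h K x \<bullet> (a (fst x) *\<^sub>R w1 (snd x))) + (LBINT x. steklov h f x \<bullet> (a (fst x) *\<^sub>R w2 (snd x))))"
    using ia\<theta> ia\<theta>h T1(2) T2(2) by simp
  also have "\<dots> = 0" using W[unfolded L Rr] T1(1) T2(1) by (simp add: diff_divide_distrib)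
  finally show ?thesis .
qed

text \<open>The order of quantifiers is the point: one null set of times serves all
  \<open>\<phi>\<close>, so at a fixed time \<open>\<phi>\<close> may run through a sequence that
  approximates that slice of \<open>\<theta>\<close>.\<close>

lemma AE_weak:
  assumes h: "0 < h" "h < c" and d: "d < R"
  shows "AE t in lborel. c < t \<and> t < d \<longrightarrow> (\<forall>\<phi>. test0 lx ly \<phi> \<longrightarrow>
    (\<integral>p. P h (t, p) * \<phi> p + steklov h f (t, p) \<bullet> sgrad \<phi> p \<partial>MO lx ly) = 0)"
proof -
  define W where "W = {w. \<exists>\<phi>. test0 lx ly \<phi> \<and> w = (\<lambda>p. indicator (Om lx ly) p *\<^sub>R (\<phi> p, sgrad \<phi> p))}"
  have i: "integrable lborel (\<lambda>x. (P h x, steklov h f x))"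
  proof (rule Bochner_Integration.integrable_bound[OF Bochner_Integration.integrable_add
      [OF integrable_norm[OF P_integrable] integrable_norm[OF steklov_integrable[OF int(4)]], of h h]])
    show "AE x in lborel. norm (P h x, steklov h f x) \<le> norm (norm (P h x) + norm (steklov h f x))"
      using sqrt_sum_squares_le_sum_abs[of "P h _" "norm (steklov h f _)"] by (auto simp: norm_Pair)
  qed measurable
  have "AE t in lborel. c < t \<and> t < d \<longrightarrow> (\<forall>w\<in>W. (LBINT p. (P h (t, p), steklov h f (t, p)) \<bullet> w p) = 0)"
  proof (rule AE_slices_orthogonal[OF i])
    fix w assume "w \<in> W"
    then obtain \<phi> where \<phi>: "test0 lx ly \<phi>" and w: "w = (\<lambda>p. indicator (Om lx ly) p *\<^sub>R (\<phi> p, sgrad \<phi> p))"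
      by (auto simp: W_def)
    note [measurable] = test0_cont(3,4)[OF \<phi>]
    show "w \<in> borel_measurable borel" unfolding w by measurable
    obtain M where M: "\<And>p. p \<in> Om lx ly \<Longrightarrow> \<bar>\<phi> p\<bar> \<le> M" "\<And>p. p \<in> Om lx ly \<Longrightarrow> norm (sgrad \<phi> p) \<le> M" "M \<ge> 0"
      using test0_bounded[OF \<phi>] by blast
    have "norm (w p) \<le> 2 * M" for p
    proof (cases "p \<in> Om lx ly")
      case True
      have "norm (\<phi> p, sgrad \<phi> p) \<le> norm (\<phi> p) + norm (sgrad \<phi> p)"
        using sqrt_sum_squares_le_sum_abs[of "norm (\<phi> p)" "norm (sgrad \<phi> p)"] by (simp add: norm_Pair)
      then show ?thesis using True M(1,2)[OF True] by (simp add: w)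
    qed (use M in \<open>simp add: w\<close>)
    then show "\<exists>M. \<forall>p. norm (w p) \<le> M" by blast
    fix a assume "continuous_on UNIV a" "\<And>t. t \<notin> {c..d} \<Longrightarrow> a t = 0" "\<And>t::real. \<bar>a t\<bar> \<le> (1::real)"
    then show "(LBINT x. a (fst x) * ((P h x, steklov h f x) \<bullet> w (snd x))) = 0"
      unfolding w by (rule orthogonal_average[OF h d \<phi>])
  qed
  then show ?thesis
  proof eventually_elim
    case (elim t)
    show ?case
    proof (intro impI allI)
      fix \<phi> assume t: "c < t \<and> t < d" and \<phi>: "test0 lx ly \<phi>"
      note [measurable] = test0_cont(3,4)[OF \<phi>]
      have m: "(\<lambda>p. indicator (Om lx ly) p *\<^sub>R (\<phi> p, sgrad \<phi> p)) \<in> W" using \<phi> by (auto simp: W_def)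
      from bspec[OF mp[OF elim t] m] have "(LBINT p. (P h (t, p), steklov h f (t, p)) \<bullet> (indicator (Om lx ly) p *\<^sub>R (\<phi> p, sgrad \<phi> p))) = 0" .
      moreover have "(\<integral>p. P h (t, p) * \<phi> p + steklov h f (t, p) \<bullet> sgrad \<phi> p \<partial>MO lx ly)
        = (LBINT p. indicator (Om lx ly) p *\<^sub>R (P h (t, p) * \<phi> p + steklov h f (t, p) \<bullet> sgrad \<phi> p))"
        by (rule lebesgue_on_borel(2)) measurable
      moreover have "indicator (Om lx ly) p *\<^sub>R (P h (t, p) * \<phi> p + steklov h f (t, p) \<bullet> sgrad \<phi> p)
         = (P h (t, p), steklov h f (t, p)) \<bullet> (indicator (Om lx ly) p *\<^sub>R (\<phi> p, sgrad \<phi> p))" for p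
        by (simp add: algebra_simps)
      ultimately show "(\<integral>p. P h (t, p) * \<phi> p + steklov h f (t, p) \<bullet> sgrad \<phi> p \<partial>MO lx ly) = 0" by simp
    qed
  qed
qed

lemma AE_interval_slice:
  assumes "0 < c" "d < R"
  shows "AE t in lborel. c < t \<and> t < d \<longrightarrow> H10_limit lx ly (\<lambda>p. \<theta> (t, p)) (\<lambda>p. D (t, p))"
  using slice by eventually_elim (use assms in auto)

text \<open>After division by \<open>h\<close>, the energy in the layer before \<open>c\<close>
  takes over the role of the initial energy. The bound of \<beta> by half the square makes the
  constant the same for every renormalization.\<close>

lemma slab_bound:
  assumes h: "0 < h" "h < c" and c: "c < R" and bt: "\<And>x. 0 \<le> \<beta> x \<and> \<beta> x \<le> x^2 / 2" and [measurable]: "\<beta> \<in> borel_measurable borel"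
  shows "(LBINT x. indicator {c - h<..c} (fst x) * \<beta> (\<theta> x)) \<le> h * C / 2"
    "integrable lborel (\<lambda>x. \<beta> (\<theta> x))"
proof -
  have i2: "integrable lborel (\<lambda>x. indicator {c - h<..c} (fst x) * (\<theta> x)^2)"
    by (rule Bochner_Integration.integrable_bound[OF int(2)]) (auto simp: indicator_def)
  show i\<beta>: "integrable lborel (\<lambda>x. \<beta> (\<theta> x))"
  proof (rule Bochner_Integration.integrable_bound[OF int(2)])
    have "\<bar>\<beta> y\<bar> \<le> y^2" for y using bt[of y] zero_le_power2[of y] by linarith
    then show "AE x in lborel. norm (\<beta> (\<theta> x)) \<le> norm ((\<theta> x)^2)" by simp
  qed measurable
  have "(LBINT x. indicator {c - h<..c} (fst x) * \<beta> (\<theta> x)) \<le> (LBINT x. (indicator {c - h<..c} (fst x) * (\<theta> x)^2) / 2)"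
  proof (rule integral_mono)
    show "integrable lborel (\<lambda>x. indicator {c - h<..c} (fst x) * \<beta> (\<theta> x))"
      by (rule Bochner_Integration.integrable_bound[OF i\<beta>]) (auto simp: indicator_def)
    show "integrable lborel (\<lambda>x. (indicator {c - h<..c} (fst x) * (\<theta> x)^2) / 2)" using i2 by simp
    show "indicator {c - h<..c} (fst x) * \<beta> (\<theta> x) \<le> (indicator {c - h<..c} (fst x) * (\<theta> x)^2) / 2" for x
      using bt[of "\<theta> x"] by (auto simp: indicator_def)
  qed
  also have "\<dots> = (LBINT x. indicator {c - h<..c} (fst x) * (\<theta> x)^2) / 2" by simp
  also have "(LBINT x. indicator {c - h<..c} (fst x) * (\<theta> x)^2) = (LBINT t. indicator {c - h<..c} t * (LBINT p. (\<theta> (t, p))^2))"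
    using lborel_Fubini(2)[OF i2] by simp
  also have "\<dots> \<le> (LBINT t. indicator {c - h<..c} t * C)"
  proof (rule integral_mono_AE)
    show "integrable lborel (\<lambda>t. indicator {c - h<..c} t * (LBINT p. (\<theta> (t, p))^2))"
      using lborel_Fubini(1)[OF i2] by simp
    show "AE t in lborel. indicator {c - h<..c} t * (LBINT p. (\<theta> (t, p))^2) \<le> indicator {c - h<..c} t * C"
      using bound by eventually_elim (use h c in \<open>auto simp: indicator_def\<close>)
  qed (use h in simp)
  also have "\<dots> = h * C" using h by simp
  finally show "(LBINT x. indicator {c - h<..c} (fst x) * \<beta> (\<theta> x)) \<le> h * C / 2" by simp
qed

section \<open>Testing with the derivative of a convex function of linear growth\<close>

context
  fixes \<beta> \<gamma> \<gamma>' :: "real \<Rightarrow> real" and B :: real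
  assumes d\<beta>: "\<And>x. (\<beta> has_real_derivative \<gamma> x) (at x)" and d\<gamma>: "\<And>x. (\<gamma> has_real_derivative \<gamma>' x) (at x)"
    and c\<gamma>': "continuous_on UNIV \<gamma>'" and B: "\<And>x. \<bar>\<gamma> x\<bar> \<le> B" and \<gamma>'1: "\<And>x. \<bar>\<gamma>' x\<bar> \<le> 1"
    and z: "\<beta> 0 = 0" "\<gamma> 0 = 0" and convex: "\<And>x y. \<beta> y - \<beta> x \<le> \<gamma> y * (y - x)"
    and \<beta>2: "\<And>x. 0 \<le> \<beta> x \<and> \<beta> x \<le> x^2 / 2"
begin

lemma renorm_measurable [measurable]: "\<beta> \<in> borel_measurable borel" "\<gamma> \<in> borel_measurable borel" "\<gamma>' \<in> borel_measurable borel"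
  using c\<gamma>' by (auto intro!: borel_measurable_continuous_onI continuous_at_imp_continuous_on DERIV_isCont[OF d\<beta>] DERIV_isCont[OF d\<gamma>])

text \<open>These are the pairings that renormalization makes possible: the bound on
  \<open>\<gamma>\<close> admits a merely integrable partner, and the bound on
  \<open>\<gamma>'\<close> keeps the gradient of \<open>\<gamma> (\<theta> x)\<close> square
  integrable.\<close>

lemma renorm_integrable:
  assumes [measurable]: "W \<in> borel_measurable borel" and W: "\<And>t. \<bar>W t\<bar> \<le> (1::real)"
  shows "integrable lborel F \<Longrightarrow> integrable lborel (\<lambda>x. W (fst x) * (F x * \<gamma> (\<theta> x)))"
    "G \<in> borel_measurable borel \<Longrightarrow> integrable lborel (\<lambda>x. (norm (G x :: pt))^2) \<Longrightarrow> integrable lborel (\<lambda>x. W (fst x) * (\<gamma>' (\<theta> x) * (G x \<bullet> D x)))"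
    "integrable lborel (\<lambda>x. (norm ((W (fst x) * \<gamma>' (\<theta> x)) *\<^sub>R D x))^2)"
proof -
  have B0: "0 \<le> B" using B[of 0] by linarith
  show "integrable lborel (\<lambda>x. W (fst x) * (F x * \<gamma> (\<theta> x)))" if F: "integrable lborel F" for F
  proof (rule Bochner_Integration.integrable_bound[OF integrable_mult_right[OF integrable_norm[OF F], of B]])
    have [measurable]: "F \<in> borel_measurable borel" using borel_measurable_integrable[OF F] by simp
    show "(\<lambda>x. W (fst x) * (F x * \<gamma> (\<theta> x))) \<in> borel_measurable lborel" by measurable
    have "\<bar>W t * (a * \<gamma> y)\<bar> \<le> 1 * (\<bar>a\<bar> * B)" for t a y
      unfolding abs_mult using B0 by (intro mult_mono W B order_refl) auto
    then show "AE x in lborel. norm (W (fst x) * (F x * \<gamma> (\<theta> x))) \<le> norm (B * norm (F x))"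
      using B0 by (intro AE_I2) (simp add: abs_mult mult.commute)
  qed
  have w: "\<bar>W t * \<gamma>' y\<bar> \<le> 1" for t y
    unfolding abs_mult using mult_mono[OF W[of t] \<gamma>'1[of y]] by simp
  show "integrable lborel (\<lambda>x. W (fst x) * (\<gamma>' (\<theta> x) * (G x \<bullet> D x)))"
    if [measurable]: "G \<in> borel_measurable borel" and G: "integrable lborel (\<lambda>x. (norm (G x :: pt))^2)" for G
  proof (rule Bochner_Integration.integrable_bound[OF integrable_inner_L2(2)[OF _ _ G int(3)]])
    have "\<bar>W t * (\<gamma>' y * a)\<bar> \<le> \<bar>a\<bar>" for t y a
      using mult_right_mono[OF w[of t y], of "\<bar>a\<bar>"] by (simp add: abs_mult mult.assoc)
    then show "AE x in lborel. norm (W (fst x) * (\<gamma>' (\<theta> x) * (G x \<bullet> D x))) \<le> norm (G x \<bullet> D x)" by simp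
  qed measurable
  show "integrable lborel (\<lambda>x. (norm ((W (fst x) * \<gamma>' (\<theta> x)) *\<^sub>R D x))^2)"
  proof (rule Bochner_Integration.integrable_bound[OF int(3)])
    have "norm ((W t * \<gamma>' y) *\<^sub>R v) \<le> norm v" for t y and v :: pt
      using mult_right_mono[OF w[of t y], of "norm v"] by simp
    then show "AE x in lborel. norm ((norm ((W (fst x) * \<gamma>' (\<theta> x)) *\<^sub>R D x))^2) \<le> norm ((norm (D x))^2)"
      by (intro AE_I2) (simp del: norm_scaleR add: power_mono)
  qed measurable
qed

text \<open>Convexity of \<open>\<beta>\<close> bounds the tested time difference from below, with the correct sign.\<close>
lemma averaged_inequality:
  assumes h: "0 < h" "h < c" and d: "c < d" "d < R"
  shows "(LBINT x. indicator {c<..<d} (fst x) * (steklov h K x * \<gamma> (\<theta> x)))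
     + (LBINT x. indicator {c<..<d} (fst x) * (\<gamma>' (\<theta> x) * (steklov h f x \<bullet> D x))) \<le> C / 2"
proof -
  let ?W = "indicator {c<..<d} :: real \<Rightarrow> real"
  have W1: "\<bar>?W t\<bar> \<le> 1" for t by (auto simp: indicator_def)
  have Sf2: "integrable lborel (\<lambda>x. (norm (steklov h f x))^2)" by (rule steklov_sq_le[OF int(4,5)])
  note IP = renorm_integrable(1)[where W="indicator {c<..<d}", OF _ W1 P_integrable[of h]]
  note IK = renorm_integrable(1)[where W="indicator {c<..<d}", OF _ W1 steklov_integrable[OF K_integrable, of h]]
  note If = renorm_integrable(2)[where W="indicator {c<..<d}", OF _ W1 _ Sf2]
  \<comment> \<open>The averaged equation is tested with \<open>\<gamma> (\<theta> (t, p))\<close>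
    on almost every slice, which \<open>AE_weak\<close> permits because its null set does not depend
    on the test function. The majorant for the source comes from the bound \<open>B\<close> on
    \<open>\<gamma>\<close>.\<close>
  have slices: "AE t in lborel. (LBINT p. ?W t * (P h (t, p) * \<gamma> (\<theta> (t, p))))
     + (LBINT p. ?W t * (\<gamma>' (\<theta> (t, p)) * (steklov h f (t, p) \<bullet> D (t, p)))) = 0"
    using AE_weak[OF h d(2)] AE_interval_slice[OF order_less_trans[OF h] d(2)]
      lborel_Fubini(3)[OF P_integrable[of h]] lborel_Fubini(3)[OF Sf2]
  proof eventually_elim
    case (elim t)
    show ?case
    proof (cases "c < t \<and> t < d")
      case True
      have "(\<integral>p. P h (t, p) * \<gamma> (\<theta> (t, p)) \<partial>MO lx ly) + (\<integral>p. \<gamma>' (\<theta> (t, p)) * (steklov h f (t, p) \<bullet> D (t, p)) \<partial>MO lx ly) = 0"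
      proof (rule weak_test_compose[OF mp[OF elim(2) True] _ _ _ _ d\<gamma> c\<gamma>' z(2) \<gamma>'1, where N="\<lambda>p. \<bar>P h (t, p)\<bar> * B"])
        show "(\<lambda>p. P h (t, p)) \<in> borel_measurable (MO lx ly)" "(\<lambda>p. steklov h f (t, p)) \<in> borel_measurable (MO lx ly)"
          by (rule borel_measurable_lebesgue_on, measurable)+
        show "integrable (MO lx ly) (\<lambda>p. P h (t, p))" "integrable (MO lx ly) (\<lambda>p. (norm (steklov h f (t, p)))^2)"
          "integrable (MO lx ly) (\<lambda>p. \<bar>P h (t, p)\<bar> * B)"
          using elim(3,4) by (auto intro: integrable_MO_I)
        show "\<bar>P h (t, p) * \<gamma> x\<bar> \<le> \<bar>P h (t, p)\<bar> * B" for p x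
          unfolding abs_mult using B by (intro mult_left_mono) auto
        show "(\<integral>p. P h (t, p) * \<phi> p + steklov h f (t, p) \<bullet> sgrad \<phi> p \<partial>MO lx ly) = 0" if "test0 lx ly \<phi>" for \<phi>
          using elim(1) True that by blast
      qed
      moreover have "(\<integral>p. P h (t, p) * \<gamma> (\<theta> (t, p)) \<partial>MO lx ly) = (LBINT p. P h (t, p) * \<gamma> (\<theta> (t, p)))"
        by (rule integral_MO_eq) (use supp(1) z(2) in auto)
      moreover have "(\<integral>p. \<gamma>' (\<theta> (t, p)) * (steklov h f (t, p) \<bullet> D (t, p)) \<partial>MO lx ly) = (LBINT p. \<gamma>' (\<theta> (t, p)) * (steklov h f (t, p) \<bullet> D (t, p)))"
        by (rule integral_MO_eq) (use supp(2) in auto)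
      ultimately show ?thesis using True by simp
    qed simp
  qed
  have "(LBINT x. ?W (fst x) * (P h x * \<gamma> (\<theta> x))) + (LBINT x. ?W (fst x) * (\<gamma>' (\<theta> x) * (steklov h f x \<bullet> D x)))
     = (LBINT t. (LBINT p. ?W t * (P h (t, p) * \<gamma> (\<theta> (t, p))))
     + (LBINT p. ?W t * (\<gamma>' (\<theta> (t, p)) * (steklov h f (t, p) \<bullet> D (t, p)))))"
    using lborel_Fubini(1,2)[OF IP] lborel_Fubini(1,2)[OF If] by simp
  also have "\<dots> = (\<integral>t. 0 \<partial>(lborel :: real measure))"
    by (rule integral_cong_AE) (use slices in auto)
  finally have zero: "(LBINT x. ?W (fst x) * (P h x * \<gamma> (\<theta> x)))
     + (LBINT x. ?W (fst x) * (\<gamma>' (\<theta> x) * (steklov h f x \<bullet> D x))) = 0" by simp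
  note i\<beta> = slab_bound(2)[OF h order_less_trans[OF d] \<beta>2 renorm_measurable(1)]
  have i\<beta>t: "integrable lborel (\<lambda>x. \<beta> (\<theta> (x - (h, 0))))" by (rule translate_minus[OF i\<beta>])
  have Wi: "integrable lborel (\<lambda>x. w (fst x) * F x)"
    if "integrable lborel F" "w \<in> borel_measurable borel" "\<And>t. \<bar>w t\<bar> \<le> 1" for w :: "real \<Rightarrow> real" and F :: "real \<times> pt \<Rightarrow> real"
    by (rule Bochner_Integration.integrable_bound[OF that(1)])
       (use that borel_measurable_integrable[OF that(1)] in \<open>auto simp: abs_mult mult_left_le_one_le\<close>)
  have Wh1: "\<bar>?W (t + h)\<bar> \<le> 1" for t by (auto simp: indicator_def)
  \<comment> \<open>A shift in time moves the delay from \<open>\<theta>\<close> to the time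
    interval, so that the two integrals of \<beta> nearly cancel.\<close>
  have tr: "(LBINT x. ?W (fst x) * \<beta> (\<theta> (x - (h, 0)))) = (LBINT x. ?W (fst x + h) * \<beta> (\<theta> x))"
    using integral_lborel_translate[of "\<lambda>x. ?W (fst x) * \<beta> (\<theta> (x - (h, 0)))" "(h, 0)"] by simp
  \<comment> \<open>The averaged transport cancels in this difference, leaving minus the difference
    quotient of \<open>\<theta>\<close> times \<open>\<gamma> (\<theta> x)\<close>, to which
    convexity applies pointwise.\<close>
  have "(LBINT x. ?W (fst x) * (steklov h K x * \<gamma> (\<theta> x))) - (LBINT x. ?W (fst x) * (P h x * \<gamma> (\<theta> x)))
    = (LBINT x. ?W (fst x) * (steklov h K x * \<gamma> (\<theta> x)) - ?W (fst x) * (P h x * \<gamma> (\<theta> x)))"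
    using IK IP by simp
  also have "\<dots> \<le> (LBINT x. (?W (fst x) * \<beta> (\<theta> (x - (h, 0))) - ?W (fst x) * \<beta> (\<theta> x)) / h)"
  proof (rule integral_mono)
    show "integrable lborel (\<lambda>x. ?W (fst x) * (steklov h K x * \<gamma> (\<theta> x)) - ?W (fst x) * (P h x * \<gamma> (\<theta> x)))"
      using IK IP by simp
    show "integrable lborel (\<lambda>x. (?W (fst x) * \<beta> (\<theta> (x - (h, 0))) - ?W (fst x) * \<beta> (\<theta> x)) / h)"
      using Wi[where w="?W", OF i\<beta> _ W1] Wi[where w="?W", OF i\<beta>t _ W1] by simp
    fix x
    have "?W (fst x) * (steklov h K x * \<gamma> (\<theta> x)) - ?W (fst x) * (P h x * \<gamma> (\<theta> x))
      = ?W (fst x) * (- (\<gamma> (\<theta> x) * (\<theta> x - \<theta> (x - (h, 0))) / h))"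
      by (simp add: P_def algebra_simps diff_divide_distrib)
    also have "\<dots> \<le> ?W (fst x) * ((\<beta> (\<theta> (x - (h, 0))) - \<beta> (\<theta> x)) / h)"
    proof (rule mult_left_mono)
      have "(\<beta> (\<theta> x) - \<beta> (\<theta> (x - (h, 0)))) / h \<le> \<gamma> (\<theta> x) * (\<theta> x - \<theta> (x - (h, 0))) / h"
        using convex h by (intro divide_right_mono) auto
      then show "- (\<gamma> (\<theta> x) * (\<theta> x - \<theta> (x - (h, 0))) / h) \<le> (\<beta> (\<theta> (x - (h, 0))) - \<beta> (\<theta> x)) / h"
        by (simp add: diff_divide_distrib)
    qed simp
    finally show "?W (fst x) * (steklov h K x * \<gamma> (\<theta> x)) - ?W (fst x) * (P h x * \<gamma> (\<theta> x))
       \<le> (?W (fst x) * \<beta> (\<theta> (x - (h, 0))) - ?W (fst x) * \<beta> (\<theta> x)) / h" by (simp add: right_diff_distrib)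
  qed
  also have "\<dots> = (LBINT x. ?W (fst x + h) * \<beta> (\<theta> x) - ?W (fst x) * \<beta> (\<theta> x)) / h"
    using Wi[where w="?W", OF i\<beta> _ W1] Wi[where w="?W", OF i\<beta>t _ W1] Wi[where w="\<lambda>t. ?W (t + h)", OF i\<beta> _ Wh1] by (simp add: tr)
  \<comment> \<open>The shifted indicator minus the original one is positive at most on the layer of
    width \<open>h\<close> before \<open>c\<close>. Its negative part, near \<open>d\<close>, is
    dropped because \<beta> is nonnegative.\<close>
  also have "\<dots> \<le> (LBINT x. indicator {c - h<..c} (fst x) * \<beta> (\<theta> x)) / h"
  proof (intro divide_right_mono integral_mono)
    show "integrable lborel (\<lambda>x. ?W (fst x + h) * \<beta> (\<theta> x) - ?W (fst x) * \<beta> (\<theta> x))"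
      using Wi[where w="?W", OF i\<beta> _ W1] Wi[where w="\<lambda>t. ?W (t + h)", OF i\<beta> _ Wh1] by simp
    show "integrable lborel (\<lambda>x. indicator {c - h<..c} (fst x) * \<beta> (\<theta> x))"
      by (rule Wi[OF i\<beta>]) (auto simp: indicator_def)
    show "?W (fst x + h) * \<beta> (\<theta> x) - ?W (fst x) * \<beta> (\<theta> x) \<le> indicator {c - h<..c} (fst x) * \<beta> (\<theta> x)" for x
      using \<beta>2[of "\<theta> x"] h by (auto simp: indicator_def)
  qed (use h in auto)
  also have "\<dots> \<le> (h * C / 2) / h"
    using slab_bound(1)[OF h order_less_trans[OF d] \<beta>2 renorm_measurable(1)] h by (intro divide_right_mono) auto
  also have "\<dots> = C / 2" using h by simp
  finally show ?thesis using zero by linarith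
qed

text \<open>Let \<open>h\<close> tend to zero in the averaged inequality. The transport term tends
  to the integral of \<open>\<gamma> (\<theta> x)\<close> times \<open>u x \<bullet> D x\<close>,
  formally u times the gradient of \<beta>(\<theta>), and this vanishes on almost every slice
  because \<open>u\<close> is divergence free.\<close>

lemma renormalized_energy:
  assumes c: "0 < c" "c < d" "d < R"
  shows "(LBINT x. indicator {c<..<d} (fst x) * (\<gamma>' (\<theta> x) * (f x \<bullet> D x))) \<le> C / 2"
proof -
  let ?W = "indicator {c<..<d} :: real \<Rightarrow> real"
  have W1: "\<bar>?W t\<bar> \<le> 1" for t by (auto simp: indicator_def)
  define b1 where "b1 x = ?W (fst x) * \<gamma> (\<theta> x)" for x
  define b2 where "b2 x = (?W (fst x) * \<gamma>' (\<theta> x)) *\<^sub>R D x" for x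
  have [measurable]: "b1 \<in> borel_measurable borel" "b2 \<in> borel_measurable borel" unfolding b1_def b2_def by measurable
  \<comment> \<open>The factor \<open>c / 2\<close> ensures \<open>h n < c\<close> for every
    \<open>n\<close>, including 0.\<close>
  define h where "h n = c / 2 * inverse (real (Suc n))" for n
  have "h \<longlonglongrightarrow> c / 2 * 0" unfolding h_def by (intro tendsto_mult_left LIMSEQ_inverse_real_of_nat)
  then have h0: "h \<longlonglongrightarrow> 0" by simp
  have h1: "0 < h n" "h n < c" for n
  proof -
    have "c / 2 * inverse (real (Suc n)) \<le> c / 2 * 1" using c by (intro mult_left_mono) (auto simp: field_simps)
    then show "0 < h n" "h n < c" using c by (auto simp: h_def)
  qed
  have B0: "0 \<le> B" using B[of 0] by linarith
  have "(\<lambda>n. LBINT x. steklov (h n) K x \<bullet> b1 x) \<longlonglongrightarrow> (LBINT x. K x \<bullet> b1 x)"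
    by (rule steklov_limit_bounded[OF K_integrable _ _ h0, of _ B]) (use B B0 in \<open>auto simp: b1_def indicator_def\<close>)
  moreover have "(\<lambda>n. LBINT x. steklov (h n) f x \<bullet> b2 x) \<longlonglongrightarrow> (LBINT x. f x \<bullet> b2 x)"
    by (rule steklov_limit_L2[OF int(4,5) _ _ h0]) (use renorm_integrable(3)[where W="indicator {c<..<d}", OF _ W1] in \<open>auto simp: b2_def simp del: norm_scaleR\<close>)
  ultimately have "(\<lambda>n. (LBINT x. steklov (h n) K x \<bullet> b1 x) + (LBINT x. steklov (h n) f x \<bullet> b2 x))
     \<longlonglongrightarrow> (LBINT x. K x \<bullet> b1 x) + (LBINT x. f x \<bullet> b2 x)"
    by (rule tendsto_add)
  moreover have "(LBINT x. steklov (h n) K x \<bullet> b1 x) + (LBINT x. steklov (h n) f x \<bullet> b2 x) \<le> C / 2" for n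
    using averaged_inequality[OF h1 c(2,3), of n] by (simp add: b1_def b2_def mult_ac)
  ultimately have lim: "(LBINT x. K x \<bullet> b1 x) + (LBINT x. f x \<bullet> b2 x) \<le> C / 2"
    by (intro LIMSEQ_le_const2) auto
  have slices: "AE t in lborel. (LBINT p. ?W t * (K (t, p) * \<gamma> (\<theta> (t, p)))) = 0"
    using div AE_interval_slice[OF c(1,3)] lborel_Fubini(3)[OF int(6)]
  proof eventually_elim
    case (elim t)
    show ?case
    proof (cases "c < t \<and> t < d")
      case True
      then have tR: "t \<in> {0..R}" using c by auto
      \<comment> \<open>The composition lemma with zero source and \<beta> in the role of
        \<open>g\<close>: although \<beta> is unbounded, the majorant \<open>N\<close> can be zero,
        and the derivative \<open>\<gamma>\<close> is bounded as required.\<close>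
      have "(\<integral>p. 0 * \<beta> (\<theta> (t, p)) \<partial>MO lx ly) + (\<integral>p. \<gamma> (\<theta> (t, p)) * (u (t, p) \<bullet> D (t, p)) \<partial>MO lx ly) = 0"
      proof (rule weak_test_compose[OF mp[OF elim(2) True] _ _ _ _ d\<beta> _ z(1) B, where N="\<lambda>_. 0"])
        show "(\<lambda>p. u (t, p)) \<in> borel_measurable (MO lx ly)" by (rule borel_measurable_lebesgue_on, measurable)
        show "integrable (MO lx ly) (\<lambda>p. (norm (u (t, p)))^2)" using elim(3) by (auto intro: integrable_MO_I)
        show "continuous_on UNIV \<gamma>" by (intro continuous_at_imp_continuous_on ballI DERIV_isCont[OF d\<gamma>])
        show "(\<integral>p. 0 * \<phi> p + u (t, p) \<bullet> sgrad \<phi> p \<partial>MO lx ly) = 0" if "test0 lx ly \<phi>" for \<phi>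
          using elim(1) tR that by simp
      qed auto
      moreover have "(\<integral>p. \<gamma> (\<theta> (t, p)) * (u (t, p) \<bullet> D (t, p)) \<partial>MO lx ly) = (LBINT p. \<gamma> (\<theta> (t, p)) * (u (t, p) \<bullet> D (t, p)))"
        by (rule integral_MO_eq) (use supp(2) in auto)
      ultimately show ?thesis using True by (simp add: K_def mult.commute)
    qed simp
  qed
  have "(LBINT x. K x \<bullet> b1 x) = (LBINT x. ?W (fst x) * (K x * \<gamma> (\<theta> x)))" by (simp add: b1_def mult_ac)
  also have "\<dots> = (LBINT t. (LBINT p. ?W t * (K (t, p) * \<gamma> (\<theta> (t, p)))))"
    using lborel_Fubini(2)[OF renorm_integrable(1)[where W="indicator {c<..<d}", OF _ W1 K_integrable]] by simp
  also have "\<dots> = (\<integral>t. 0 \<partial>(lborel :: real measure))"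
    by (rule integral_cong_AE) (use slices in auto)
  finally show ?thesis using lim by (simp add: b2_def mult_ac)
qed

end

end

section \<open>Removing the renormalization\<close>

lemma sqrt_one_add_le: "0 \<le> y \<Longrightarrow> sqrt (1 + y) \<le> 1 + y / 2"
  by (rule real_le_lsqrt) (auto simp: power2_eq_square algebra_simps)

lemma abs_inverse_le_1: "1 \<le> y \<Longrightarrow> \<bar>1 / y\<bar> \<le> (1::real)"
  by simp

text \<open>For the chosen \<beta> the weight in the renormalized inequality is
  \<open>1 / (S n (\<theta> x))^3\<close>, which lies between 0 and 1 and tends to 1. The right side
  \<open>C / 2\<close> is the same for all \<open>n\<close>, so dominated convergence removes the
  weight.\<close>

lemma (in energy_setup) energy_interval:
  assumes c: "0 < c" "c < d" "d < R"
  shows "(LBINT x. indicator {c<..<d} (fst x) * (f x \<bullet> D x)) \<le> C / 2"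
proof -
  define e where "e n = inverse (real (Suc n))" for n
  have e0: "e \<longlonglongrightarrow> 0" unfolding e_def by (rule LIMSEQ_inverse_real_of_nat)
  have epos: "0 < e n" for n by (simp add: e_def)
  define S where "S n x = sqrt (1 + e n * x^2)" for n x
  have S1: "1 \<le> S n x" for n x using epos[of n] by (simp add: S_def)
  have S2: "(S n x)^2 = 1 + e n * x^2" for n x using epos[of n] by (simp add: S_def add_nonneg_nonneg)
  have dS: "(S n has_real_derivative e n * x / S n x) (at x)" for n x
  proof -
    have "0 < 1 + e n * x^2" using epos[of n] by (intro add_pos_nonneg) auto
    then show ?thesis unfolding S_def
      by (auto intro!: derivative_eq_intros simp: field_simps)
  qed
  have ineq: "(LBINT x. indicator {c<..<d} (fst x) * (1 / (S n (\<theta> x))^3 * (f x \<bullet> D x))) \<le> C / 2" for n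
  proof (rule renormalized_energy[OF _ _ _ _ _ _ _ _ _ c, where \<beta>="\<lambda>x. (S n x - 1) / e n" and \<gamma>="\<lambda>x. x / S n x" and B="1 / sqrt (e n)"])
    have S0: "S n x \<noteq> 0" for x using S1[of n x] by linarith
    show "((\<lambda>x. (S n x - 1) / e n) has_real_derivative x / S n x) (at x)" for x
      using epos[of n] by (auto intro!: derivative_eq_intros dS)
    show "((\<lambda>x. x / S n x) has_real_derivative 1 / (S n x)^3) (at x)" for x
    proof -
      have "((\<lambda>x. x / S n x) has_real_derivative (1 * S n x - x * (e n * x / S n x)) / (S n x * S n x)) (at x)"
        by (intro DERIV_divide DERIV_ident dS S0)
      moreover have "(1 * S n x - x * (e n * x / S n x)) / (S n x * S n x) = 1 / (S n x)^3"
      proof -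
        have "1 * S n x - x * (e n * x / S n x) = ((S n x)^2 - e n * x^2) / S n x"
          using S0[of x] by (simp add: field_simps power2_eq_square)
        also have "\<dots> = 1 / S n x" by (simp add: S2)
        finally show ?thesis by (simp add: power3_eq_cube)
      qed
      ultimately show ?thesis by simp
    qed
    have "continuous_on UNIV (S n)" by (intro continuous_at_imp_continuous_on ballI DERIV_isCont[OF dS])
    then show "continuous_on UNIV (\<lambda>x. 1 / (S n x)^3)" by (intro continuous_intros) (use S0 in auto)
    \<comment> \<open>The constant comes from \<open>\<bar>x\<bar> * sqrt (e n) \<le> S n x\<close>.
      It blows up with \<open>n\<close>, which is harmless because \<open>B\<close> does not enter
      the conclusion of \<open>renormalized_energy\<close>.\<close>
    show "\<bar>x / S n x\<bar> \<le> 1 / sqrt (e n)" for x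
    proof -
      have "\<bar>x\<bar> * sqrt (e n) = sqrt (e n * x^2)" by (simp add: real_sqrt_mult mult.commute)
      also have "\<dots> \<le> S n x" unfolding S_def by (intro real_sqrt_le_mono) simp
      finally show ?thesis using S1[of n x] epos[of n] by (simp add: abs_divide field_simps)
    qed
    show "\<bar>1 / (S n x)^3\<bar> \<le> 1" for x
      by (rule abs_inverse_le_1[OF one_le_power[OF S1]])
    show "(S n 0 - 1) / e n = 0" "0 / S n 0 = 0" by (auto simp: S_def)
    show "(S n y - 1) / e n - (S n x - 1) / e n \<le> y / S n y * (y - x)" for x y
    proof -
      \<comment> \<open>Cauchy-Schwarz for the vectors (1, sqrt e * x) and (1, sqrt e * y); the
        difference of the squares is e * (x - y)^2. Dividing by \<open>S n y\<close> afterwards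
        gives the tangent inequality.\<close>
      have "1 + e n * (x * y) \<le> S n x * S n y"
      proof (rule power2_le_imp_le)
        have "0 \<le> e n * (x - y)^2" using epos[of n] by simp
        then show "(1 + e n * (x * y))^2 \<le> (S n x * S n y)^2"
          unfolding power_mult_distrib[of "S n x"] S2 by (simp add: power2_eq_square algebra_simps)
        show "0 \<le> S n x * S n y" using S1[of n x] S1[of n y] by simp
      qed
      then have "S n y * S n y - S n x * S n y \<le> e n * (y * (y - x))"
        using S2[of n y] by (simp add: power2_eq_square algebra_simps)
      then have "(S n y - S n x) * S n y \<le> e n * (y * (y - x))" by (simp add: algebra_simps)
      then have "S n y - S n x \<le> e n * (y * (y - x)) / S n y"
        using S1[of n y] by (subst pos_le_divide_eq) auto
      then have "(S n y - S n x) / e n \<le> e n * (y * (y - x)) / S n y / e n"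
        using epos[of n] by (intro divide_right_mono) auto
      then show ?thesis using epos[of n] by (simp add: diff_divide_distrib)
    qed
    show "0 \<le> (S n x - 1) / e n \<and> (S n x - 1) / e n \<le> x^2 / 2" for x
    proof
      show "0 \<le> (S n x - 1) / e n" using S1[of n x] epos[of n] by simp
      have "S n x \<le> 1 + e n * x^2 / 2" unfolding S_def using epos[of n] by (intro sqrt_one_add_le) simp
      then show "(S n x - 1) / e n \<le> x^2 / 2" using epos[of n] by (simp add: pos_divide_le_eq mult.commute)
    qed
  qed
  have S_lim: "(\<lambda>n. S n x) \<longlonglongrightarrow> 1" for x
  proof -
    have "(\<lambda>n. sqrt (1 + e n * x^2)) \<longlonglongrightarrow> sqrt (1 + 0 * x^2)" by (intro tendsto_intros e0)
    then show ?thesis by (simp add: S_def)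
  qed
  have [measurable]: "S n \<in> borel_measurable borel" for n unfolding S_def by measurable
  have ifD: "integrable lborel (\<lambda>x. f x \<bullet> D x)" by (rule integrable_inner_L2) (use int in auto)
  have "(\<lambda>n. LBINT x. indicator {c<..<d} (fst x) * (1 / (S n (\<theta> x))^3 * (f x \<bullet> D x)))
    \<longlonglongrightarrow> (LBINT x. indicator {c<..<d} (fst x) * (1 / 1^3 * (f x \<bullet> D x)))"
  proof (rule integral_dominated_convergence[OF _ _ integrable_norm[OF ifD]])
    show "AE x in lborel. (\<lambda>n. indicator {c<..<d} (fst x) * (1 / (S n (\<theta> x))^3 * (f x \<bullet> D x)))
        \<longlonglongrightarrow> indicator {c<..<d} (fst x) * (1 / 1^3 * (f x \<bullet> D x))"
      by (intro AE_I2 tendsto_intros S_lim) auto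
    show "AE x in lborel. norm (indicator {c<..<d} (fst x) * (1 / (S n (\<theta> x))^3 * (f x \<bullet> D x))) \<le> norm (f x \<bullet> D x)" for n
    proof (rule AE_I2)
      fix x
      have "1 \<le> (S n (\<theta> x))^3" by (rule one_le_power[OF S1])
      then have "\<bar>1 / (S n (\<theta> x))^3\<bar> \<le> 1" by (rule abs_inverse_le_1)
      then have "\<bar>1 / (S n (\<theta> x))^3\<bar> * \<bar>f x \<bullet> D x\<bar> \<le> 1 * \<bar>f x \<bullet> D x\<bar>" by (rule mult_right_mono) simp
      then show "norm (indicator {c<..<d} (fst x) * (1 / (S n (\<theta> x))^3 * (f x \<bullet> D x))) \<le> norm (f x \<bullet> D x)"
        by (auto simp: indicator_def abs_mult)
    qed
  qed measurable
  then have "(LBINT x. indicator {c<..<d} (fst x) * (1 / 1^3 * (f x \<bullet> D x))) \<le> C / 2"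
    by (rule LIMSEQ_le_const2) (use ineq in auto)
  then show ?thesis by simp
qed

text \<open>The bound \<open>C / 2\<close> depends on neither end of the interval, so the intervals
  may exhaust the time span from 0 to \<open>R\<close>.\<close>

lemma (in energy_setup) energy_total:
  assumes R: "0 < R" and time: "\<And>x. fst x \<notin> {0..R} \<Longrightarrow> f x = 0"
  shows "(LBINT x. f x \<bullet> D x) \<le> C / 2"
proof -
  \<comment> \<open>The factor \<open>R / 3\<close> makes every interval from \<open>c n\<close> to
    \<open>R - c n\<close> nonempty.\<close>
  define c where "c n = R / 3 * inverse (real (Suc n))" for n
  have "c \<longlonglongrightarrow> R / 3 * 0" unfolding c_def by (intro tendsto_mult_left LIMSEQ_inverse_real_of_nat)
  then have c0: "c \<longlonglongrightarrow> 0" by simp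
  have c1: "0 < c n" "c n < R - c n" for n
  proof -
    have "R / 3 * inverse (real (Suc n)) \<le> R / 3 * 1" using R by (intro mult_left_mono) (auto simp: field_simps)
    then show "0 < c n" "c n < R - c n" using R by (auto simp: c_def)
  qed
  have ifD: "integrable lborel (\<lambda>x. f x \<bullet> D x)" by (rule integrable_inner_L2) (use int in auto)
  have "(\<lambda>n. LBINT x. indicator {c n<..<R - c n} (fst x) * (f x \<bullet> D x)) \<longlonglongrightarrow> (LBINT x. f x \<bullet> D x)"
  proof (rule integral_dominated_convergence[OF _ _ integrable_norm[OF ifD]])
    \<comment> \<open>The times 0 and \<open>R\<close> belong to none of the intervals and are set
      aside as null slices; at every other time the integrand is eventually constant in
      \<open>n\<close>.\<close>
    have "AE x in (lborel :: (real \<times> pt) measure). fst x \<noteq> t" for t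
    proof (rule AE_I'[of "{t} \<times> UNIV"])
      have "emeasure (lborel \<Otimes>\<^sub>M lborel) ({t} \<times> (UNIV :: pt set)) = emeasure lborel {t} * emeasure lborel (UNIV :: pt set)"
        by (rule lborel.emeasure_pair_measure_Times) auto
      then show "{t} \<times> (UNIV :: pt set) \<in> null_sets lborel"
        by (auto simp: lborel_prod null_sets_def intro!: borel_closed closed_Times)
    qed auto
    from this[of 0] this[of R]
    show "AE x in lborel. (\<lambda>n. indicator {c n<..<R - c n} (fst x) * (f x \<bullet> D x)) \<longlonglongrightarrow> f x \<bullet> D x"
    proof eventually_elim
      case (elim x)
      show ?case
      proof (cases "0 < fst x \<and> fst x < R")
        case True
        then have "eventually (\<lambda>n. c n < min (fst x) (R - fst x)) sequentially"
          using order_tendstoD(2)[OF c0, of "min (fst x) (R - fst x)"] by auto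
        then have "eventually (\<lambda>n. indicator {c n<..<R - c n} (fst x) * (f x \<bullet> D x) = f x \<bullet> D x) sequentially"
          by eventually_elim (auto simp: indicator_def)
        then show ?thesis by (rule tendsto_eventually)
      next
        case False
        then have "f x = 0" using elim time[of x] by auto
        then show ?thesis by simp
      qed
    qed
  qed (auto simp: indicator_def)
  then show ?thesis
    by (rule LIMSEQ_le_const2) (use energy_interval[OF c1(1) c1(2)] c1(1) in auto)
qed

section \<open>Fields cut to a finite time span, and test functions separated in time and
  space\<close>

lemma H10_limit_cong:
  assumes "H10_limit lx ly f G" and eq: "\<And>p. p \<in> Om lx ly \<Longrightarrow> f p = f' p" "\<And>p. p \<in> Om lx ly \<Longrightarrow> G p = G' p"
  shows "H10_limit lx ly f' G'"
proof -
  let ?M = "MO lx ly"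
  have "f' \<in> borel_measurable ?M \<longleftrightarrow> f \<in> borel_measurable ?M" "G' \<in> borel_measurable ?M \<longleftrightarrow> G \<in> borel_measurable ?M"
    by (rule measurable_cong; use eq in simp)+
  moreover have "integrable ?M (\<lambda>p. (f' p)^2) \<longleftrightarrow> integrable ?M (\<lambda>p. (f p)^2)"
    "integrable ?M (\<lambda>p. (norm (G' p))^2) \<longleftrightarrow> integrable ?M (\<lambda>p. (norm (G p))^2)"
    by (rule Bochner_Integration.integrable_cong; use eq in simp)+
  moreover have "(\<integral>p. (f' p - \<zeta> p)^2 + (norm (G' p - sgrad \<zeta> p))^2 \<partial>?M) = (\<integral>p. (f p - \<zeta> p)^2 + (norm (G p - sgrad \<zeta> p))^2 \<partial>?M)" for \<zeta>
    by (rule Bochner_Integration.integral_cong) (use eq in simp_all)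
  ultimately show ?thesis using assms(1) unfolding H10_limit_def by simp
qed

text \<open>The profile \<open>1 - p $ 3\<close> and its gradient are subtracted from both arguments
  and cancel, so the difference vanishes at both plates in the sense of the closure.\<close>

lemma bc10_diff:
  assumes "bc10 lx ly f F" "bc10 lx ly g G"
  shows "H10_limit lx ly (\<lambda>p. f p - g p) (\<lambda>p. F p - G p)"
  using H10_limit_diff[OF H10_imp_limit H10_imp_limit, OF assms[unfolded bc10_def]] by simp

text \<open>One product serves both weak formulations. A positive \<open>c\<close> makes it vanish
  for times up to \<open>c / 2\<close>, as demanded of the tests that define the time derivative of
  eta.\<close>

lemma product_test:
  assumes A: "\<And>t. (A has_real_derivative A' t) (at t)" "continuous_on UNIV A'"
    and supp: "0 < c" "\<And>t. t \<notin> {c..d} \<Longrightarrow> A t = 0" and \<phi>: "test0 lx ly \<phi>"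
  defines "\<Phi> \<equiv> \<lambda>x. A (fst x) * \<phi> (snd x)"
  shows "st_test_pos lx ly \<Phi>" "dtime \<Phi> t p = A' t * \<phi> p" "tgrad \<Phi> t p = A t *\<^sub>R sgrad \<phi> p"
proof -
  note C = test0_C1[OF \<phi>]
  define E where "E x v = A (fst x) * frechet_derivative \<phi> (at (snd x)) (snd v) + (A' (fst x) * fst v) * \<phi> (snd x)" for x v :: "real \<times> pt"
  have D: "(\<Phi> has_derivative E x) (at x)" for x
  proof -
    have 1: "((\<lambda>x. A (fst x)) has_derivative (\<lambda>v. A' (fst x) * fst v)) (at x)"
      by (rule has_derivative_compose[OF has_derivative_fst[OF has_derivative_ident] A(1)[unfolded has_field_derivative_def]])
    have 2: "((\<lambda>x. \<phi> (snd x)) has_derivative (\<lambda>v. frechet_derivative \<phi> (at (snd x)) (snd v))) (at x)"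
      by (rule has_derivative_compose[OF has_derivative_snd[OF has_derivative_ident] C1funD(1)[OF C]])
    show ?thesis unfolding \<Phi>_def E_def using has_derivative_mult[OF 1 2] .
  qed
  have cA: "continuous_on UNIV A" by (intro continuous_at_imp_continuous_on ballI DERIV_isCont[OF A(1)])
  have c: "continuous_on UNIV (\<lambda>x. E x v)" for v
    unfolding E_def
    by (intro continuous_intros continuous_on_compose2[OF cA] continuous_on_compose2[OF A(2)]
        continuous_on_compose2[OF C1funD(3)[OF C]] continuous_on_compose2[OF C1funD(2)[OF C]]) auto
  have C1: "C1fun \<Phi>" by (rule C1funI(1)[OF D c])
  have fd: "frechet_derivative \<Phi> (at x) = E x" for x by (rule C1funI(2)[OF D c])
  show "dtime \<Phi> t p = A' t * \<phi> p"
    using linear_0[OF has_derivative_linear[OF C1funD(1)[OF C]]] by (simp add: dtime_def fd E_def)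
  show "tgrad \<Phi> t p = A t *\<^sub>R sgrad \<phi> p" by (simp add: tgrad_def fd E_def vec_eq_iff sgrad_nth)
  have per: "xy_periodic lx ly (\<lambda>p. \<Phi> (t, p))" for t
    using \<phi> by (simp add: test0_def xy_periodic_def \<Phi>_def)
  obtain \<delta> where \<delta>: "\<delta> > 0" "\<And>p. p $ 3 < \<delta> \<or> 1 - \<delta> < p $ 3 \<Longrightarrow> \<phi> p = 0"
    using \<phi> unfolding test0_def by blast
  have z: "\<exists>\<delta>>0. \<forall>t p. (p $ 3 < \<delta> \<or> 1 - \<delta> < p $ 3) \<longrightarrow> \<Phi> (t, p) = 0"
    using \<delta> by (intro exI[of _ \<delta>]) (auto simp: \<Phi>_def)
  have r: "\<exists>R. \<forall>t p. R \<le> t \<longrightarrow> \<Phi> (t, p) = 0"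
    using supp(2) by (intro exI[of _ "d + 1"]) (auto simp: \<Phi>_def)
  have s: "\<exists>\<delta>>0. \<forall>t p. t \<le> \<delta> \<longrightarrow> \<Phi> (t, p) = 0"
    using supp by (intro exI[of _ "c / 2"]) (auto simp: \<Phi>_def)
  show "st_test_pos lx ly \<Phi>" unfolding st_test_pos_def st_test_def using C1 per z r s by blast
qed

lemma slab_borel [measurable]: "{0..\<tau>::real} \<times> Om lx ly \<in> sets borel" "{0::real..} \<times> Om lx ly \<in> sets borel"
  using compact_imp_closed[OF Om_compact] by (auto intro!: borel_closed closed_Times)

lemma cut_L2:
  fixes F :: "real \<times> pt \<Rightarrow> 'v::euclidean_space"
  assumes [measurable]: "F \<in> borel_measurable borel"
    and fin: "(\<integral>\<^sup>+x. ennreal ((norm (F x))^2) \<partial>lebesgue_on ({0..\<tau>} \<times> Om lx ly)) < \<infinity>"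
  shows "integrable lborel (\<lambda>x. (norm (indicator ({0..\<tau>} \<times> Om lx ly) x *\<^sub>R F x))^2)"
proof (rule integrableI_nonneg)
  have "(\<integral>\<^sup>+x. ennreal ((norm (indicator ({0..\<tau>} \<times> Om lx ly) x *\<^sub>R F x))^2) \<partial>lborel)
    = (\<integral>\<^sup>+x. ennreal ((norm (F x))^2) * indicator ({0..\<tau>} \<times> Om lx ly) x \<partial>lborel)"
    by (intro nn_integral_cong) (auto simp: indicator_def)
  also have "\<dots> = (\<integral>\<^sup>+x. ennreal ((norm (F x))^2) \<partial>lebesgue_on ({0..\<tau>} \<times> Om lx ly))"
    by (rule lebesgue_on_borel(1)[symmetric]) measurable
  finally show "(\<integral>\<^sup>+x. ennreal ((norm (indicator ({0..\<tau>} \<times> Om lx ly) x *\<^sub>R F x))^2) \<partial>lborel) < \<infinity>" using fin by simp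
qed (auto intro!: borel_measurable_scaleR borel_measurable_indicator)

lemma slab_finite: "emeasure lborel ({0..\<tau>::real} \<times> Om lx ly) < \<infinity>"
proof -
  have "compact ({0..\<tau>::real} \<times> Om lx ly)" using Om_compact by (intro compact_Times) auto
  then show ?thesis by (rule emeasure_compact_finite)
qed

section \<open>The energy bound\<close>

lemma deriv_zero_outside:
  assumes A: "(A has_real_derivative a) (at t)" and z: "\<And>t. t \<notin> {c..d} \<Longrightarrow> A t = 0" and t: "t \<notin> {c..d::real}"
  shows "a = 0"
proof -
  have "((\<lambda>_. 0) has_real_derivative a) (at t)"
    by (rule has_field_derivative_transform_within_open[OF A, of "- {c..d}"]) (use t z in auto)
  then show ?thesis using DERIV_unique DERIV_const by blast
qed

lemma bounded_outside_interval:
  fixes A :: "real \<Rightarrow> real"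
  assumes "continuous_on UNIV A" "\<And>t. t \<notin> {c..d} \<Longrightarrow> A t = 0"
  shows "\<exists>m. \<forall>t. \<bar>A t\<bar> \<le> m"
proof -
  have "bounded (A ` {c..d})"
    by (intro compact_imp_bounded compact_continuous_image continuous_on_subset[OF assms(1)]) auto
  then obtain m where "\<forall>t\<in>{c..d}. \<bar>A t\<bar> \<le> m" unfolding bounded_iff by auto
  then have m: "\<bar>A t\<bar> \<le> m" if "t \<in> {c..d}" for t using that by blast
  have "\<bar>A t\<bar> \<le> \<bar>m\<bar>" for t using m[of t] assms(2)[of t] by (cases "t \<in> {c..d}") auto
  then show ?thesis by blast
qed

lemma AE_time: "(AE t in lebesgue_on {0::real..}. Pr t) \<longleftrightarrow> (AE t in lborel. 0 \<le> t \<longrightarrow> Pr t)"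
  by (subst lebesgue_on_borel(4)) auto

text \<open>By the definition of psi, eta satisfies eta_t + div(u eta) = Lap psi; subtracting this
  from the temperature equation leaves the flux grad T - grad psi. The factor \<open>q\<close> turns
  all fields into globally defined integrable functions. The constant is that of (T - eta)^2 \<le> 2
  T^2 + 2 eta^2, with the supremum bound for T on the cell and the uniform L2 bound for eta.\<close>

lemma energy_setup_difference:
  fixes u :: "real \<Rightarrow> pt \<Rightarrow> pt"
  assumes l: "0 < lx" "0 < ly" and R: "0 < R"
    and divu: "divfree lx ly u"
    and fu: "(\<integral>\<^sup>+x. ennreal ((norm (u (fst x) (snd x)))^2) \<partial>lebesgue_on ({0..R} \<times> Om lx ly)) < \<infinity>"
    and T: "weak_sol lx ly u T0 T GTe"
    and CT: "AE x in lebesgue_on ({0..} \<times> Om lx ly). \<bar>T (fst x) (snd x)\<bar> \<le> CT"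
    and eta: "admissible lx ly \<eta> G\<eta> g"
    and CE: "AE t in lebesgue_on {0..}. (\<integral>\<^sup>+p. ennreal ((\<eta> t p)^2) \<partial>MO lx ly) \<le> ennreal CE" "0 \<le> CE"
    and bc: "AE t in lebesgue_on {0..}. bc10 lx ly (\<eta> t) (G\<eta> t)"
    and fE: "(\<integral>\<^sup>+x. ennreal ((norm (G\<eta> (fst x) (snd x)))^2) \<partial>lebesgue_on ({0..R} \<times> Om lx ly)) < \<infinity>"
    and psi: "inv_lap lx ly u \<eta> g \<psi> G\<psi>"
    and fP: "(\<integral>\<^sup>+x. ennreal ((norm (G\<psi> (fst x) (snd x)))^2) \<partial>lebesgue_on ({0..R} \<times> Om lx ly)) < \<infinity>"
  defines "q \<equiv> \<lambda>x. indicator ({0..R} \<times> Om lx ly) x :: real"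
  shows "energy_setup lx ly R (2 * (CT^2 * measure lborel (Om lx ly)) + 2 * CE)
      (\<lambda>x. q x * T (fst x) (snd x) - q x * \<eta> (fst x) (snd x))
      (\<lambda>x. q x *\<^sub>R GTe (fst x) (snd x) - q x *\<^sub>R G\<eta> (fst x) (snd x))
      (\<lambda>x. q x *\<^sub>R GTe (fst x) (snd x) - q x *\<^sub>R G\<psi> (fst x) (snd x))
      (\<lambda>x. q x *\<^sub>R u (fst x) (snd x))"
proof -
  let ?O = "Om lx ly" and ?Q = "{0..R} \<times> Om lx ly"
  have [measurable]: "(\<lambda>x. u (fst x) (snd x)) \<in> borel_measurable borel"
    using divu by (simp add: divfree_def)
  have [measurable]: "(\<lambda>x. T (fst x) (snd x)) \<in> borel_measurable borel" "(\<lambda>x. GTe (fst x) (snd x)) \<in> borel_measurable borel"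
    using T by (simp_all add: weak_sol_def)
  have [measurable]: "(\<lambda>x. \<eta> (fst x) (snd x)) \<in> borel_measurable borel" "(\<lambda>x. G\<eta> (fst x) (snd x)) \<in> borel_measurable borel"
    using eta by (simp_all add: admissible_def)
  have [measurable]: "(\<lambda>x. G\<psi> (fst x) (snd x)) \<in> borel_measurable borel" using psi by (simp add: inv_lap_def)
  have [measurable]: "q \<in> borel_measurable borel" unfolding q_def by measurable
  define XT where "XT x = q x * T (fst x) (snd x)" for x
  define XE where "XE x = q x * \<eta> (fst x) (snd x)" for x
  define VT where "VT x = q x *\<^sub>R GTe (fst x) (snd x)" for x
  define VE where "VE x = q x *\<^sub>R G\<eta> (fst x) (snd x)" for x
  define VP where "VP x = q x *\<^sub>R G\<psi> (fst x) (snd x)" for x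
  define U where "U x = q x *\<^sub>R u (fst x) (snd x)" for x
  have [measurable]: "XT \<in> borel_measurable borel" "XE \<in> borel_measurable borel" "VT \<in> borel_measurable borel"
    "VE \<in> borel_measurable borel" "VP \<in> borel_measurable borel" "U \<in> borel_measurable borel"
    unfolding XT_def XE_def VT_def VE_def VP_def U_def by measurable
  have q1: "q (t, p) = 1" if "t \<in> {0..R}" "p \<in> ?O" for t p using that by (simp add: q_def)
  have q0: "q x = 0" if "x \<notin> ?Q" for x using that by (simp add: q_def)
  have z: "XT x = 0" "XE x = 0" "VT x = 0" "VE x = 0" "VP x = 0" "U x = 0" if "x \<notin> ?Q" for x
    using q0[OF that] by (auto simp: XT_def XE_def VT_def VE_def VP_def U_def)
  have fT: "(\<integral>\<^sup>+x. ennreal ((norm (GTe (fst x) (snd x)))^2) \<partial>lebesgue_on ({0..R} \<times> Om lx ly)) < \<infinity>"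
    using T by (simp add: weak_sol_def)
  have L2: "integrable lborel (\<lambda>x. (norm (VT x))^2)" "integrable lborel (\<lambda>x. (norm (VE x))^2)"
    "integrable lborel (\<lambda>x. (norm (VP x))^2)" "integrable lborel (\<lambda>x. (norm (U x))^2)"
    unfolding VT_def VE_def VP_def U_def q_def by (rule cut_L2; use fT fE fP fu in simp)+
  have sO: "?O \<in> sets borel" by (rule Om_borel)
  \<comment> \<open>The bound holds almost everywhere in space and time. Stated in this form it
    descends to almost every slice through \<open>lborel_AE_slices\<close>.\<close>
  have AT: "AE x in lborel. (XT x)^2 \<le> CT^2 * q x"
  proof -
    have "AE x in lborel. x \<in> {0..} \<times> ?O \<longrightarrow> \<bar>T (fst x) (snd x)\<bar> \<le> CT"
      using CT by (subst (asm) lebesgue_on_borel(4)) auto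
    then show ?thesis
    proof eventually_elim
      case (elim x)
      show ?case
      proof (cases "x \<in> ?Q")
        case True
        then have "\<bar>T (fst x) (snd x)\<bar> \<le> CT" using elim by auto
        then have "\<bar>T (fst x) (snd x)\<bar>^2 \<le> CT^2" by (intro power_mono) auto
        then show ?thesis using True by (simp add: XT_def q_def)
      qed (simp add: XT_def q_def)
    qed
  qed
  have iq: "integrable lborel q" unfolding q_def using slab_finite[of R lx ly] by simp
  have LT: "integrable lborel (\<lambda>x. (XT x)^2)"
    by (rule Bochner_Integration.integrable_bound[OF integrable_mult_right[OF iq, of "CT^2"]])
       (use AT in \<open>auto elim!: eventually_mono simp: q_def\<close>)
  have sE: "AE t in lborel. t \<in> {0..R} \<longrightarrow> (\<integral>\<^sup>+p. ennreal ((XE (t, p))^2) \<partial>lborel) \<le> ennreal CE"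
    using CE(1)[unfolded AE_time]
  proof eventually_elim
    case (elim t)
    show ?case
    proof
      assume t: "t \<in> {0..R}"
      have "(\<integral>\<^sup>+p. ennreal ((XE (t, p))^2) \<partial>lborel) = (\<integral>\<^sup>+p. ennreal ((\<eta> t p)^2) * indicator ?O p \<partial>lborel)"
        using t by (intro nn_integral_cong) (auto simp: XE_def q_def indicator_def)
      also have "\<dots> = (\<integral>\<^sup>+p. ennreal ((\<eta> t p)^2) \<partial>MO lx ly)"
      proof (rule lebesgue_on_borel(1)[OF sO, symmetric])
        have "(\<lambda>p. \<eta> (fst (t, p)) (snd (t, p))) \<in> borel_measurable borel" by measurable
        then show "(\<lambda>p. ennreal ((\<eta> t p)^2)) \<in> borel_measurable borel" by simp
      qed
      finally show "(\<integral>\<^sup>+p. ennreal ((XE (t, p))^2) \<partial>lborel) \<le> ennreal CE" using elim t by simp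
    qed
  qed
  have LE: "integrable lborel (\<lambda>x. (XE x)^2)"
  proof (rule integrableI_nonneg)
    have "(\<integral>\<^sup>+x. ennreal ((XE x)^2) \<partial>lborel) = (\<integral>\<^sup>+t. (\<integral>\<^sup>+p. ennreal ((XE (t, p))^2) \<partial>lborel) \<partial>lborel)"
      by (subst lborel_Tonelli) auto
    also have "\<dots> \<le> (\<integral>\<^sup>+t. ennreal CE * indicator {0..R} t \<partial>lborel)"
    proof (rule nn_integral_mono_AE)
      show "AE t in lborel. (\<integral>\<^sup>+p. ennreal ((XE (t, p))^2) \<partial>lborel) \<le> ennreal CE * indicator {0..R} t"
        using sE
      proof eventually_elim
        case (elim t)
        show ?case using elim z(2)[of "(t, _)"] by (cases "t \<in> {0..R}") auto
      qed
    qed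
    also have "\<dots> = ennreal CE * ennreal R" using R by (simp add: nn_integral_cmult_indicator)
    also have "\<dots> < \<infinity>" by (simp add: ennreal_mult_less_top)
    finally show "(\<integral>\<^sup>+x. ennreal ((XE x)^2) \<partial>lborel) < \<infinity>" .
  qed auto
  define \<theta> where "\<theta> x = XT x - XE x" for x
  define D where "D x = VT x - VE x" for x
  define f where "f x = VT x - VP x" for x
  have [measurable]: "\<theta> \<in> borel_measurable borel" "D \<in> borel_measurable borel" "f \<in> borel_measurable borel"
    unfolding \<theta>_def D_def f_def by measurable
  have z': "\<theta> x = 0" "D x = 0" "f x = 0" if "x \<notin> ?Q" for x using z[OF that] by (auto simp: \<theta>_def D_def f_def)
  have L\<theta>: "integrable lborel (\<lambda>x. (\<theta> x)^2)"
    unfolding \<theta>_def using integrable_L2_diff[of XT lborel XE] LT LE by simp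
  have LD: "integrable lborel (\<lambda>x. (norm (D x))^2)" "integrable lborel (\<lambda>x. (norm (f x))^2)"
    unfolding D_def f_def by (rule integrable_L2_diff; use L2 in simp)+
  have L1: "integrable lborel F" if [measurable]: "F \<in> borel_measurable borel"
      and "integrable lborel (\<lambda>x. (norm (F x))^2)" "\<And>x. x \<notin> ?Q \<Longrightarrow> F x = 0" for F :: "real \<times> pt \<Rightarrow> 'w::euclidean_space"
    by (rule integrable_L2_imp_L1[OF _ _ that(2) slab_finite that(3)]) auto
  have eq: "\<theta> (t, p) = T t p - \<eta> t p" "D (t, p) = GTe t p - G\<eta> t p" "U (t, p) = u t p" if "t \<in> {0..R}" "p \<in> ?O" for t p
    using q1[OF that] by (auto simp: \<theta>_def D_def U_def XT_def XE_def VT_def VE_def)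
  have slice: "AE t in lborel. t \<in> {0..R} \<longrightarrow> H10_limit lx ly (\<lambda>p. \<theta> (t, p)) (\<lambda>p. D (t, p))"
  proof -
    have "AE t in lebesgue_on {0..}. bc10 lx ly (T t) (GTe t)" using T by (auto simp: weak_sol_def elim: eventually_mono)
    then show ?thesis using bc unfolding AE_time
    proof eventually_elim
      case (elim t)
      show ?case
      proof
        assume t: "t \<in> {0..R}"
        then have "H10_limit lx ly (\<lambda>p. T t p - \<eta> t p) (\<lambda>p. GTe t p - G\<eta> t p)" using elim by (intro bc10_diff) auto
        then show "H10_limit lx ly (\<lambda>p. \<theta> (t, p)) (\<lambda>p. D (t, p))" by (rule H10_limit_cong) (use eq[OF t] in auto)
      qed
    qed
  qed
  have div: "AE t in lborel. t \<in> {0..R} \<longrightarrow> (\<forall>\<phi>. test0 lx ly \<phi> \<longrightarrow> (\<integral>p. U (t, p) \<bullet> sgrad \<phi> p \<partial>MO lx ly) = 0)"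
  proof -
    have "AE t in lborel. 0 \<le> t \<longrightarrow> (\<forall>\<phi>. test0 lx ly \<phi> \<longrightarrow> (\<integral>p. u t p \<bullet> sgrad \<phi> p \<partial>MO lx ly) = 0)"
      using divu by (simp add: divfree_def AE_time)
    then show ?thesis
    proof eventually_elim
      case (elim t)
      have "(\<integral>p. U (t, p) \<bullet> sgrad \<phi> p \<partial>MO lx ly) = (\<integral>p. u t p \<bullet> sgrad \<phi> p \<partial>MO lx ly)" if "t \<in> {0..R}" for \<phi>
        by (rule Bochner_Integration.integral_cong) (use eq(3)[OF that] in auto)
      then show ?case using elim by auto
    qed
  qed
  have bound: "AE t in lborel. t \<in> {0..R} \<longrightarrow> (LBINT p. (\<theta> (t, p))^2) \<le> 2 * (CT^2 * measure lborel ?O) + 2 * CE"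
    using sE lborel_AE_slices[OF AT] lborel_Fubini(3)[OF LT] lborel_Fubini(3)[OF LE] lborel_Fubini(3)[OF L\<theta>]
  proof eventually_elim
    case (elim t)
    show ?case
    proof
      assume t: "t \<in> {0..R}"
      have "(LBINT p. (\<theta> (t, p))^2) \<le> (LBINT p. 2 * (XT (t, p))^2 + 2 * (XE (t, p))^2)"
      proof (rule integral_mono[OF elim(5)])
        show "integrable lborel (\<lambda>p. 2 * (XT (t, p))^2 + 2 * (XE (t, p))^2)" using elim(3,4) by simp
        show "(\<theta> (t, p))^2 \<le> 2 * (XT (t, p))^2 + 2 * (XE (t, p))^2" for p
          using norm_diff_sq_le[of "XT (t, p)" "XE (t, p)"] by (simp add: \<theta>_def)
      qed
      also have "\<dots> = 2 * (LBINT p. (XT (t, p))^2) + 2 * (LBINT p. (XE (t, p))^2)" using elim(3,4) by simp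
      also have "(LBINT p. (XT (t, p))^2) \<le> (LBINT p. CT^2 * indicator ?O p)"
      proof (rule integral_mono_AE[OF elim(3)])
        show "integrable lborel (\<lambda>p. CT^2 * indicator ?O p)" using Om_finite by simp
        show "AE p in lborel. (XT (t, p))^2 \<le> CT^2 * indicator ?O p"
          using elim(2) t by (simp add: q_def indicator_times)
      qed
      also have "(LBINT p. CT^2 * indicator ?O p) = CT^2 * measure lborel ?O" by simp
      also have "(LBINT p. (XE (t, p))^2) \<le> CE"
        using elim(1) t nn_integral_eq_integral[OF elim(4)] CE(2) by simp
      finally show "(LBINT p. (\<theta> (t, p))^2) \<le> 2 * (CT^2 * measure lborel ?O) + 2 * CE" by simp
    qed
  qed
  have weak: "(LBINT x. A' (fst x) * (\<theta> x * \<phi> (snd x)))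
        = (LBINT x. A (fst x) * (\<phi> (snd x) * (U x \<bullet> D x) + f x \<bullet> sgrad \<phi> (snd x)))"
    if cd: "0 < c" "d < R" and A: "\<And>t. (A has_real_derivative A' t) (at t)" and cA': "continuous_on UNIV A'"
      and A0: "\<And>t. t \<notin> {c..d} \<Longrightarrow> A t = 0" and \<phi>: "test0 lx ly \<phi>" for A A' \<phi> c d
  proof -
    note [measurable] = test0_cont(3,4)[OF \<phi>]
    have cA: "continuous_on UNIV A" by (intro continuous_at_imp_continuous_on ballI DERIV_isCont[OF A])
    have [measurable]: "A \<in> borel_measurable borel" "A' \<in> borel_measurable borel"
      using cA cA' by (auto intro: borel_measurable_continuous_onI)
    have A'0: "A' t = 0" if "t \<notin> {c..d}" for t by (rule deriv_zero_outside[OF A A0 that])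
    obtain m where m: "\<And>t. \<bar>A t\<bar> \<le> m" using bounded_outside_interval[OF cA A0] by blast
    obtain m' where m': "\<And>t. \<bar>A' t\<bar> \<le> m'" using bounded_outside_interval[OF cA' A'0] by blast
    obtain M where M: "\<And>p. p \<in> Om lx ly \<Longrightarrow> \<bar>\<phi> p\<bar> \<le> M" "\<And>p. p \<in> Om lx ly \<Longrightarrow> norm (sgrad \<phi> p) \<le> M" "M \<ge> 0"
      using test0_bounded[OF \<phi>] by blast
    define a where "a x = A' (fst x) * \<phi> (snd x)" for x
    define b where "b x = A (fst x) * \<phi> (snd x)" for x
    define v where "v x = A (fst x) *\<^sub>R sgrad \<phi> (snd x)" for x
    have [measurable]: "a \<in> borel_measurable borel" "b \<in> borel_measurable borel" "v \<in> borel_measurable borel"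
      unfolding a_def b_def v_def by measurable
    have m0: "m \<ge> 0" "m' \<ge> 0" using m[of 0] m'[of 0] by linarith+
    have bd: "norm (a x) \<le> m' * M" "norm (b x) \<le> m * M" "norm (v x) \<le> m * M" if "x \<in> ?Q" for x
      using that m[of "fst x"] m'[of "fst x"] M(1,2)[of "snd x"] m0 M(3)
      by (auto simp: a_def b_def v_def abs_mult intro!: mult_mono)
    \<comment> \<open>A point over the cell but outside the slab has its time outside
      \<open>{0..R}\<close>, hence outside \<open>{c..d}\<close>. So the test fields vanish wherever
      the factor \<open>q\<close> changes something, and cut and uncut integrals agree.\<close>
    have sup0: "a x = 0" "b x = 0" "v x = 0" if "x \<notin> ?Q" "x \<in> UNIV \<times> ?O" for x
    proof -
      have "fst x \<notin> {c..d}" using that cd by auto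
      then show "a x = 0" "b x = 0" "v x = 0" using A0 A'0 by (auto simp: a_def b_def v_def)
    qed
    have I1: "integrable lborel (\<lambda>x. XT x * a x)" "integrable lborel (\<lambda>x. XE x * a x)"
      using integrable_inner_bounded[OF L1[of XT] _ bd(1) z(1)] integrable_inner_bounded[OF L1[of XE] _ bd(1) z(2)] LT LE z(1,2)
      by simp_all
    have I2: "integrable lborel (\<lambda>x. XT x * (U x \<bullet> v x))" "integrable lborel (\<lambda>x. XE x * (U x \<bullet> v x))"
      using integrable_inner_bounded[OF integrable_L2_scaleR[of XT lborel U] _ bd(3), of ]
        integrable_inner_bounded[OF integrable_L2_scaleR[of XE lborel U] _ bd(3)] LT LE L2(4) z(1,2)
      by simp_all
    have I3: "integrable lborel (\<lambda>x. VT x \<bullet> v x)" "integrable lborel (\<lambda>x. VP x \<bullet> v x)"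
      using integrable_inner_bounded[OF L1[of VT] _ bd(3) z(3)] integrable_inner_bounded[OF L1[of VP] _ bd(3) z(5)] L2 z(3,5)
      by simp_all
    have iUD: "integrable lborel (\<lambda>x. U x \<bullet> D x)" by (rule integrable_inner_L2) (use L2 LD in auto)
    have I4: "integrable lborel (\<lambda>x. (U x \<bullet> D x) * b x)"
      using integrable_inner_bounded[OF iUD _ bd(2)] z by simp
    note prod = product_test[where c=c and d=d and A=A, OF A cA' cd(1) A0 \<phi>, simplified]
    \<comment> \<open>The temperature equation; the initial datum disappears because
      \<open>A 0 = 0\<close>.\<close>
    have E1: "- (LBINT x. XT x * a x) - (LBINT x. XT x * (U x \<bullet> v x)) + (LBINT x. VT x \<bullet> v x) = 0"
    proof -
      have s: "st_test lx ly (\<lambda>x. A (fst x) * \<phi> (snd x))" using prod(1) by (simp add: st_test_pos_def)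
      let ?F = "\<lambda>x. - T (fst x) (snd x) * a x - T (fst x) (snd x) * (u (fst x) (snd x) \<bullet> v x) + GTe (fst x) (snd x) \<bullet> v x"
      have "(\<integral>x. ?F x \<partial>lebesgue_on ({0..} \<times> ?O)) = (\<integral>p. T0 p * (A 0 * \<phi> p) \<partial>MO lx ly)"
      proof -
        have "(\<integral>x. - T (fst x) (snd x) * dtime \<Phi> (fst x) (snd x)
               - T (fst x) (snd x) * (u (fst x) (snd x) \<bullet> tgrad \<Phi> (fst x) (snd x))
               + GTe (fst x) (snd x) \<bullet> tgrad \<Phi> (fst x) (snd x) \<partial>lebesgue_on ({0..} \<times> ?O))
            = (\<integral>p. T0 p * \<Phi> (0, p) \<partial>MO lx ly)" if "st_test lx ly \<Phi>" for \<Phi>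
          using T that unfolding weak_sol_def by blast
        from this[OF s] show ?thesis unfolding prod(2,3) a_def v_def by simp
      qed
      also have "A 0 = 0" using A0[of 0] cd by simp
      finally have "0 = (\<integral>x. ?F x \<partial>lebesgue_on ({0..} \<times> ?O))" by simp
      also have "\<dots> = (LBINT x. indicator ({0..} \<times> ?O) x *\<^sub>R ?F x)" by (rule lebesgue_on_borel(2)) measurable
      also have "\<dots> = (LBINT x. - (XT x * a x) - XT x * (U x \<bullet> v x) + VT x \<bullet> v x)"
      proof (rule Bochner_Integration.integral_cong)
        fix x
        show "indicator ({0..} \<times> ?O) x *\<^sub>R ?F x = - (XT x * a x) - XT x * (U x \<bullet> v x) + VT x \<bullet> v x"
        proof (cases "x \<in> ?Q")
          case True
          then show ?thesis by (auto simp: XT_def U_def VT_def q_def)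
        next
          case False
          then show ?thesis using z[OF False] sup0[OF False] by (auto simp: indicator_def)
        qed
      qed simp
      finally show ?thesis using I1 I2 I3 by simp
    qed
    \<comment> \<open>The equation for eta. The pairing with the time derivative \<open>g\<close> is
      computed twice: as a distribution, with the derivative on the time weight, and slice by slice
      through the relation that defines psi.\<close>
    have E2: "(LBINT x. XE x * (U x \<bullet> v x)) - (LBINT x. VP x \<bullet> v x) = - (LBINT x. XE x * a x)"
    proof -
      have ig: "integrable (lebesgue_on {0..}) (\<lambda>t. g t (\<lambda>p. A t * \<phi> p))"
        and eg: "(\<integral>t. g t (\<lambda>p. A t * \<phi> p) \<partial>lebesgue_on {0..}) = - (\<integral>x. \<eta> (fst x) (snd x) * a x \<partial>lebesgue_on ({0..} \<times> ?O))"
        using eta prod(1) unfolding admissible_def a_def by (auto simp: prod(2))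
      have r: "(\<integral>x. \<eta> (fst x) (snd x) * a x \<partial>lebesgue_on ({0..} \<times> ?O)) = (LBINT x. XE x * a x)"
      proof -
        have "(\<integral>x. \<eta> (fst x) (snd x) * a x \<partial>lebesgue_on ({0..} \<times> ?O)) = (LBINT x. indicator ({0..} \<times> ?O) x *\<^sub>R (\<eta> (fst x) (snd x) * a x))"
          by (rule lebesgue_on_borel(2)) measurable
        also have "\<dots> = (LBINT x. XE x * a x)"
        proof (rule Bochner_Integration.integral_cong)
          fix x
          show "indicator ({0..} \<times> ?O) x *\<^sub>R (\<eta> (fst x) (snd x) * a x) = XE x * a x"
          proof (cases "x \<in> ?Q")
            case True
            then show ?thesis by (auto simp: XE_def q_def)
          next
            case False
            then show ?thesis using z[OF False] sup0[OF False] by (auto simp: indicator_def)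
          qed
        qed simp
        finally show ?thesis .
      qed
      define H where "H x = XE x * (U x \<bullet> v x) - VP x \<bullet> v x" for x
      have iH: "integrable lborel H" unfolding H_def using I2 I3 by simp
      have [measurable]: "H \<in> borel_measurable borel" unfolding H_def by measurable
      have ae: "AE t in lborel. 0 \<le> t \<longrightarrow> g t (\<lambda>p. A t * \<phi> p) = (LBINT p. H (t, p))"
      proof -
        have "AE t in lborel. 0 \<le> t \<longrightarrow> (\<forall>f G. H10 lx ly f G \<longrightarrow>
           - (\<integral>p. G\<psi> t p \<bullet> G p \<partial>MO lx ly) = g t f - (\<integral>p. \<eta> t p * (u t p \<bullet> G p) \<partial>MO lx ly))"
          using psi unfolding inv_lap_def AE_time by (auto elim: eventually_mono)
        then show ?thesis using lborel_Fubini(3)[OF I2(2)] lborel_Fubini(3)[OF I3(2)]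
        proof eventually_elim
          case (elim t)
          show ?case
          proof
            assume t: "0 \<le> t"
            have "sgrad (\<lambda>p. A t * \<phi> p) = (\<lambda>p. v (t, p))"
              using test0_scale(2)[OF \<phi>] by (auto simp: v_def)
            \<comment> \<open>At a fixed time the test function is a multiple of
              \<open>\<phi>\<close>, an element of H^1_0, so the defining relation of psi can be
              evaluated at it.\<close>
            then have "H10 lx ly (\<lambda>p. A t * \<phi> p) (\<lambda>p. v (t, p))"
              using test0_H10[OF test0_scale(1)[OF \<phi>] l, of "A t"] by simp
            with elim(1) t have g: "g t (\<lambda>p. A t * \<phi> p) = (\<integral>p. \<eta> t p * (u t p \<bullet> v (t, p)) \<partial>MO lx ly) - (\<integral>p. G\<psi> t p \<bullet> v (t, p) \<partial>MO lx ly)"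
              by fastforce
            have cut: "XE (t, p) = \<eta> t p \<and> U (t, p) = u t p \<and> VP (t, p) = G\<psi> t p \<or> v (t, p) = 0" if "p \<in> ?O" for p
              using sup0(3)[of "(t, p)"] that by (cases "(t, p) \<in> ?Q") (auto simp: XE_def U_def VP_def q_def)
            have "(\<integral>p. \<eta> t p * (u t p \<bullet> v (t, p)) \<partial>MO lx ly) = (\<integral>p. XE (t, p) * (U (t, p) \<bullet> v (t, p)) \<partial>MO lx ly)"
              by (rule Bochner_Integration.integral_cong) (use cut in force)+
            also have "\<dots> = (LBINT p. XE (t, p) * (U (t, p) \<bullet> v (t, p)))"
              by (rule integral_MO_eq) (use z in auto)
            finally have 1: "(\<integral>p. \<eta> t p * (u t p \<bullet> v (t, p)) \<partial>MO lx ly) = (LBINT p. XE (t, p) * (U (t, p) \<bullet> v (t, p)))" .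
            have "(\<integral>p. G\<psi> t p \<bullet> v (t, p) \<partial>MO lx ly) = (\<integral>p. VP (t, p) \<bullet> v (t, p) \<partial>MO lx ly)"
              by (rule Bochner_Integration.integral_cong) (use cut in force)+
            also have "\<dots> = (LBINT p. VP (t, p) \<bullet> v (t, p))"
              by (rule integral_MO_eq) (use z in auto)
            finally have 2: "(\<integral>p. G\<psi> t p \<bullet> v (t, p) \<partial>MO lx ly) = (LBINT p. VP (t, p) \<bullet> v (t, p))" .
            show "g t (\<lambda>p. A t * \<phi> p) = (LBINT p. H (t, p))"
              unfolding g 1 2 H_def using elim(2,3) by simp
          qed
        qed
      qed
      have "(\<integral>t. g t (\<lambda>p. A t * \<phi> p) \<partial>lebesgue_on {0..}) = (\<integral>t. (LBINT p. H (t, p)) \<partial>lebesgue_on {0..})"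
      proof (rule integral_cong_AE)
        show "(\<lambda>t. g t (\<lambda>p. A t * \<phi> p)) \<in> borel_measurable (lebesgue_on {0..})" using ig by (rule borel_measurable_integrable)
        show "(\<lambda>t. LBINT p. H (t, p)) \<in> borel_measurable (lebesgue_on {0..})"
          by (rule borel_measurable_lebesgue_on) measurable
        show "AE t in lebesgue_on {0..}. g t (\<lambda>p. A t * \<phi> p) = (LBINT p. H (t, p))" unfolding AE_time by (rule ae)
      qed
      also have "\<dots> = (LBINT t. indicator {0..} t *\<^sub>R (LBINT p. H (t, p)))"
        by (rule lebesgue_on_borel(2)) measurable
      also have "\<dots> = (LBINT t. (LBINT p. H (t, p)))"
      proof (rule Bochner_Integration.integral_cong)
        fix t
        show "indicator {0..} t *\<^sub>R (LBINT p. H (t, p)) = (LBINT p. H (t, p))"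
        proof (cases "0 \<le> t")
          case False
          then have "H (t, p) = 0" for p using z[of "(t, p)"] by (auto simp: H_def)
          then show ?thesis by simp
        qed simp
      qed simp
      also have "\<dots> = (LBINT x. H x)" by (rule lborel_Fubini(2)[OF iH])
      also have "\<dots> = (LBINT x. XE x * (U x \<bullet> v x)) - (LBINT x. VP x \<bullet> v x)"
        unfolding H_def using I2 I3 by simp
      finally show ?thesis using eg r by simp
    qed
    \<comment> \<open>The slicewise product rule brings the transport of the difference into
      advective form. It is applied to T - eta as a whole, which vanishes at the plates as the
      closure of the test functions requires.\<close>
    have E3: "(LBINT x. \<theta> x * (U x \<bullet> v x)) = - (LBINT x. (U x \<bullet> D x) * b x)"
    proof -
      have i: "integrable lborel (\<lambda>x. \<theta> x * (U x \<bullet> v x))" unfolding \<theta>_def using I2 by (simp add: left_diff_distrib)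
      have "AE t in lborel. (LBINT p. \<theta> (t, p) * (U (t, p) \<bullet> v (t, p))) = - (LBINT p. (U (t, p) \<bullet> D (t, p)) * b (t, p))"
        using slice div lborel_Fubini(3)[OF L2(4)]
      proof eventually_elim
        case (elim t)
        show ?case
        proof (cases "t \<in> {0..R}")
          case True
          have "(\<integral>p. \<theta> (t, p) * (U (t, p) \<bullet> sgrad \<phi> p) \<partial>MO lx ly) = - (\<integral>p. \<phi> p * (U (t, p) \<bullet> D (t, p)) \<partial>MO lx ly)"
          proof (rule weak_test_mult[OF mp[OF elim(1) True] _ _ _ \<phi>])
            show "(\<lambda>p. U (t, p)) \<in> borel_measurable (MO lx ly)" by (rule borel_measurable_lebesgue_on) measurable
            show "integrable (MO lx ly) (\<lambda>p. (norm (U (t, p)))^2)" by (rule integrable_MO_I[OF elim(3)])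
          qed (use elim(2) True in auto)
          moreover have "(\<integral>p. \<theta> (t, p) * (U (t, p) \<bullet> sgrad \<phi> p) \<partial>MO lx ly) = (LBINT p. \<theta> (t, p) * (U (t, p) \<bullet> sgrad \<phi> p))"
            by (rule integral_MO_eq) (use z z' in auto)
          moreover have "(\<integral>p. \<phi> p * (U (t, p) \<bullet> D (t, p)) \<partial>MO lx ly) = (LBINT p. \<phi> p * (U (t, p) \<bullet> D (t, p)))"
            by (rule integral_MO_eq) (use z z' in auto)
          ultimately have e: "(LBINT p. \<theta> (t, p) * (U (t, p) \<bullet> sgrad \<phi> p)) = - (LBINT p. \<phi> p * (U (t, p) \<bullet> D (t, p)))" by simp
          have "(LBINT p. \<theta> (t, p) * (U (t, p) \<bullet> v (t, p))) = (LBINT p. A t * (\<theta> (t, p) * (U (t, p) \<bullet> sgrad \<phi> p)))"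
            by (simp add: v_def mult_ac)
          also have "\<dots> = - (A t * (LBINT p. \<phi> p * (U (t, p) \<bullet> D (t, p))))" by (simp add: e)
          also have "\<dots> = - (LBINT p. A t * (\<phi> p * (U (t, p) \<bullet> D (t, p))))" by simp
          also have "\<dots> = - (LBINT p. (U (t, p) \<bullet> D (t, p)) * b (t, p))"
            by (simp only: b_def fst_conv snd_conv mult_ac)
          finally show ?thesis .
        next
          case False
          then have "\<theta> (t, p) = 0" "U (t, p) = 0" for p using z(6)[of "(t, p)"] z'(1)[of "(t, p)"] by auto
          then show ?thesis by simp
        qed
      qed
      then have "(LBINT t. (LBINT p. \<theta> (t, p) * (U (t, p) \<bullet> v (t, p)))) = (LBINT t. - (LBINT p. (U (t, p) \<bullet> D (t, p)) * b (t, p)))"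
        by (intro integral_cong_AE) auto
      then show ?thesis using lborel_Fubini(2)[OF i] lborel_Fubini(2)[OF I4] by simp
    qed
    have "(LBINT x. A' (fst x) * (\<theta> x * \<phi> (snd x))) = (LBINT x. XT x * a x - XE x * a x)"
      by (simp add: \<theta>_def a_def algebra_simps)
    also have "\<dots> = (LBINT x. XT x * a x) - (LBINT x. XE x * a x)" using I1 by simp
    also have "\<dots> = (LBINT x. VT x \<bullet> v x) - (LBINT x. VP x \<bullet> v x)
        - ((LBINT x. XT x * (U x \<bullet> v x)) - (LBINT x. XE x * (U x \<bullet> v x)))"
      using E1 E2 by simp
    also have "(LBINT x. XT x * (U x \<bullet> v x)) - (LBINT x. XE x * (U x \<bullet> v x)) = (LBINT x. \<theta> x * (U x \<bullet> v x))"
      using I2 by (simp add: \<theta>_def left_diff_distrib)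
    also have "(LBINT x. VT x \<bullet> v x) - (LBINT x. VP x \<bullet> v x) = (LBINT x. f x \<bullet> v x)"
      using I3 by (simp add: f_def inner_diff_left)
    also have "(LBINT x. f x \<bullet> v x) - (LBINT x. \<theta> x * (U x \<bullet> v x))
      = (LBINT x. (U x \<bullet> D x) * b x + f x \<bullet> v x)"
      unfolding E3 using I3 I4 by (simp add: f_def inner_diff_left)
    also have "\<dots> = (LBINT x. A (fst x) * (\<phi> (snd x) * (U x \<bullet> D x) + f x \<bullet> sgrad \<phi> (snd x)))"
      by (simp add: b_def v_def algebra_simps)
    finally show ?thesis .
  qed
  have "energy_setup lx ly R (2 * (CT^2 * measure lborel ?O) + 2 * CE) \<theta> D f U"
  proof
    show "integrable lborel \<theta>" "integrable lborel f" using L1[of \<theta>] L1[of f] L\<theta> LD z' by auto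
    show "\<theta> x = 0" "D x = 0" "f x = 0" "U x = 0" if "snd x \<notin> ?O" for x
      using z[of x] z'[of x] that by (auto simp: mem_Times_iff)
  qed (use l L2 LD L\<theta> slice div bound weak in auto)
  then show ?thesis unfolding \<theta>_def D_def f_def U_def XT_def XE_def VT_def VE_def VP_def .
qed

lemma cut_nn_integral:
  fixes F :: "real \<times> pt \<Rightarrow> 'v::euclidean_space"
  assumes [measurable]: "F \<in> borel_measurable borel"
    and I: "integrable lborel (\<lambda>x. (norm (indicator ({0..\<tau>} \<times> Om lx ly) x *\<^sub>R F x))^2)"
  shows "(\<integral>\<^sup>+x. ennreal ((norm (F x))^2) \<partial>lebesgue_on ({0..\<tau>} \<times> Om lx ly))
    = ennreal (LBINT x. (norm (indicator ({0..\<tau>} \<times> Om lx ly) x *\<^sub>R F x))^2)"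
proof -
  have "(\<integral>\<^sup>+x. ennreal ((norm (F x))^2) \<partial>lebesgue_on ({0..\<tau>} \<times> Om lx ly))
    = (\<integral>\<^sup>+x. ennreal ((norm (F x))^2) * indicator ({0..\<tau>} \<times> Om lx ly) x \<partial>lborel)"
    by (rule lebesgue_on_borel(1)) measurable
  also have "\<dots> = (\<integral>\<^sup>+x. ennreal ((norm (indicator ({0..\<tau>} \<times> Om lx ly) x *\<^sub>R F x))^2) \<partial>lborel)"
    by (intro nn_integral_cong) (auto simp: indicator_def)
  also have "\<dots> = ennreal (LBINT x. (norm (indicator ({0..\<tau>} \<times> Om lx ly) x *\<^sub>R F x))^2)"
    by (rule nn_integral_eq_integral[OF I]) simp
  finally show ?thesis .
qed

text \<open>The quantifier order is what matters: \<open>C\<close> is chosen before the horizon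
  \<open>R\<close>, so it disappears on division by the length of the time interval. This is
  possible because T is bounded, and eta bounded in L2, uniformly over all times.\<close>

lemma energy_bound:
  fixes u :: "real \<Rightarrow> pt \<Rightarrow> pt"
  assumes l: "0 < lx" "0 < ly"
    and divu: "divfree lx ly u"
    and fu: "\<And>R. (\<integral>\<^sup>+x. ennreal ((norm (u (fst x) (snd x)))^2) \<partial>lebesgue_on ({0..R} \<times> Om lx ly)) < \<infinity>"
    and T: "weak_sol lx ly u T0 T GTe"
    and eta: "admissible lx ly \<eta> G\<eta> g"
    and bc: "AE t in lebesgue_on {0..}. bc10 lx ly (\<eta> t) (G\<eta> t)"
    and psi: "inv_lap lx ly u \<eta> g \<psi> G\<psi>"
    and fin: "\<And>R. (\<integral>\<^sup>+x. ennreal ((norm (G\<eta> (fst x) (snd x)))^2 + (norm (G\<psi> (fst x) (snd x)))^2) \<partial>lebesgue_on ({0..R} \<times> Om lx ly)) < \<infinity>"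
  shows "\<exists>C\<ge>0. \<forall>R>0. (\<integral>\<^sup>+x. ennreal ((norm (GTe (fst x) (snd x)))^2) \<partial>lebesgue_on ({0..R} \<times> Om lx ly))
    \<le> (\<integral>\<^sup>+x. ennreal ((norm (G\<eta> (fst x) (snd x)))^2 + (norm (G\<psi> (fst x) (snd x)))^2) \<partial>lebesgue_on ({0..R} \<times> Om lx ly)) + ennreal C"
proof -
  have mT [measurable]: "(\<lambda>x. GTe (fst x) (snd x)) \<in> borel_measurable borel" using T by (simp add: weak_sol_def)
  have mE [measurable]: "(\<lambda>x. G\<eta> (fst x) (snd x)) \<in> borel_measurable borel" using eta by (simp add: admissible_def)
  have mP [measurable]: "(\<lambda>x. G\<psi> (fst x) (snd x)) \<in> borel_measurable borel" using psi by (simp add: inv_lap_def)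
  obtain CT where CT: "AE x in lebesgue_on ({0..} \<times> Om lx ly). \<bar>T (fst x) (snd x)\<bar> \<le> CT"
    using T unfolding weak_sol_def by blast
  obtain c where c: "AE t in lebesgue_on {0..}. (\<integral>\<^sup>+p. ennreal ((\<eta> t p)^2) \<partial>MO lx ly) \<le> ennreal c"
    using eta unfolding admissible_def by blast
  \<comment> \<open>\<open>ennreal\<close> sends negative reals to 0, so a negative bound can be
    replaced by 0.\<close>
  define CE where "CE = max 0 c"
  have CE: "AE t in lebesgue_on {0..}. (\<integral>\<^sup>+p. ennreal ((\<eta> t p)^2) \<partial>MO lx ly) \<le> ennreal CE" "0 \<le> CE"
    using c by (auto simp: CE_def max_def ennreal_neg elim: eventually_mono)
  define C where "C = 2 * (CT^2 * measure lborel (Om lx ly)) + 2 * CE"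
  have C0: "C \<ge> 0" using CE(2) by (simp add: C_def)
  have "(\<integral>\<^sup>+x. ennreal ((norm (GTe (fst x) (snd x)))^2) \<partial>lebesgue_on ({0..R} \<times> Om lx ly))
    \<le> (\<integral>\<^sup>+x. ennreal ((norm (G\<eta> (fst x) (snd x)))^2 + (norm (G\<psi> (fst x) (snd x)))^2) \<partial>lebesgue_on ({0..R} \<times> Om lx ly)) + ennreal C"
    if R: "R > 0" for R
  proof -
    let ?M = "lebesgue_on ({0..R} \<times> Om lx ly)"
    have fE: "(\<integral>\<^sup>+x. ennreal ((norm (G\<eta> (fst x) (snd x)))^2) \<partial>?M) < \<infinity>"
      by (rule le_less_trans[OF nn_integral_mono fin[of R]]) (auto intro: ennreal_leI)
    have fP: "(\<integral>\<^sup>+x. ennreal ((norm (G\<psi> (fst x) (snd x)))^2) \<partial>?M) < \<infinity>"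
      by (rule le_less_trans[OF nn_integral_mono fin[of R]]) (auto intro: ennreal_leI)
    have fT: "(\<integral>\<^sup>+x. ennreal ((norm (GTe (fst x) (snd x)))^2) \<partial>?M) < \<infinity>"
      using T by (simp add: weak_sol_def)
    define q where "q x = (indicator ({0..R} \<times> Om lx ly) x :: real)" for x
    define VT where "VT x = q x *\<^sub>R GTe (fst x) (snd x)" for x
    define VE where "VE x = q x *\<^sub>R G\<eta> (fst x) (snd x)" for x
    define VP where "VP x = q x *\<^sub>R G\<psi> (fst x) (snd x)" for x
    have IT: "integrable lborel (\<lambda>x. (norm (VT x))^2)" unfolding VT_def q_def by (rule cut_L2[OF mT fT])
    have IE: "integrable lborel (\<lambda>x. (norm (VE x))^2)" unfolding VE_def q_def by (rule cut_L2[OF mE fE])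
    have IP: "integrable lborel (\<lambda>x. (norm (VP x))^2)" unfolding VP_def q_def by (rule cut_L2[OF mP fP])
    interpret E: energy_setup lx ly R C "\<lambda>x. q x * T (fst x) (snd x) - q x * \<eta> (fst x) (snd x)"
        "\<lambda>x. VT x - VE x" "\<lambda>x. VT x - VP x" "\<lambda>x. q x *\<^sub>R u (fst x) (snd x)"
      unfolding C_def VT_def VE_def VP_def q_def
      by (rule energy_setup_difference[OF l R divu fu T CT eta CE bc fE psi fP])
    have E: "(LBINT x. (VT x - VP x) \<bullet> (VT x - VE x)) \<le> C / 2"
      by (rule E.energy_total[OF R]) (auto simp: VT_def VP_def q_def indicator_def)
    have iE: "integrable lborel (\<lambda>x. (VT x - VP x) \<bullet> (VT x - VE x))"
      by (rule integrable_inner_L2) (use E.meas E.int in auto)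
    have "(LBINT x. (norm (VT x))^2) \<le> (LBINT x. (norm (VE x))^2 + (norm (VP x))^2 + 2 * ((VT x - VP x) \<bullet> (VT x - VE x)))"
    proof (rule integral_mono[OF IT])
      show "integrable lborel (\<lambda>x. (norm (VE x))^2 + (norm (VP x))^2 + 2 * ((VT x - VP x) \<bullet> (VT x - VE x)))"
        using IE IP iE by simp
      fix x
      \<comment> \<open>The inequality comes from a complete square: right side minus left side
        equals the square of the norm of \<open>VT x - VE x - VP x\<close>.\<close>
      have "0 \<le> (VT x - VE x - VP x) \<bullet> (VT x - VE x - VP x)" by simp
      then show "(norm (VT x))^2 \<le> (norm (VE x))^2 + (norm (VP x))^2 + 2 * ((VT x - VP x) \<bullet> (VT x - VE x))"
        unfolding power2_norm_eq_inner by (simp add: inner_diff_left inner_diff_right inner_commute)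
    qed
    also have "\<dots> = (LBINT x. (norm (VE x))^2) + (LBINT x. (norm (VP x))^2) + 2 * (LBINT x. (VT x - VP x) \<bullet> (VT x - VE x))"
      using IE IP iE by simp
    finally have main: "(LBINT x. (norm (VT x))^2) \<le> (LBINT x. (norm (VE x))^2) + (LBINT x. (norm (VP x))^2) + C"
      using E by linarith
    have "(\<integral>\<^sup>+x. ennreal ((norm (GTe (fst x) (snd x)))^2) \<partial>?M) = ennreal (LBINT x. (norm (VT x))^2)"
      unfolding VT_def q_def by (rule cut_nn_integral[OF mT IT[unfolded VT_def q_def]])
    also have "\<dots> \<le> ennreal ((LBINT x. (norm (VE x))^2) + (LBINT x. (norm (VP x))^2) + C)"
      by (rule ennreal_leI[OF main])
    also have "\<dots> = ennreal (LBINT x. (norm (VE x))^2) + ennreal (LBINT x. (norm (VP x))^2) + ennreal C"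
      using C0 by (simp add: ennreal_plus)
    also have "ennreal (LBINT x. (norm (VE x))^2) = (\<integral>\<^sup>+x. ennreal ((norm (G\<eta> (fst x) (snd x)))^2) \<partial>?M)"
      unfolding VE_def q_def by (rule cut_nn_integral[OF mE IE[unfolded VE_def q_def], symmetric])
    also have "ennreal (LBINT x. (norm (VP x))^2) = (\<integral>\<^sup>+x. ennreal ((norm (G\<psi> (fst x) (snd x)))^2) \<partial>?M)"
      unfolding VP_def q_def by (rule cut_nn_integral[OF mP IP[unfolded VP_def q_def], symmetric])
    also have "(\<integral>\<^sup>+x. ennreal ((norm (G\<eta> (fst x) (snd x)))^2) \<partial>?M) + (\<integral>\<^sup>+x. ennreal ((norm (G\<psi> (fst x) (snd x)))^2) \<partial>?M)
      = (\<integral>\<^sup>+x. ennreal ((norm (G\<eta> (fst x) (snd x)))^2) + ennreal ((norm (G\<psi> (fst x) (snd x)))^2) \<partial>?M)"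
    proof (rule nn_integral_add[symmetric])
      show "(\<lambda>x. ennreal ((norm (G\<eta> (fst x) (snd x)))^2)) \<in> borel_measurable ?M"
        "(\<lambda>x. ennreal ((norm (G\<psi> (fst x) (snd x)))^2)) \<in> borel_measurable ?M"
        by (rule borel_measurable_lebesgue_on, measurable)+
    qed
    finally show ?thesis by (simp add: ennreal_plus)
  qed
  with C0 show ?thesis by blast
qed

text \<open>A finite upper limit controls the integrals only at large times. They increase with the
  horizon, so one large time bounds the integral up to \<open>R\<close>.\<close>

lemma tavg_finite_imp:
  assumes l: "0 < lx" "0 < ly" and fin: "tavg lx ly F < \<infinity>"
    and [measurable]: "(\<lambda>x. F (fst x) (snd x)) \<in> borel_measurable borel"
  shows "(\<integral>\<^sup>+x. ennreal (F (fst x) (snd x)) \<partial>lebesgue_on ({0..R} \<times> Om lx ly)) < \<infinity>"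
proof -
  let ?I = "\<lambda>\<tau>. \<integral>\<^sup>+x. ennreal (F (fst x) (snd x)) \<partial>lebesgue_on ({0..\<tau>} \<times> Om lx ly)"
  have "eventually (\<lambda>\<tau>. ennreal (1 / (\<tau> * (lx * ly))) * ?I \<tau> < \<infinity>) at_top"
    by (rule Limsup_lessD) (use fin in \<open>simp add: tavg_def\<close>)
  then have "eventually (\<lambda>\<tau>. ennreal (1 / (\<tau> * (lx * ly))) * ?I \<tau> < \<infinity> \<and> \<tau> \<ge> max 1 R) at_top"
    using eventually_ge_at_top by (rule eventually_conj)
  then obtain \<tau> where \<tau>: "ennreal (1 / (\<tau> * (lx * ly))) * ?I \<tau> < \<infinity>" "\<tau> \<ge> 1" "\<tau> \<ge> R"
    by (auto simp: eventually_at_top_linorder)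
  have "0 < 1 / (\<tau> * (lx * ly))" using l \<tau>(2) by simp
  then have fin: "?I \<tau> < \<infinity>" using \<tau>(1) by (auto simp: ennreal_mult_less_top)
  have "?I R \<le> ?I \<tau>"
    unfolding lebesgue_on_borel(1)[OF slab_borel(1) measurable_compose[OF assms(4) measurable_ennreal]]
    by (intro nn_integral_mono) (use \<tau>(3) in \<open>auto simp: indicator_def\<close>)
  then show ?thesis using fin by (rule le_less_trans)
qed

text \<open>An excess that stays bounded is lost in the long-time mean. The slack \<open>e\<close>
  is split into one half for approaching the upper limit of \<open>G\<close> and one half for the
  excess.\<close>

lemma tavg_le_tavg:
  assumes l: "0 < lx" "0 < ly" and C: "0 \<le> C"
    and le: "\<And>\<tau>. 0 < \<tau> \<Longrightarrow> (\<integral>\<^sup>+x. ennreal (F (fst x) (snd x)) \<partial>lebesgue_on ({0..\<tau>} \<times> Om lx ly))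
      \<le> (\<integral>\<^sup>+x. ennreal (G (fst x) (snd x)) \<partial>lebesgue_on ({0..\<tau>} \<times> Om lx ly)) + ennreal C"
  shows "tavg lx ly F \<le> tavg lx ly G"
proof (rule ennreal_le_epsilon)
  fix e :: real assume fin: "tavg lx ly G < top" and e: "0 < e"
  let ?c = "\<lambda>\<tau>. ennreal (1 / (\<tau> * (lx * ly)))"
  let ?F = "\<lambda>\<tau>. \<integral>\<^sup>+x. ennreal (F (fst x) (snd x)) \<partial>lebesgue_on ({0..\<tau>} \<times> Om lx ly)"
  let ?G = "\<lambda>\<tau>. \<integral>\<^sup>+x. ennreal (G (fst x) (snd x)) \<partial>lebesgue_on ({0..\<tau>} \<times> Om lx ly)"
  have "tavg lx ly G + 0 < tavg lx ly G + ennreal (e / 2)"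
    using fin e by (subst ennreal_add_left_cancel_less) auto
  then have ev: "eventually (\<lambda>\<tau>. ?c \<tau> * ?G \<tau> < tavg lx ly G + ennreal (e / 2)) at_top"
    by (intro Limsup_lessD) (simp add: tavg_def)
  \<comment> \<open>Beyond the second threshold the excess divided by
    \<open>\<tau> * (lx * ly)\<close> is at most \<open>e / 2\<close>; the threshold 1 keeps \<tau>
    positive.\<close>
  have "eventually (\<lambda>\<tau>. \<tau> \<ge> max 1 (2 * C / (e * (lx * ly)))) at_top" by (rule eventually_ge_at_top)
  with ev have "eventually (\<lambda>\<tau>. ?c \<tau> * ?F \<tau> \<le> tavg lx ly G + ennreal e) at_top"
  proof eventually_elim
    case (elim \<tau>)
    have \<tau>: "\<tau> > 0" "2 * C / (e * (lx * ly)) \<le> \<tau>" using elim(2) by auto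
    have ll: "0 < lx * ly" using l by simp
    have "2 * C \<le> \<tau> * (e * (lx * ly))" using \<tau>(2) e ll by (simp add: pos_divide_le_eq)
    then have "1 / (\<tau> * (lx * ly)) * C \<le> e / 2"
      using \<tau>(1) ll by (simp add: pos_divide_le_eq mult_ac)
    then have small: "?c \<tau> * ennreal C \<le> ennreal (e / 2)"
      using \<tau>(1) ll C by (subst ennreal_mult[symmetric]) (auto intro!: ennreal_leI)
    have "?c \<tau> * ?F \<tau> \<le> ?c \<tau> * (?G \<tau> + ennreal C)" by (intro mult_left_mono le \<tau>) simp
    also have "\<dots> = ?c \<tau> * ?G \<tau> + ?c \<tau> * ennreal C" by (rule distrib_left)
    also have "\<dots> \<le> (tavg lx ly G + ennreal (e / 2)) + ennreal (e / 2)"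
      by (intro add_mono less_imp_le[OF elim(1)] small)
    also have "\<dots> = tavg lx ly G + ennreal e"
      using e by (simp add: add.assoc ennreal_plus[symmetric] del: ennreal_plus)
    finally show ?case .
  qed
  then show "tavg lx ly F \<le> tavg lx ly G + ennreal e"
    unfolding tavg_def[of lx ly F] by (rule Limsup_bounded)
qed

theorem theorem2p4:
  fixes lx ly :: real and u :: "real \<Rightarrow> pt \<Rightarrow> real^3" and T0 :: "pt \<Rightarrow> real"
    and T :: "real \<Rightarrow> pt \<Rightarrow> real" and GTe :: "real \<Rightarrow> pt \<Rightarrow> real^3"
  assumes "0 < lx" and "0 < ly"
    and "divfree lx ly u"
    and "tavg lx ly (\<lambda>t p. (norm (u t p))^2) < \<infinity>"
    and "Linf lx ly T0"
    and "weak_sol lx ly u T0 T GTe"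
  shows "tavg lx ly (\<lambda>t p. (norm (GTe t p))^2) \<le>
    Inf {tavg lx ly (\<lambda>t p. (norm (G\<eta> t p))^2 + (norm (G\<psi> t p))^2) | \<eta> G\<eta> g \<psi> G\<psi>.
           admissible lx ly \<eta> G\<eta> g \<and>
           (AE t in lebesgue_on {0..}. bc10 lx ly (\<eta> t) (G\<eta> t)) \<and>
           inv_lap lx ly u \<eta> g \<psi> G\<psi>}"
proof (rule Inf_greatest)
  fix X assume "X \<in> {tavg lx ly (\<lambda>t p. (norm (G\<eta> t p))^2 + (norm (G\<psi> t p))^2) | \<eta> G\<eta> g \<psi> G\<psi>.
           admissible lx ly \<eta> G\<eta> g \<and>
           (AE t in lebesgue_on {0..}. bc10 lx ly (\<eta> t) (G\<eta> t)) \<and>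
           inv_lap lx ly u \<eta> g \<psi> G\<psi>}"
  then obtain \<eta> G\<eta> g \<psi> G\<psi> where X: "X = tavg lx ly (\<lambda>t p. (norm (G\<eta> t p))^2 + (norm (G\<psi> t p))^2)"
    and a: "admissible lx ly \<eta> G\<eta> g" and b: "AE t in lebesgue_on {0..}. bc10 lx ly (\<eta> t) (G\<eta> t)"
    and i: "inv_lap lx ly u \<eta> g \<psi> G\<psi>" by blast
  have [measurable]: "(\<lambda>x. u (fst x) (snd x)) \<in> borel_measurable borel" "(\<lambda>x. G\<eta> (fst x) (snd x)) \<in> borel_measurable borel"
    "(\<lambda>x. G\<psi> (fst x) (snd x)) \<in> borel_measurable borel"
    using assms(3) a i by (simp_all add: divfree_def admissible_def inv_lap_def)
  show "tavg lx ly (\<lambda>t p. (norm (GTe t p))^2) \<le> X"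
  \<comment> \<open>A competitor of infinite cost bounds everything. Finite cost makes both of its
    gradients square integrable up to every finite horizon, which \<open>energy_bound\<close> asks
    for.\<close>
  proof (cases "X < \<infinity>")
    case True
    have fu: "(\<integral>\<^sup>+x. ennreal ((norm (u (fst x) (snd x)))^2) \<partial>lebesgue_on ({0..R} \<times> Om lx ly)) < \<infinity>" for R
      by (rule tavg_finite_imp[OF assms(1,2,4)]) measurable
    have fin: "(\<integral>\<^sup>+x. ennreal ((norm (G\<eta> (fst x) (snd x)))^2 + (norm (G\<psi> (fst x) (snd x)))^2) \<partial>lebesgue_on ({0..R} \<times> Om lx ly)) < \<infinity>" for R
      by (rule tavg_finite_imp[OF assms(1,2) True[unfolded X]]) measurable
    obtain C where C: "C \<ge> 0" "\<And>R. R > 0 \<Longrightarrow> (\<integral>\<^sup>+x. ennreal ((norm (GTe (fst x) (snd x)))^2) \<partial>lebesgue_on ({0..R} \<times> Om lx ly))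
      \<le> (\<integral>\<^sup>+x. ennreal ((norm (G\<eta> (fst x) (snd x)))^2 + (norm (G\<psi> (fst x) (snd x)))^2) \<partial>lebesgue_on ({0..R} \<times> Om lx ly)) + ennreal C"
      using energy_bound[OF assms(1-3) fu assms(6) a b i fin] by blast
    show ?thesis unfolding X by (rule tavg_le_tavg[OF assms(1,2) C])
  next
    case False
    then have "X = top" by (metis infinity_ennreal_def top.not_eq_extremum)
    then show ?thesis by simp
  qed
qed

end
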